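(* Let $\phi$ be a positive function on $\Omega\times\mathbb{C}^n$ and suppose that $\phi\in L^{1,\infty}(\Omega\times\mathbb{C}^n,\,dw\,d\nu_2)$. Then for $1<p\le2$ there exists a constant $C_p$ (independent of $f$) such that for all $f\in L^p(\mathbb{H}^n)$, $$\left(\int_{\Omega\times\mathbb{C}^n}|\tilde f(a,w)|^p\,\phi(a,w)^{2-p}\,dw\,d\nu_2(a)\right)^{1/p}\le C_p\,\|f\|_p.$$
   Context: The Heisenberg group $\mathbb{H}^n=\mathbb{C}^n\times\mathbb{R}$ ($n\ge1$) has group law $(z,t)(w,s)=(z+w,\,t+s+\frac12\operatorname{Im}(z\cdot\bar w))$, with Lebesgue (Haar) measure $dz\,dt$. For $\delta>-1$, $k\in\{0,1,2,\dots\}$, the Laguerre polynomial is $L_k^\delta(t)=\frac{t^{-\delta}e^t}{k!}\left(\frac{d}{dt}\right)^k(e^{-t}t^{k+\delta})$. For $\lambda\in\mathbb{R}^*=\mathbb{R}\setminus\{0\}$ put $\varphi^{n-1}_{k,\lambda}(z)=L^{n-1}_k(\frac12|\lambda||z|^2)e^{-\frac14|\lambda||z|^2}$ and $e^{n-1}_{k,\lambda}(z,t)=e^{i\lambda t}\varphi^{n-1}_{k,\lambda}(z)$. The Heisenberg fan $\Omega$ is the union of the rays $R_k=\{(\lambda,(2k+n)|\lambda|):\lambda\in\mathbb{R}^*\}$, $k=0,1,2,\dots$, and $R_\infty=\{(0,\tau):\tau\ge0\}$. The Strichartz Fourier transform of $f\in L^1\cap L^2(\mathbb{H}^n)$ is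 the function on $\Omega\times\mathbb{C}^n$ given by $\widehat f(a,w)=\int_{\mathbb{H}^n}f(z,t)\,e_a((z,t)^{-1}(w,0))\,dz\,dt$ for $a=(\lambda,(2k+n)|\lambda|)\in R_k$, where $e_a=e^{n-1}_{k,\lambda}$, and $\widehat f(0,\tau,w)=(n-1)!\,2^{n-1}\int_{\mathbb{H}^n}f(z,t)\frac{J_{n-1}(\sqrt\tau|w-z|)}{(\sqrt\tau|w-z|)^{n-1}}\,dz\,dt$ on $R_\infty$ ($J_{n-1}$ the Bessel function). The normalized transform is $\tilde f(a,w)=\frac{k!(n-1)!}{(k+n-1)!}\widehat f(a,w)$ for $a\in R_k$ and $\tilde f(0,\tau,w)=\widehat f(0,\tau,w)$. The measure $\nu_2$ on $\Omega$ is defined by $$\int_\Omega\phi(a)\,d\nu_2(a)=(2\pi)^{-2n-1}\int_{-\infty}^\infty\left(\sum_{k=0}^\infty\left(\frac{(k+n-1)!}{k!(n-1)!}\right)^2\phi(\lambda,(2k+n)|\lambda|)\right)|\lambda|^{2n}\,d\lambda.$$ Known facts: $f\mapsto\tilde f$ is bounded from $L^1(\mathbb{H}^n)$ to $L^\infty(\Omega\times\mathbb{C}^n)$, is isometric from $L^2(\mathbb{H}^n)$ into $L^2(\Omega\times\mathbb{C}^n,dw\,d\nu_2)$, and hence is defined on $L^p(\mathbb{H}^n)$, $1\le p\le2$, by extension, with values in $L^{p'}(\Omega\times\mathbb{C}^n,dw\,d\nu_2)$. The condition $\phi\in L^{1,\infty}$ means $\phi$ is measurable and $\sup_{s>0}s\,(dw\,d\nu_2)\{(a,w):\phi(a,w)>s\}<\infty$.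 *)

theory Defs
  imports "HOL-Analysis.Analysis" "HOL-Computational_Algebra.Polynomial"
begin

section \<open>The Heisenberg group\<close>

text \<open>
  \<open>\<H>\<^sup>n\<close> is \<open>\<complex>\<^sup>n \<times> \<real>\<close> with \<open>n = CARD('n)\<close>. Its Haar measure is the Lebesgue measure of
  this Euclidean space.
\<close>

type_synonym 'n heis = "(complex, 'n) vec \<times> real"

definition herm :: "complex ^ 'n \<Rightarrow> complex ^ 'n \<Rightarrow> complex" where
  "herm z w = (\<Sum>i\<in>UNIV. z $ i * cnj (w $ i))"

definition heis_mult :: "('n::finite) heis \<Rightarrow> 'n heis \<Rightarrow> 'n heis" where
  "heis_mult x y = (fst x + fst y, snd x + snd y + Im (herm (fst x) (fst y)) / 2)"

definition heis_inv :: "('n::finite) heis \<Rightarrow> 'n heis" where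
  "heis_inv x = (- fst x, - snd x)"

lemma heis_inv_mult:
  "heis_mult (heis_inv x) x = (0, 0)" "heis_mult x (heis_inv x) = (0, 0)"
proof -
  have "Im (herm z z) = 0" for z :: "complex ^ 'n"
    by (simp add: herm_def)
  then show "heis_mult (heis_inv x) x = (0, 0)" "heis_mult x (heis_inv x) = (0, 0)"
    by (simp_all add: heis_mult_def heis_inv_def herm_def sum_negf)
qed


section \<open>Laguerre and Bessel functions\<close>

definition laguerre_rodrigues :: "real \<Rightarrow> nat \<Rightarrow> real \<Rightarrow> real" where
  "laguerre_rodrigues d k t =
     t powr (- d) * exp t / fact k * (deriv ^^ k) (\<lambda>x. exp (- x) * x powr (real k + d)) t"

text \<open>
  The Rodrigues expression is literally meaningful only for \<open>t > 0\<close>; the Laguerre polynomial is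
  the polynomial that it agrees with there. See \<open>poly_laguerre\<close> below for well-definedness.
\<close>

definition laguerre :: "real \<Rightarrow> nat \<Rightarrow> real poly" where
  "laguerre d k = (THE q. \<forall>t>0. poly q t = laguerre_rodrigues d k t)"

lemma deriv_funpow_exp_powr:
  "\<exists>q. \<forall>t>0. (deriv ^^ k) (\<lambda>x::real. exp (- x) * x powr a) t
           = exp (- t) * t powr (a - real k) * poly q t"
proof (induction k)
  case 0
  show ?case by (rule exI[of _ 1]) simp
next
  case (Suc k)
  then obtain q where q: "\<And>t. t > 0 \<Longrightarrow> (deriv ^^ k) (\<lambda>x::real. exp (- x) * x powr a) t
           = exp (- t) * t powr (a - real k) * poly q t" by blast
  let ?r = "[:a - real k, -1:] * q + [:0, 1:] * pderiv q"
  have "(deriv ^^ Suc k) (\<lambda>x::real. exp (- x) * x powr a) t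
           = exp (- t) * t powr (a - real (Suc k)) * poly ?r t" if t: "t > 0" for t
  proof -
    have p: "t powr (a - real k) = t powr (a - real (Suc k)) * t"
      using t by (simp add: powr_diff powr_add field_simps)
    have p': "t powr (a - real k - 1) = t powr (a - real (Suc k))"
      by (simp add: algebra_simps)
    have "((\<lambda>x. exp (- x) * x powr (a - real k) * poly q x) has_field_derivative
             exp (- t) * t powr (a - real (Suc k)) * poly ?r t) (at t)"
      using t
      by (auto intro!: derivative_eq_intros poly_DERIV simp: p' p)
         (simp add: algebra_simps p)
    then have "((deriv ^^ k) (\<lambda>x::real. exp (- x) * x powr a) has_field_derivative
             exp (- t) * t powr (a - real (Suc k)) * poly ?r t) (at t)"
      by (rule has_field_derivative_transform_within_open[where S = "{0<..}"])
         (use t q in auto)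
    then show ?thesis by (simp add: DERIV_imp_deriv)
  qed
  then show ?case by blast
qed

lemma poly_laguerre:
  assumes "t > 0"
  shows "poly (laguerre d k) t = laguerre_rodrigues d k t"
proof -
  obtain q where q: "\<And>t. t > 0 \<Longrightarrow> (deriv ^^ k) (\<lambda>x::real. exp (- x) * x powr (real k + d)) t
           = exp (- t) * t powr d * poly q t"
    using deriv_funpow_exp_powr[of k "real k + d"] by auto
  have 1: "\<forall>t>0. poly (smult (1 / fact k) q) t = laguerre_rodrigues d k t"
  proof (intro allI impI)
    fix t :: real
    assume t: "t > 0"
    have "exp t * exp (- t) = 1" "t powr - d * t powr d = 1"
      using t by (simp_all flip: exp_add powr_add)
    then have "t powr - d * exp t * (exp (- t) * t powr d * poly q t) = poly q t"
      by (simp add: mult_ac)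
    then show "poly (smult (1 / fact k) q) t = laguerre_rodrigues d k t"
      unfolding laguerre_rodrigues_def q[OF t] by simp
  qed
  have 2: "r = smult (1 / fact k) q" if "\<forall>t>0. poly r t = laguerre_rodrigues d k t" for r
  proof (rule ccontr)
    assume "r \<noteq> smult (1 / fact k) q"
    then have "finite {t. poly (r - smult (1 / fact k) q) t = 0}"
      by (intro poly_roots_finite) auto
    moreover have "{0<..} \<subseteq> {t. poly (r - smult (1 / fact k) q) t = 0}"
      using that 1 by auto
    ultimately show False
      using finite_subset infinite_Ioi by blast
  qed
  have "\<forall>t>0. poly (laguerre d k) t = laguerre_rodrigues d k t"
    unfolding laguerre_def by (rule theI2[where P = "\<lambda>q. \<forall>t>0. poly q t = laguerre_rodrigues d k t", OF 1 2])
  with assms show ?thesis by blast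
qed

definition bessel_J :: "nat \<Rightarrow> real \<Rightarrow> real" where
  "bessel_J m x = (\<Sum>j. (-1) ^ j / (fact j * fact (j + m)) * (x / 2) ^ (2 * j + m))"

text \<open>\<open>J\<^sub>m(x) / x\<^sup>m\<close>, extended continuously to \<open>x = 0\<close>.\<close>

definition bessel_quot :: "nat \<Rightarrow> real \<Rightarrow> real" where
  "bessel_quot m x = (if x = 0 then 1 / (2 ^ m * fact m) else bessel_J m x / x ^ m)"


section \<open>The Heisenberg fan\<close>

definition fan_ray :: "nat \<Rightarrow> nat \<Rightarrow> (real \<times> real) set" where
  "fan_ray n k = {(l, (2 * real k + real n) * \<bar>l\<bar>) | l. l \<noteq> 0}"

definition fan_ray_inf :: "(real \<times> real) set" where
  "fan_ray_inf = {(0, \<tau>) | \<tau>. \<tau> \<ge> 0}"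

definition heis_fan :: "nat \<Rightarrow> (real \<times> real) set" where
  "heis_fan n = (\<Union>k. fan_ray n k) \<union> fan_ray_inf"

definition fan_index :: "nat \<Rightarrow> real \<times> real \<Rightarrow> nat" where
  "fan_index n a = (THE k. a \<in> fan_ray n k)"

lemma fan_index_eq:
  assumes "a \<in> fan_ray n k"
  shows "fan_index n a = k"
  unfolding fan_index_def using assms by (intro the_equality) (auto simp: fan_ray_def)

definition fan_coeff :: "nat \<Rightarrow> nat \<Rightarrow> real" where
  "fan_coeff n k = fact (k + n - 1) / (fact k * fact (n - 1))"

text \<open>
  \<open>\<nu>\<^sub>2\<close> is the image of \<open>(2\<pi>)\<^bsup>-2n-1\<^esup> c\<^sub>k\<^sup>2 |l|\<^bsup>2n\<^esup> dl \<otimes> (counting measure in k)\<close> under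
  \<open>(l, k) \<mapsto> (l, (2k + n)|l|)\<close>, where \<open>c\<^sub>k = fan_coeff n k\<close>; the lemma \<open>nn_integral_nu2\<close> is its usual
  defining formula.
\<close>

definition nu2 :: "nat \<Rightarrow> (real \<times> real) measure" where
  "nu2 n =
     distr
       (density (lborel \<Otimes>\<^sub>M count_space UNIV)
         (\<lambda>(l, k). ennreal ((2 * pi) powi (- 2 * int n - 1) * (fan_coeff n k)\<^sup>2 * \<bar>l\<bar> ^ (2 * n))))
       (restrict_space borel (heis_fan n))
       (\<lambda>(l, k). (l, (2 * real k + real n) * \<bar>l\<bar>))"

lemma space_nu2: "space (nu2 n) = heis_fan n"
  by (simp add: nu2_def space_restrict_space)

lemma sets_nu2: "sets (nu2 n) = sets (restrict_space borel (heis_fan n))"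
  by (simp add: nu2_def)

lemma nn_integral_nu2:
  assumes h [measurable]: "h \<in> borel_measurable (restrict_space borel (heis_fan n))"
  shows "(\<integral>\<^sup>+ a. h a \<partial>nu2 n) =
    ennreal ((2 * pi) powi (- 2 * int n - 1)) *
      (\<integral>\<^sup>+ l. (\<Sum>k. ennreal ((fan_coeff n k)\<^sup>2) * h (l, (2 * real k + real n) * \<bar>l\<bar>))
               * ennreal (\<bar>l\<bar> ^ (2 * n)) \<partial>lborel)"
proof -
  let ?N = "lborel \<Otimes>\<^sub>M count_space (UNIV :: nat set)"
  let ?c = "(2 * pi) powi (- 2 * int n - 1)"
  let ?g = "\<lambda>(l, k). (l, (2 * real k + real n) * \<bar>l\<bar>)"
  let ?d = "\<lambda>(l, k). ennreal (?c * (fan_coeff n k)\<^sup>2 * \<bar>l\<bar> ^ (2 * n))"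
  interpret C: sigma_finite_measure "count_space (UNIV :: nat set)"
    by (rule sigma_finite_measure_count_space)
  have g [measurable]: "?g \<in> measurable ?N (restrict_space borel (heis_fan n))"
  proof (rule measurable_restrict_space2)
    show "?g \<in> space ?N \<rightarrow> heis_fan n"
      by (auto simp: heis_fan_def fan_ray_def fan_ray_inf_def)
    show "?g \<in> borel_measurable ?N"
      by measurable
  qed
  have d [measurable]: "?d \<in> borel_measurable ?N"
    by measurable
  have hg [measurable]: "(\<lambda>x. h (?g x)) \<in> borel_measurable ?N"
    by (rule measurable_compose[OF g h])
  have hk [measurable]: "(\<lambda>l. h (l, (2 * real k + real n) * \<bar>l\<bar>)) \<in> borel_measurable lborel" for k
    using measurable_compose[OF measurable_Pair1'[of k "count_space UNIV" lborel]]
      measurable_compose[of "\<lambda>l. (l, k)" lborel ?N "\<lambda>x. h (?g x)"] by simp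
  have c: "?c \<ge> 0" by simp
  have "(\<integral>\<^sup>+ a. h a \<partial>nu2 n) = (\<integral>\<^sup>+ x. ?d x * h (?g x) \<partial>?N)"
    unfolding nu2_def by (simp add: nn_integral_distr nn_integral_density)
  also have "\<dots> = (\<integral>\<^sup>+ l. \<integral>\<^sup>+ k. ?d (l, k) * h (?g (l, k)) \<partial>count_space UNIV \<partial>lborel)"
    by (rule C.nn_integral_fst[symmetric]) measurable
  also have "\<dots> = (\<integral>\<^sup>+ l. ennreal ?c *
      ((\<Sum>k. ennreal ((fan_coeff n k)\<^sup>2) * h (l, (2 * real k + real n) * \<bar>l\<bar>))
               * ennreal (\<bar>l\<bar> ^ (2 * n))) \<partial>lborel)"
    using c
    by (simp add: nn_integral_count_space_nat ennreal_mult mult_ac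
          flip: ennreal_suminf_cmult ennreal_suminf_multc)
  also have "\<dots> = ennreal ?c * (\<integral>\<^sup>+ l. (\<Sum>k. ennreal ((fan_coeff n k)\<^sup>2)
      * h (l, (2 * real k + real n) * \<bar>l\<bar>)) * ennreal (\<bar>l\<bar> ^ (2 * n)) \<partial>lborel)"
    by (rule nn_integral_cmult) measurable
  finally show ?thesis .
qed

text \<open>The measure \<open>dw d\<nu>\<^sub>2\<close> on \<open>\<Omega> \<times> \<complex>\<^sup>n\<close>, completed.\<close>

definition fan_measure :: "((real \<times> real) \<times> (complex ^ 'n)) measure" where
  "fan_measure = completion (nu2 CARD('n) \<Otimes>\<^sub>M lborel)"


section \<open>Lebesgue spaces\<close>

definition lp_space :: "real \<Rightarrow> 'a measure \<Rightarrow> ('a \<Rightarrow> complex) set" where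
  "lp_space p M = {f \<in> borel_measurable M. integrable M (\<lambda>x. norm (f x) powr p)}"

definition lp_norm :: "real \<Rightarrow> 'a measure \<Rightarrow> ('a \<Rightarrow> complex) \<Rightarrow> real" where
  "lp_norm p M f = (\<integral>x. norm (f x) powr p \<partial>M) powr (1 / p)"

text \<open>
  Convergence in \<open>L\<^sup>p\<close>, through the extended nonnegative integral so that a difference that is not
  \<open>p\<close>-integrable does not count as small.
\<close>

definition lp_tendsto :: "real \<Rightarrow> 'a measure \<Rightarrow> (nat \<Rightarrow> 'a \<Rightarrow> complex) \<Rightarrow> ('a \<Rightarrow> complex) \<Rightarrow> bool" where
  "lp_tendsto p M F f \<longleftrightarrow>
     (\<lambda>j. \<integral>\<^sup>+ x. ennreal (norm (F j x - f x) powr p) \<partial>M) \<longlonglongrightarrow> 0"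

definition weak_L1 :: "'a measure \<Rightarrow> ('a \<Rightarrow> real) \<Rightarrow> bool" where
  "weak_L1 M \<phi> \<longleftrightarrow> \<phi> \<in> borel_measurable M \<and>
     (SUP s\<in>{0<..}. ennreal s * emeasure M {x \<in> space M. \<phi> x > s}) < \<infinity>"


section \<open>The Strichartz Fourier transform\<close>

definition heis_phi :: "nat \<Rightarrow> real \<Rightarrow> complex ^ 'n \<Rightarrow> real" where
  "heis_phi k l z = poly (laguerre (real CARD('n) - 1) k) (\<bar>l\<bar> * (norm z)\<^sup>2 / 2)
                      * exp (- (\<bar>l\<bar> * (norm z)\<^sup>2 / 4))"

definition heis_e :: "nat \<Rightarrow> real \<Rightarrow> ('n::finite) heis \<Rightarrow> complex" where
  "heis_e k l x = cis (l * snd x) * of_real (heis_phi k l (fst x))"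

definition strichartz_hat :: "(('n::finite) heis \<Rightarrow> complex) \<Rightarrow> (real \<times> real) \<times> (complex ^ 'n) \<Rightarrow> complex" where
  "strichartz_hat f = (\<lambda>((l, \<tau>), w).
     if l \<noteq> 0 then
       \<integral>x. f x * heis_e (fan_index CARD('n) (l, \<tau>)) l (heis_mult (heis_inv x) (w, 0)) \<partial>lebesgue
     else
       fact (CARD('n) - 1) * 2 ^ (CARD('n) - 1) *
         (\<integral>x. f x * of_real (bessel_quot (CARD('n) - 1) (sqrt \<tau> * norm (w - fst x))) \<partial>lebesgue))"

definition strichartz_tilde :: "(('n::finite) heis \<Rightarrow> complex) \<Rightarrow> (real \<times> real) \<times> (complex ^ 'n) \<Rightarrow> complex" where
  "strichartz_tilde f = (\<lambda>(a, w).
     if fst a \<noteq> 0 then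
       strichartz_hat f (a, w) / of_real (fan_coeff CARD('n) (fan_index CARD('n) a))
     else strichartz_hat f (a, w))"

text \<open>
  \<open>has_strichartz_tilde p f g\<close> says that \<open>g\<close> represents the normalized transform of \<open>f\<close>, where the
  transform on \<open>L\<^sup>p\<close> (\<open>1 < p \<le> 2\<close>) is the continuous extension, as a map into \<open>L\<^bsup>p'\<^esup>\<close> with
  \<open>p' = p / (p - 1)\<close>, of the integral formula on \<open>L\<^sup>1 \<inter> L\<^sup>2\<close>. As an element of \<open>L\<^bsup>p'\<^esup>\<close>, \<open>g\<close> is
  determined only almost everywhere, hence a relation.
\<close>

definition has_strichartz_tilde ::
  "real \<Rightarrow> (('n::finite) heis \<Rightarrow> complex) \<Rightarrow> ((real \<times> real) \<times> (complex ^ 'n) \<Rightarrow> complex) \<Rightarrow> bool" where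
  "has_strichartz_tilde p f g \<longleftrightarrow>
     f \<in> lp_space p lebesgue \<and> g \<in> lp_space (p / (p - 1)) fan_measure \<and>
     (\<exists>F. (\<forall>j. F j \<in> lp_space 1 lebesgue \<inter> lp_space 2 lebesgue) \<and>
          lp_tendsto p lebesgue F f \<and>
          lp_tendsto (p / (p - 1)) fan_measure (\<lambda>j. strichartz_tilde (F j)) g)"

end

theory Submission
  imports Defs "HOL-Probability.Characteristic_Functions"
begin

text \<open>
  Division by \<open>\<phi>\<close> turns the transform into a linear operator into the measure \<open>\<phi>\<^sup>2 dw d\<nu>\<^sub>2\<close>. It is of
  weak type \<open>(1,1)\<close>, because \<open>\<phi>\<close> is in weak \<open>L\<^sup>1\<close> and the transform maps \<open>L\<^sup>1\<close> to \<open>L\<^sup>\<infinity>\<close>, and of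
  strong type \<open>(2,2)\<close> by Plancherel; Marcinkiewicz interpolation gives \<open>1 < p < 2\<close>, and Fatou's lemma
  passes from \<open>L\<^sup>1 \<inter> L\<^sup>2\<close> to \<open>L\<^sup>p\<close>.

  Both endpoint bounds rest on one identity. By the generating function of the Laguerre polynomials,
  \<open>\<Sum>\<^sub>k r\<^sup>k \<phi>\<^sub>k\<close> is a Gaussian, and the twisted convolution of two such Gaussians with parameters \<open>r\<close> and \<open>s\<close>
  is \<open>(2\<pi>/|\<lambda>|)\<^sup>n\<close> times the one with parameter \<open>r s\<close>. Comparing coefficients, \<open>\<phi>\<^sub>k\<close> is a reproducing
  kernel up to this factor. Cauchy--Schwarz then gives \<open>|\<phi>\<^sub>k| \<le> \<phi>\<^sub>k(0)\<close>, and a \<open>T T\<^sup>*\<close> argument with weight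
  \<open>r\<^sup>k\<close>, where \<open>T T\<^sup>*\<close> has a Gaussian kernel, gives the \<open>L\<^sup>2\<close> bound at a fixed frequency as
  \<open>r \<rightarrow> 1\<close>. The same argument with weight \<open>exp (- \<epsilon> \<lambda>\<^sup>2)\<close> gives Plancherel on the line.
\<close>


section \<open>Gaussian integrals and power series\<close>

text \<open>Only the inequality half of Plancherel is used, so any constant that survives the limit
  is good enough. This permits TT-star with Schur's test and avoids a completeness statement for the
  functions \<open>heis_phi\<close>. The regularizing weight is forced. At a fixed frequency the
  unweighted sum over k of the reproducing kernels is a multiple of a delta, not a function. With
  r^k it becomes a Gaussian whose mass stays bounded as r tends to 1. The bound that justifies
  Fubini is of size (1 - r)^(-n) and does blow up, which is harmless because it does not enter the
  final estimate. The normalization serves both endpoints. The largest value of |phi_k| is phi_k(0)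
  = \<open>fan_coeff n k\<close>, so dividing by it gives the L^1 to L^infinity bound with constant
  1. The square of the same factor in nu_2 cancels that division in L^2 and leaves the weight
  |lambda|^(2n), which absorbs the |lambda|^(-2n) of the fixed-frequency bound.\<close>

lemma gauss_fourier_real:
  fixes c b :: real
  assumes c: "c > 0"
  shows "has_bochner_integral lborel (\<lambda>x. of_real (exp (- c * x\<^sup>2)) * cis (b * x))
           (complex_of_real (sqrt (pi / c) * exp (- (b\<^sup>2 / (4 * c)))))"
proof -
  \<comment> \<open>With this scale (s x)^2 / 2 = c x^2, so the integral becomes the characteristic
    function of the standard normal law at b / s.\<close>
  define s where "s = sqrt (2 * c)"
  have s: "s > 0" "s\<^sup>2 = 2 * c" using c by (auto simp: s_def)
  define g where "g = (\<lambda>x. complex_of_real (std_normal_density x) * cis (b / s * x))"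
  have int: "integrable lborel g"
    unfolding g_def
  proof (rule Bochner_Integration.integrable_bound[of _ std_normal_density])
    show "(\<lambda>x. complex_of_real (std_normal_density x) * cis (b / s * x)) \<in> borel_measurable lborel"
      unfolding cis_conv_exp by measurable
  qed (auto simp: norm_mult)
  have "integral\<^sup>L lborel g = char std_normal_distribution (b / s)"
    unfolding char_def g_def
    by (subst integral_density) (auto simp: cis_conv_exp scaleR_conv_of_real)
  also have "\<dots> = of_real (exp (- (b\<^sup>2 / (4 * c))))"
    unfolding char_std_normal_distribution using s by (simp add: power_divide)
  finally have "has_bochner_integral lborel g (of_real (exp (- (b\<^sup>2 / (4 * c)))))"
    using int by (simp add: has_bochner_integral_iff)
  then have "has_bochner_integral lborel (\<lambda>x. g (0 + s * x)) (of_real (exp (- (b\<^sup>2 / (4 * c)))) /\<^sub>R \<bar>s\<bar>)"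
    using s by (subst (asm) lborel_has_bochner_integral_real_affine_iff[of s _ _ 0]) auto
  then have "has_bochner_integral lborel (\<lambda>x. of_real (sqrt (2 * pi)) * g (0 + s * x))
     (of_real (sqrt (2 * pi)) * (of_real (exp (- (b\<^sup>2 / (4 * c)))) /\<^sub>R \<bar>s\<bar>))"
    by (rule has_bochner_integral_mult_right)
  also have "(\<lambda>x. of_real (sqrt (2 * pi)) * g (0 + s * x)) = (\<lambda>x. of_real (exp (- c * x\<^sup>2)) * cis (b * x))"
    using s by (auto simp: g_def std_normal_density_def fun_eq_iff power_mult_distrib)
  also have "of_real (sqrt (2 * pi)) * (of_real (exp (- (b\<^sup>2 / (4 * c)))) /\<^sub>R \<bar>s\<bar>)
     = complex_of_real (sqrt (2 * pi) / s * exp (- (b\<^sup>2 / (4 * c))))"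
    using s by (simp add: scaleR_conv_of_real field_simps)
  also have "sqrt (2 * pi) / s = sqrt (pi / c)"
    by (simp add: s_def flip: real_sqrt_divide)
  finally show ?thesis .
qed

text \<open>\<open>lborel_eq\<close> presents Lebesgue measure as the image of the product measure
  over the coordinates in \<open>Basis\<close>, where Fubini for products of one-variable functions
  applies.\<close>

lemma has_bochner_integral_lborel_prod:
  fixes f :: "'a::euclidean_space \<Rightarrow> real \<Rightarrow> complex"
  assumes "\<And>b. b \<in> Basis \<Longrightarrow> has_bochner_integral lborel (f b) (v b)"
  shows "has_bochner_integral lborel (\<lambda>x. \<Prod>b\<in>Basis. f b (x \<bullet> b)) (\<Prod>b\<in>Basis. v b)"
proof -
  interpret product_sigma_finite "\<lambda>_::'a. lborel :: real measure" ..
  have int: "b \<in> Basis \<Longrightarrow> integrable lborel (f b)" for b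
    using assms by (auto simp: has_bochner_integral_iff)
  have [measurable]: "b \<in> Basis \<Longrightarrow> f b \<in> borel_measurable borel" for b
    using borel_measurable_integrable[OF int] by simp
  have eq: "(\<lambda>y. \<Prod>b\<in>Basis. f b ((\<Sum>i\<in>Basis. y i *\<^sub>R i) \<bullet> b)) = (\<lambda>y. \<Prod>b\<in>Basis. f b (y b))"
    by simp
  have m: "(\<lambda>y. \<Sum>b\<in>Basis. y b *\<^sub>R b) \<in> borel_measurable (\<Pi>\<^sub>M b\<in>(Basis::'a set). lborel)"
    by measurable
  have mp: "(\<lambda>x::'a. \<Prod>b\<in>Basis. f b (x \<bullet> b)) \<in> borel_measurable borel"
    by measurable
  show ?thesis
    unfolding has_bochner_integral_iff
    using product_integrable_prod[OF finite_Basis int] product_integral_prod[OF finite_Basis int] assms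
    by (subst (1 2) lborel_eq)
       (simp add: integrable_distr_eq[OF m mp] integral_distr[OF m mp] has_bochner_integral_iff
         del: borel_measurable_prod)
qed

lemma gauss_fourier:
  fixes b :: "'a::euclidean_space"
  assumes c: "c > 0"
  shows "has_bochner_integral lborel (\<lambda>x. of_real (exp (- c * (norm x)\<^sup>2)) * cis (b \<bullet> x))
           (complex_of_real (sqrt (pi / c) ^ DIM('a) * exp (- ((norm b)\<^sup>2 / (4 * c)))))"
proof -
  have nrm: "(norm x)\<^sup>2 = (\<Sum>i\<in>Basis. (x \<bullet> i)\<^sup>2)" for x :: 'a
    by (subst power2_norm_eq_inner, subst euclidean_inner) (simp add: power2_eq_square)
  have cs: "cis (sum g S) = (\<Prod>i\<in>S. cis (g i))" if "finite S" for g and S :: "'a set"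
    using that by induction (auto simp flip: cis_mult)
  have "has_bochner_integral lborel
     (\<lambda>x. \<Prod>i\<in>Basis. of_real (exp (- c * (x \<bullet> i)\<^sup>2)) * cis ((b \<bullet> i) * (x \<bullet> i)))
     (\<Prod>i\<in>Basis. complex_of_real (sqrt (pi / c) * exp (- ((b \<bullet> i)\<^sup>2 / (4 * c)))))"
    by (rule has_bochner_integral_lborel_prod[of "\<lambda>i x. of_real (exp (- c * x\<^sup>2)) * cis ((b \<bullet> i) * x)"])
       (rule gauss_fourier_real[OF c])
  also have "(\<lambda>x. \<Prod>i\<in>Basis. of_real (exp (- c * (x \<bullet> i)\<^sup>2)) * cis ((b \<bullet> i) * (x \<bullet> i)))
     = (\<lambda>x. of_real (exp (- c * (norm x)\<^sup>2)) * cis (b \<bullet> x))"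
  proof
    fix x :: 'a
    have "b \<bullet> x = (\<Sum>i\<in>Basis. (b \<bullet> i) * (x \<bullet> i))" by (rule euclidean_inner)
    moreover have "exp (- c * (norm x)\<^sup>2) = (\<Prod>i\<in>Basis. exp (- c * (x \<bullet> i)\<^sup>2))"
      by (subst nrm, subst sum_distrib_left, subst exp_sum) auto
    ultimately show "(\<Prod>i\<in>Basis. of_real (exp (- c * (x \<bullet> i)\<^sup>2)) * cis ((b \<bullet> i) * (x \<bullet> i)))
      = of_real (exp (- c * (norm x)\<^sup>2)) * cis (b \<bullet> x)"
      by (simp add: prod.distrib cs)
  qed
  also have "(\<Prod>i\<in>Basis. complex_of_real (sqrt (pi / c) * exp (- ((b \<bullet> i)\<^sup>2 / (4 * c)))))
     = complex_of_real (sqrt (pi / c) ^ DIM('a) * exp (- ((norm b)\<^sup>2 / (4 * c))))"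
  proof -
    have "- ((norm b)\<^sup>2 / (4 * c)) = (\<Sum>i\<in>Basis. - ((b \<bullet> i)\<^sup>2 / (4 * c)))"
      by (simp only: nrm sum_divide_distrib sum_negf)
    then have "exp (- ((norm b)\<^sup>2 / (4 * c))) = (\<Prod>i\<in>Basis. exp (- ((b \<bullet> i)\<^sup>2 / (4 * c))))"
      by (simp only: exp_sum[OF finite_Basis])
    then show ?thesis
      by (simp add: prod.distrib)
  qed
  finally show ?thesis .
qed

lemma nn_integral_gauss:
  assumes c: "c > 0"
  shows "(\<integral>\<^sup>+x. ennreal (exp (- c * (norm (x - y))\<^sup>2)) \<partial>(lborel :: 'a::euclidean_space measure)) = ennreal (sqrt (pi / c) ^ DIM('a))"
proof -
  have "has_bochner_integral lborel (\<lambda>x::'a. of_real (exp (- c * (norm x)\<^sup>2)) :: complex)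
       (of_real (sqrt (pi / c) ^ DIM('a)))"
    using gauss_fourier[OF c, of "0::'a"] by simp
  from has_bochner_integral_Re[OF this]
  have "has_bochner_integral lborel (\<lambda>x::'a. exp (- c * (norm x)\<^sup>2)) (sqrt (pi / c) ^ DIM('a))"
    by simp
  then have *: "(\<integral>\<^sup>+x. ennreal (exp (- c * (norm x)\<^sup>2)) \<partial>(lborel :: 'a measure)) = ennreal (sqrt (pi / c) ^ DIM('a))"
    by (auto simp: has_bochner_integral_iff intro!: nn_integral_eq_integral[THEN trans])
  show ?thesis
    by (subst lborel_distr_plus[of y, symmetric], subst nn_integral_distr) (use * in auto)
qed

text \<open>The limit at 0 kills the constant term, then the series is divided by x. The quotient
  series is known only for x different from 0, hence the limit lemma that ignores the value at the
  point.\<close>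

lemma powser_real_sums_0_imp:
  fixes a :: "nat \<Rightarrow> real"
  assumes s: "0 < s" and a: "\<And>x. norm x < s \<Longrightarrow> (\<lambda>n. a n * x ^ n) sums 0"
  shows "a n = 0"
  using a
proof (induction n arbitrary: a)
  case 0
  have "((\<lambda>x::real. 0::real) \<longlongrightarrow> a 0) (at 0)"
    using 0 by (rule powser_limit_0[OF s])
  then show ?case
    by (metis LIM_unique tendsto_const)
next
  case (Suc n)
  have "((\<lambda>x::real. 0::real) \<longlongrightarrow> a 0) (at 0)"
    using Suc.prems by (rule powser_limit_0[OF s])
  then have a0: "a 0 = 0" by (metis LIM_unique tendsto_const)
  define b where "b = (\<lambda>n. a (Suc n))"
  have nz: "(\<lambda>n. b n * x ^ n) sums 0" if "norm x < s" "x \<noteq> 0" for x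
  proof -
    have "(\<lambda>n. a (Suc n) * x ^ Suc n) sums 0"
      using Suc.prems[OF that(1)] a0 by (subst sums_Suc_iff) auto
    from sums_mult[OF this, of "1/x"] show ?thesis
      using that by (simp add: b_def field_simps)
  qed
  have "((\<lambda>x::real. 0::real) \<longlongrightarrow> b 0) (at 0)"
    by (rule powser_limit_0_strong[OF s]) (use nz in auto)
  then have "b 0 = 0" by (metis LIM_unique tendsto_const)
  then have "(\<lambda>n. b n * x ^ n) sums 0" if "norm x < s" for x
    using nz that powser_sums_zero[of b] by (cases "x = 0") auto
  from Suc.IH[OF this] show ?case by (simp add: b_def)
qed

text \<open>The variable stays real although the coefficients are complex: the parameters r and s of
  the Gaussians are real, while the integrals compared as coefficients carry a complex
  phase.\<close>

lemma powser_of_real_unique: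
  fixes a b :: "nat \<Rightarrow> complex"
  assumes s: "0 < s" 
    and a: "\<And>x::real. norm x < s \<Longrightarrow> (\<lambda>n. a n * of_real x ^ n) sums (f x)"
    and b: "\<And>x::real. norm x < s \<Longrightarrow> (\<lambda>n. b n * of_real x ^ n) sums (f x)"
  shows "a n = b n"
proof -
  have "(\<lambda>n. (a n - b n) * of_real x ^ n) sums 0" if "norm x < s" for x
    using sums_diff[OF a[OF that] b[OF that]] by (simp add: algebra_simps)
  then have "(\<lambda>n. Re (a n - b n) * x ^ n) sums 0" "(\<lambda>n. Im (a n - b n) * x ^ n) sums 0" if "norm x < s" for x
    using that by (auto simp: sums_complex_iff simp flip: of_real_power)
  from powser_real_sums_0_imp[OF s this(1)] powser_real_sums_0_imp[OF s this(2)]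
  have "Re (a n - b n) = 0" "Im (a n - b n) = 0" by blast+
  then show ?thesis by (simp add: complex_eq_iff)
qed


section \<open>Laguerre polynomials\<close>

text \<open>The classical closed form for integer order, which is the case at hand with d = n - 1.
  It makes sense at every real x, and its sum can be rearranged in the generating function.\<close>

definition laguerre_sum :: "nat \<Rightarrow> nat \<Rightarrow> real \<Rightarrow> real" where
  "laguerre_sum d k x = (\<Sum>j\<le>k. (- x) ^ j / fact j * real ((k + d) choose (k - j)))"

text \<open>Differentiating exp (- x) q(x) replaces q by q' - q, so the Rodrigues formula iterates D
  - 1 on a monomial. The right side is the binomial expansion of (D - 1)^m, and the induction step
  is Pascal's rule.\<close>

lemma coeff_funpow_pderiv_diff:
  "coeff (((\<lambda>q. pderiv q - q) ^^ m) (monom (1::real) N)) i =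
     (if i \<le> N then (- 1) ^ (m + N + i) * real (m choose (N - i)) * fact N / fact i else 0)"
proof (induction m arbitrary: i)
  case 0
  show ?case
    by (auto simp: coeff_monom le_less)
next
  case (Suc m)
  define q where "q = ((\<lambda>q. pderiv q - q) ^^ m) (monom (1::real) N)"
  have "coeff (((\<lambda>q. pderiv q - q) ^^ Suc m) (monom (1::real) N)) i = real (Suc i) * coeff q (Suc i) - coeff q i"
    by (simp add: q_def coeff_pderiv)
  moreover consider "i < N" | "i = N" | "i > N" by linarith
  then have "real (Suc i) * coeff q (Suc i) - coeff q i =
     (if i \<le> N then (- 1) ^ (Suc m + N + i) * real (Suc m choose (N - i)) * fact N / fact i else 0)"
  proof cases
    case 1
    then obtain t where t: "N - i = Suc t" "N - Suc i = t" by (metis Suc_diff_Suc)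
    have "real (Suc i) * coeff q (Suc i) = (- 1) ^ (Suc m + N + i) * real (m choose t) * fact N / fact i"
      using 1 t unfolding q_def Suc.IH by (simp add: divide_simps del: of_nat_Suc)
    moreover have "coeff q i = - ((- 1) ^ (Suc m + N + i) * real (m choose Suc t) * fact N / fact i)"
      using 1 t unfolding q_def Suc.IH by simp
    ultimately show ?thesis
      using 1 t by (simp add: field_simps)
  qed (simp_all add: q_def Suc.IH)
  ultimately show ?case by simp
qed

lemma deriv_funpow_exp_power:
  assumes "t > 0"
  shows "(deriv ^^ m) (\<lambda>x::real. exp (- x) * x powr real N) t
           = exp (- t) * poly (((\<lambda>q. pderiv q - q) ^^ m) (monom 1 N)) t"
  using assms
proof (induction m arbitrary: t)
  case 0
  then show ?case by (simp add: poly_monom powr_realpow)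
next
  case (Suc m)
  let ?q = "((\<lambda>q. pderiv q - q) ^^ m) (monom (1::real) N)"
  have "((\<lambda>x. exp (- x) * poly ?q x) has_field_derivative exp (- t) * poly (pderiv ?q - ?q) t) (at t)"
    by (auto intro!: derivative_eq_intros poly_DERIV simp: algebra_simps)
  then have "((deriv ^^ m) (\<lambda>x::real. exp (- x) * x powr real N) has_field_derivative
       exp (- t) * poly (pderiv ?q - ?q) t) (at t)"
    by (rule has_field_derivative_transform_within_open[where S = "{0<..}"])
       (use Suc in auto)
  then show ?case by (simp add: DERIV_imp_deriv)
qed

lemma laguerre_rodrigues_nat:
  assumes t: "t > 0"
  shows "laguerre_rodrigues (real d) k t = laguerre_sum d k t"
proof -
  let ?q = "((\<lambda>q. pderiv q - q) ^^ k) (monom (1::real) (k + d))"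
  have "degree ?q \<le> k + d"
    by (rule degree_le) (simp add: coeff_funpow_pderiv_diff)
  then have "poly ?q t = (\<Sum>i\<le>k + d. coeff ?q i * t ^ i)"
    unfolding poly_altdef by (intro sum.mono_neutral_left) (auto simp: coeff_eq_0)
  \<comment> \<open>For i < d the lower index k + d - i exceeds k and the binomial coefficient
    vanishes. Hence t^d factors out and cancels the \<open>t powr (- d)\<close> of the Rodrigues
    formula.\<close>
  also have "\<dots> = (\<Sum>i\<in>{d..k+d}. coeff ?q i * t ^ i)"
    by (rule sum.mono_neutral_right) (auto simp: coeff_funpow_pderiv_diff)
  also have "\<dots> = (\<Sum>j\<le>k. coeff ?q (j + d) * t ^ (j + d))"
    by (rule sum.reindex_bij_witness[of _ "\<lambda>j. j + d" "\<lambda>i. i - d"]) auto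
  also have "\<dots> = (\<Sum>j\<le>k. t ^ d * fact k * ((- t) ^ j / fact j * real ((k + d) choose (k - j))))"
  proof (rule sum.cong[OF refl])
    fix j assume "j \<in> {..k}"
    then have j: "j \<le> k" by simp
    have e: "(- 1::real) ^ (k + (k + d) + (j + d)) = (- 1) ^ j"
      by (rule minus_one_power_iff[THEN trans]) (auto simp: minus_one_power_iff)
    have b1: "real (k choose (k - j)) = fact k / (fact (k - j) * fact j)"
      using j by (subst binomial_fact) auto
    have b2: "real ((k + d) choose (k - j)) = fact (k + d) / (fact (k - j) * fact (d + j))"
      using j by (subst binomial_fact) (auto simp: algebra_simps)
    show "coeff ?q (j + d) * t ^ (j + d) = t ^ d * fact k * ((- t) ^ j / fact j * real ((k + d) choose (k - j)))"
      using j unfolding coeff_funpow_pderiv_diff e b2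
      by (simp add: b1 power_add power_minus[of t] field_simps)
  qed
  also have "\<dots> = t ^ d * fact k * laguerre_sum d k t"
    by (simp add: laguerre_sum_def sum_distrib_left)
  finally have p: "poly ?q t = t ^ d * fact k * laguerre_sum d k t" .
  have "exp t * exp (- t) = 1" "t powr - real d * t ^ d = 1"
    using t by (simp_all add: powr_minus powr_realpow flip: exp_add)
  then have "t powr - real d * exp t / fact k * (exp (- t) * (t ^ d * fact k * laguerre_sum d k t)) = laguerre_sum d k t"
    by (simp add: mult_ac) (metis (no_types, opaque_lifting) mult.assoc mult.commute mult_1)
  then show ?thesis
    unfolding laguerre_rodrigues_def of_nat_add[symmetric] deriv_funpow_exp_power[OF t] p .
qed

text \<open>The Rodrigues formula fixes the polynomial only on t > 0. Two polynomials that agree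
  there agree everywhere, in particular at 0, where the value of phi_k is needed.\<close>

lemma poly_laguerre_nat: "poly (laguerre (real d) k) x = laguerre_sum d k x"
proof -
  define r where "r = (\<Sum>j\<le>k. monom ((- 1) ^ j / fact j * real ((k + d) choose (k - j))) j)"
  have r: "poly r y = laguerre_sum d k y" for y
    unfolding r_def laguerre_sum_def
    by (simp add: poly_sum poly_monom power_minus[of y] mult_ac)
  have "laguerre (real d) k = r"
  proof (rule ccontr)
    assume "laguerre (real d) k \<noteq> r"
    then have "finite {t. poly (laguerre (real d) k - r) t = 0}"
      by (intro poly_roots_finite) auto
    moreover have "{0<..} \<subseteq> {t. poly (laguerre (real d) k - r) t = 0}"
      by (auto simp: poly_laguerre laguerre_rodrigues_nat r)
    ultimately show False
      using finite_subset infinite_Ioi by blast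
  qed
  with r show ?thesis by simp
qed

lemma abs_laguerre_sum_le: "\<bar>laguerre_sum d k x\<bar> \<le> laguerre_sum d k (- \<bar>x\<bar>)"
  unfolding laguerre_sum_def
  by (rule order_trans[OF sum_abs]) (auto simp: abs_mult power_abs)

text \<open>Newton's binomial series with exponent -(a + 1), rewritten by negating the upper
  index.\<close>

lemma negative_binomial_sums:
  fixes r :: real
  assumes r: "\<bar>r\<bar> < 1"
  shows "(\<lambda>m. real ((m + a) choose m) * r ^ m) sums (1 / (1 - r) ^ Suc a)"
proof -
  have "(\<lambda>m. (- real (Suc a) gchoose m) * (- r) ^ m) sums (1 + - r) powr (- real (Suc a))"
    using r by (intro gen_binomial_real) auto
  also have "(\<lambda>m. (- real (Suc a) gchoose m) * (- r) ^ m) = (\<lambda>m. real ((m + a) choose m) * r ^ m)"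
  proof
    fix m
    have "(- real (Suc a) gchoose m) = (- 1) ^ m * ((real m - (- real (Suc a)) - 1) gchoose m)"
      by (rule gbinomial_negated_upper)
    also have "real m - (- real (Suc a)) - 1 = real (m + a)" by simp
    finally show "(- real (Suc a) gchoose m) * (- r) ^ m = real ((m + a) choose m) * r ^ m"
      by (metis (no_types, lifting) binomial_gbinomial minus_mult_minus mult.commute mult.left_commute mult_1 power_mult_distrib)
  qed
  also have "(1 + - r) powr (- real (Suc a)) = 1 / (1 - r) ^ Suc a"
    using r by (simp add: powr_minus_divide powr_realpow del: of_nat_Suc)
  finally show ?thesis .
qed

text \<open>With k = j + m this is a double series. The sum over m is negative binomial, and the
  remaining sum over j is exponential. The same two sums at \<open>- \<bar>x\<bar>\<close> and
  \<open>\<bar>r\<bar>\<close> give the sum of the absolute values, which justifies regrouping along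
  k.\<close>

lemma laguerre_generating:
  fixes r x :: real
  assumes r: "\<bar>r\<bar> < 1"
  shows "(\<lambda>k. r ^ k * laguerre_sum d k x) sums (exp (- x * r / (1 - r)) / (1 - r) ^ Suc d)"
proof -
  define f where "f = (\<lambda>x r (j, m). (- x) ^ j / fact j * r ^ (j + m) * real ((j + m + d) choose m))"
  define g where "g = (\<lambda>x r j. ((- x * r / (1 - r)) ^ j / fact j) / (1 - r :: real) ^ Suc d)"
  have inner: "(\<lambda>m. f x r (j, m)) sums g x r j" if "\<bar>r\<bar> < 1" for x r j
  proof -
    have "(\<lambda>m. (- x * r) ^ j / fact j * (real ((m + (j + d)) choose m) * r ^ m)) sums
       ((- x * r) ^ j / fact j * (1 / (1 - r) ^ Suc (j + d)))"
      by (intro sums_mult negative_binomial_sums that)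
    also have "(- x * r) ^ j / fact j * (1 / (1 - r) ^ Suc (j + d)) = g x r j"
      using that unfolding g_def by (subst power_divide) (simp add: power_add)
    also have "(\<lambda>m. (- x * r) ^ j / fact j * (real ((m + (j + d)) choose m) * r ^ m)) = (\<lambda>m. f x r (j, m))"
      unfolding f_def prod.case power_mult_distrib power_add by (simp add: ac_simps)
    finally show ?thesis .
  qed
  have outer: "g x r sums (exp (- x * r / (1 - r)) / (1 - r) ^ Suc d)" if "\<bar>r\<bar> < 1" for x r
    unfolding g_def using exp_converges[of "- x * r / (1 - r)"]
    by (intro sums_divide) (simp add: inverse_eq_divide field_simps)
  have nf: "norm (f x r jm) = f (- \<bar>x\<bar>) \<bar>r\<bar> jm" for jm
    by (cases jm) (simp add: f_def abs_mult power_abs)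
  have hs: "((\<lambda>m. norm (f x r (j, m))) has_sum g (- \<bar>x\<bar>) \<bar>r\<bar> j) UNIV" for j
    unfolding nf by (rule sums_nonneg_imp_has_sum) (use inner[of "\<bar>r\<bar>" "- \<bar>x\<bar>" j] r in \<open>auto simp: f_def\<close>)
  have gs: "g (- \<bar>x\<bar>) \<bar>r\<bar> summable_on UNIV"
    by (rule summable_nonneg_imp_summable_on)
       (use outer[of "\<bar>r\<bar>" "- \<bar>x\<bar>"] r in \<open>auto simp: g_def sums_iff\<close>)
  have "(\<lambda>jm. norm (f x r jm)) summable_on (UNIV \<times> UNIV)"
    by (rule summable_on_SigmaI[OF _ gs]) (use hs in auto)
  then have abs: "f x r summable_on (UNIV \<times> UNIV)"
    by (rule abs_summable_summable)
  have "((\<lambda>m. f x r (j, m)) has_sum g x r j) UNIV" for j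
    by (rule norm_summable_imp_has_sum) (use hs[of j] inner[OF r] has_sum_imp_sums sums_summable in blast)+
  moreover have "(g x r has_sum (exp (- x * r / (1 - r)) / (1 - r) ^ Suc d)) UNIV"
  proof (rule norm_summable_imp_has_sum[OF _ outer[OF r]])
    have "norm (g x r j) \<le> g (- \<bar>x\<bar>) \<bar>r\<bar> j" for j
    proof -
      have "norm (g x r j) \<le> (\<Sum>m. norm (f x r (j, m)))"
        using inner[OF r, of x j] has_sum_imp_sums[OF hs[of j]]
        by (metis sums_unique summable_norm sums_summable)
      also have "\<dots> = g (- \<bar>x\<bar>) \<bar>r\<bar> j"
        using has_sum_imp_sums[OF hs[of j]] by (simp add: sums_iff)
      finally show ?thesis .
    qed
    then show "summable (\<lambda>j. norm (g x r j))"
      by (intro summable_comparison_test'[OF summable_on_imp_summable[OF gs], of 0]) auto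
  qed
  ultimately have "(f x r has_sum (exp (- x * r / (1 - r)) / (1 - r) ^ Suc d)) (UNIV \<times> UNIV)"
    using abs by (intro has_sum_SigmaI) auto
  also have "?this \<longleftrightarrow> ((\<lambda>(k, j). f x r (j, k - j)) has_sum (exp (- x * r / (1 - r)) / (1 - r) ^ Suc d)) (SIGMA k:UNIV. {..k})"
    by (rule has_sum_reindex_bij_witness[of _ "\<lambda>(k, j). (j, k - j)" "\<lambda>(j, m). (j + m, j)"]) auto
  finally have "((\<lambda>k. \<Sum>j\<le>k. f x r (j, k - j)) has_sum (exp (- x * r / (1 - r)) / (1 - r) ^ Suc d)) UNIV"
    by (rule has_sum_SigmaD) auto
  then have "(\<lambda>k. \<Sum>j\<le>k. f x r (j, k - j)) sums (exp (- x * r / (1 - r)) / (1 - r) ^ Suc d)"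
    by (rule has_sum_imp_sums)
  also have "(\<lambda>k. \<Sum>j\<le>k. f x r (j, k - j)) = (\<lambda>k. r ^ k * laguerre_sum d k x)"
    by (auto simp: f_def laguerre_sum_def sum_distrib_left fun_eq_iff intro!: sum.cong)
  finally show ?thesis .
qed

lemma laguerre_sum_0: "laguerre_sum d k 0 = real ((k + d) choose k)"
  by (subst laguerre_sum_def, subst sum.remove[of _ 0]) (auto intro!: sum.neutral)

text \<open>The generating function at \<open>r = 1/5\<close> has nonnegative terms when the argument is negated.\<close>

lemma laguerre_sum_exp_bound:
  assumes x: "x \<ge> 0"
  shows "\<bar>laguerre_sum d k x\<bar> * exp (- x / 2) \<le> (5 / 4) ^ Suc d * 5 ^ k * exp (- x / 4)"
proof -
  have nn: "laguerre_sum d k (- x) \<ge> 0" for k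
    using x by (auto simp: laguerre_sum_def intro!: sum_nonneg)
  \<comment> \<open>At r = 1/5 the growth factor is exp (x r / (1 - r)) = exp (x / 4), half of the
    available decay exp (- x / 2); any r below 1/3 would leave some decay. The price is the factor
    5^k, which is the reason for the radius 1/5 in the later power series.\<close>
  have s: "(\<lambda>k. (1/5) ^ k * laguerre_sum d k (- x)) sums (exp (x / 4) * (5 / 4) ^ Suc d)"
    using laguerre_generating[of "1/5" d "- x"] by (simp add: power_divide)
  have "5 ^ k * ((1/5) ^ k * laguerre_sum d k (- x)) \<le> 5 ^ k * (exp (x / 4) * (5 / 4) ^ Suc d)"
    using sum_le_suminf[OF sums_summable[OF s], of "{k}"] nn sums_unique[OF s]
    by (intro mult_left_mono) auto
  moreover have "\<bar>laguerre_sum d k x\<bar> \<le> laguerre_sum d k (- x)"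
    using abs_laguerre_sum_le[of d k x] x by simp
  ultimately have "\<bar>laguerre_sum d k x\<bar> \<le> 5 ^ k * (exp (x / 4) * (5 / 4) ^ Suc d)"
    by (simp add: power_divide)
  then have "\<bar>laguerre_sum d k x\<bar> * exp (- x / 2) \<le> 5 ^ k * (exp (x / 4) * (5 / 4) ^ Suc d) * exp (- x / 2)"
    by (intro mult_right_mono) auto
  also have "\<dots> = (5 / 4) ^ Suc d * 5 ^ k * (exp (x / 4) * exp (- x / 2))" by (simp add: mult_ac)
  also have "exp (x / 4) * exp (- x / 2) = exp (- x / 4)"
    by (simp flip: exp_add)
  finally show ?thesis .
qed


section \<open>The \<open>T T\<^sup>*\<close> bound\<close>

lemma borel_measurable_cnj [measurable (raw)]:
  "g \<in> borel_measurable M \<Longrightarrow> (\<lambda>x. cnj (g x)) \<in> borel_measurable M"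
  by (rule measurable_compose[OF _ borel_measurable_continuous_onI]) (auto intro: continuous_intros)

text \<open>The squared norm of the image is the double integral of f(x) cnj (f(x')) against the
  kernel of the composition with the adjoint. The inequality |f(x) f(x')| <= (|f(x)|^2 + |f(x')|^2)
  / 2 and the row and column bounds \<open>A\<close> then finish (Schur's test). The constant
  \<open>B\<close> serves only to make the triple integrand integrable for Fubini; it is absent from
  the conclusion, so it may degenerate when a regularization is removed.\<close>

lemma TT_star_bound:
  fixes K :: "'x \<Rightarrow> 'y \<Rightarrow> complex" and f :: "'x \<Rightarrow> complex" and R :: "'x \<Rightarrow> 'x \<Rightarrow> ennreal" and B :: real
  assumes sM: "sigma_finite_measure M" and sN: "sigma_finite_measure N"
    and K [measurable]: "case_prod K \<in> borel_measurable (M \<Otimes>\<^sub>M N)"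
    and f: "integrable M f"
    and B: "\<And>x x'. (\<integral>\<^sup>+y. ennreal (norm (K x y) * norm (K x' y)) \<partial>N) \<le> ennreal B"
    and R [measurable]: "case_prod R \<in> borel_measurable (M \<Otimes>\<^sub>M M)"
    and KR: "\<And>x x'. ennreal (norm (\<integral>y. K x y * cnj (K x' y) \<partial>N)) \<le> R x x'"
    and R1: "\<And>x. (\<integral>\<^sup>+x'. R x x' \<partial>M) \<le> A"
    and R2: "\<And>x'. (\<integral>\<^sup>+x. R x x' \<partial>M) \<le> A"
  shows "(\<integral>\<^sup>+y. ennreal ((norm (\<integral>x. f x * K x y \<partial>M))\<^sup>2) \<partial>N) \<le> A * (\<integral>\<^sup>+x. ennreal ((norm (f x))\<^sup>2) \<partial>M)"
proof -
  interpret M: sigma_finite_measure M by fact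
  interpret N: sigma_finite_measure N by fact
  interpret MM: pair_sigma_finite M M ..
  interpret MMN: pair_sigma_finite "M \<Otimes>\<^sub>M M" N ..
  have [measurable]: "f \<in> borel_measurable M" using f by auto
  define F where "F = (\<lambda>p y. f (fst p) * cnj (f (snd p)) * (K (fst p) y * cnj (K (snd p) y)))"
  have F1 [measurable]: "case_prod F \<in> borel_measurable ((M \<Otimes>\<^sub>M M) \<Otimes>\<^sub>M N)"
    unfolding F_def by measurable
  have F: "integrable ((M \<Otimes>\<^sub>M M) \<Otimes>\<^sub>M N) (case_prod F)"
    unfolding integrable_iff_bounded
  proof
    have "(\<integral>\<^sup>+z. ennreal (norm (case_prod F z)) \<partial>((M \<Otimes>\<^sub>M M) \<Otimes>\<^sub>M N))
      = (\<integral>\<^sup>+p. \<integral>\<^sup>+y. ennreal (norm (F p y)) \<partial>N \<partial>(M \<Otimes>\<^sub>M M))"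
      by (subst N.nn_integral_fst[symmetric]) (auto simp: case_prod_unfold)
    also have "\<dots> = (\<integral>\<^sup>+p. (\<integral>\<^sup>+y. ennreal (norm (f (fst p)) * norm (f (snd p))) * ennreal (norm (K (fst p) y) * norm (K (snd p) y)) \<partial>N) \<partial>(M \<Otimes>\<^sub>M M))"
      by (auto simp: F_def case_prod_unfold norm_mult ennreal_mult[symmetric] intro!: nn_integral_cong)
    also have "\<dots> \<le> (\<integral>\<^sup>+p. ennreal (norm (f (fst p)) * norm (f (snd p))) * ennreal B \<partial>(M \<Otimes>\<^sub>M M))"
    proof (rule nn_integral_mono)
      fix p assume p: "p \<in> space (M \<Otimes>\<^sub>M M)"
      then have [measurable]: "K (fst p) \<in> borel_measurable N" "K (snd p) \<in> borel_measurable N"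
        using K by (auto simp: space_pair_measure)
      show "(\<integral>\<^sup>+y. ennreal (norm (f (fst p)) * norm (f (snd p))) * ennreal (norm (K (fst p) y) * norm (K (snd p) y)) \<partial>N)
         \<le> ennreal (norm (f (fst p)) * norm (f (snd p))) * ennreal B"
        by (subst nn_integral_cmult) (auto intro!: mult_left_mono B)
    qed
    also have "\<dots> = (\<integral>\<^sup>+x. ennreal (norm (f x)) * ((\<integral>\<^sup>+x'. ennreal (norm (f x')) \<partial>M) * ennreal B) \<partial>M)"
      by (subst M.nn_integral_fst[symmetric])
         (auto simp: ennreal_mult nn_integral_cmult nn_integral_multc mult.assoc)
    also have "\<dots> = (\<integral>\<^sup>+x. ennreal (norm (f x)) \<partial>M) * ((\<integral>\<^sup>+x'. ennreal (norm (f x')) \<partial>M) * ennreal B)"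
      by (rule nn_integral_multc) auto
    also have "\<dots> < \<infinity>"
      using f unfolding integrable_iff_bounded by (auto simp: ennreal_mult_less_top)
    finally show "(\<integral>\<^sup>+z. ennreal (norm (case_prod F z)) \<partial>((M \<Otimes>\<^sub>M M) \<Otimes>\<^sub>M N)) < \<infinity>" .
  qed measurable
  define T where "T = (\<lambda>y. \<integral>x. f x * K x y \<partial>M)"
  have sq: "AE y in N. (\<integral>p. F p y \<partial>(M \<Otimes>\<^sub>M M)) = complex_of_real ((norm (T y))\<^sup>2)"
    using MMN.AE_integrable_snd[OF F]
  proof eventually_elim
    fix y assume "integrable (M \<Otimes>\<^sub>M M) (\<lambda>p. F p y)"
    then have "(\<integral>p. F p y \<partial>(M \<Otimes>\<^sub>M M)) = (\<integral>x. \<integral>x'. F (x, x') y \<partial>M \<partial>M)"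
      by (subst MM.integral_fst') auto
    also have "\<dots> = (\<integral>x. \<integral>x'. (f x * K x y) * cnj (f x' * K x' y) \<partial>M \<partial>M)"
      by (simp add: F_def mult_ac)
    also have "\<dots> = T y * cnj (T y)"
      by (simp only: T_def integral_mult_right_zero integral_mult_left_zero
            Bochner_Integration.integral_cnj[of M "\<lambda>x. f x * K x y"])
    finally show "(\<integral>p. F p y \<partial>(M \<Otimes>\<^sub>M M)) = complex_of_real ((norm (T y))\<^sup>2)"
      by (simp only: complex_norm_square)
  qed
  have int: "integrable N (\<lambda>y. \<integral>p. F p y \<partial>(M \<Otimes>\<^sub>M M))"
    by (rule MMN.integrable_snd[OF F])
  have Tm [measurable]: "T \<in> borel_measurable N"
    unfolding T_def by measurable
  have intT': "integrable N (\<lambda>y. complex_of_real ((norm (T y))\<^sup>2))"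
    using int by (rule integrable_cong_AE_imp) (use sq in \<open>auto elim: eventually_mono\<close>)
  then have intT: "integrable N (\<lambda>y. (norm (T y))\<^sup>2)"
    using complex_of_real_integrable_eq by blast
  have "(\<integral>\<^sup>+y. ennreal ((norm (T y))\<^sup>2) \<partial>N) = ennreal (\<integral>y. (norm (T y))\<^sup>2 \<partial>N)"
    by (rule nn_integral_eq_integral[OF intT]) auto
  also have "(\<integral>y. (norm (T y))\<^sup>2 \<partial>N) = norm (\<integral>y. complex_of_real ((norm (T y))\<^sup>2) \<partial>N)"
    unfolding integral_complex_of_real norm_of_real by simp
  also have "(\<integral>y. complex_of_real ((norm (T y))\<^sup>2) \<partial>N) = (\<integral>y. \<integral>p. F p y \<partial>(M \<Otimes>\<^sub>M M) \<partial>N)"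
    using int sq by (intro integral_cong_AE) (auto elim: eventually_mono)
  also have "\<dots> = (\<integral>p. \<integral>y. F p y \<partial>N \<partial>(M \<Otimes>\<^sub>M M))"
    by (rule MMN.Fubini_integral[OF F])
  also have "ennreal (norm \<dots>) \<le> (\<integral>\<^sup>+p. ennreal (norm (\<integral>y. F p y \<partial>N)) \<partial>(M \<Otimes>\<^sub>M M))"
    by (rule integral_norm_bound_ennreal[OF MMN.integrable_fst[OF F]])
  also have "\<dots> \<le> (\<integral>\<^sup>+p. ennreal ((norm (f (fst p)))\<^sup>2 / 2) * R (fst p) (snd p) +
      ennreal ((norm (f (snd p)))\<^sup>2 / 2) * R (fst p) (snd p) \<partial>(M \<Otimes>\<^sub>M M))"
  proof (rule nn_integral_mono)
    fix p :: "'x \<times> 'x"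
    obtain x x' where p: "p = (x, x')" by (cases p)
    have "norm (f x) * norm (f x') \<le> (norm (f x))\<^sup>2 / 2 + (norm (f x'))\<^sup>2 / 2"
      using sum_squares_bound[of "norm (f x)" "norm (f x')"] by simp
    then have le: "ennreal (norm (f x) * norm (f x')) \<le> ennreal ((norm (f x))\<^sup>2 / 2) + ennreal ((norm (f x'))\<^sup>2 / 2)"
      by (subst ennreal_plus[symmetric]) (auto intro!: ennreal_leI simp del: ennreal_plus)
    have "ennreal (norm (\<integral>y. F p y \<partial>N)) = ennreal (norm (f x) * norm (f x')) * ennreal (norm (\<integral>y. K x y * cnj (K x' y) \<partial>N))"
      by (simp add: F_def p norm_mult ennreal_mult)
    also have "\<dots> \<le> (ennreal ((norm (f x))\<^sup>2 / 2) + ennreal ((norm (f x'))\<^sup>2 / 2)) * R x x'"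
      by (rule mult_mono[OF le KR]) auto
    finally show "ennreal (norm (\<integral>y. F p y \<partial>N)) \<le> ennreal ((norm (f (fst p)))\<^sup>2 / 2) * R (fst p) (snd p) +
      ennreal ((norm (f (snd p)))\<^sup>2 / 2) * R (fst p) (snd p)"
      by (simp add: p distrib_right)
  qed
  also have "\<dots> = (\<integral>\<^sup>+p. ennreal ((norm (f (fst p)))\<^sup>2 / 2) * R (fst p) (snd p) \<partial>(M \<Otimes>\<^sub>M M)) +
      (\<integral>\<^sup>+p. ennreal ((norm (f (snd p)))\<^sup>2 / 2) * R (fst p) (snd p) \<partial>(M \<Otimes>\<^sub>M M))"
    by (rule nn_integral_add) measurable
  also have "\<dots> = (\<integral>\<^sup>+x. \<integral>\<^sup>+x'. ennreal ((norm (f x))\<^sup>2 / 2) * R x x' \<partial>M \<partial>M) +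
      (\<integral>\<^sup>+x'. \<integral>\<^sup>+x. ennreal ((norm (f x'))\<^sup>2 / 2) * R x x' \<partial>M \<partial>M)"
    by (subst M.nn_integral_fst[symmetric], measurable, subst MM.nn_integral_snd[symmetric], measurable)
  also have "\<dots> = (\<integral>\<^sup>+x. ennreal ((norm (f x))\<^sup>2 / 2) * (\<integral>\<^sup>+x'. R x x' \<partial>M) \<partial>M) +
      (\<integral>\<^sup>+x'. ennreal ((norm (f x'))\<^sup>2 / 2) * (\<integral>\<^sup>+x. R x x' \<partial>M) \<partial>M)"
    by (intro arg_cong2[where f = "(+)"] nn_integral_cong nn_integral_cmult) measurable
  also have "\<dots> \<le> (\<integral>\<^sup>+x. ennreal ((norm (f x))\<^sup>2 / 2) * A \<partial>M) + (\<integral>\<^sup>+x'. ennreal ((norm (f x'))\<^sup>2 / 2) * A \<partial>M)"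
    by (intro add_mono nn_integral_mono mult_left_mono R1 R2) auto
  also have "\<dots> = (\<integral>\<^sup>+x. ennreal ((norm (f x))\<^sup>2 / 2) * A + ennreal ((norm (f x))\<^sup>2 / 2) * A \<partial>M)"
    by (rule nn_integral_add[symmetric]) measurable
  also have "\<dots> = (\<integral>\<^sup>+x. A * ennreal ((norm (f x))\<^sup>2) \<partial>M)"
  proof (rule nn_integral_cong)
    fix x
    have "ennreal ((norm (f x))\<^sup>2 / 2) + ennreal ((norm (f x))\<^sup>2 / 2) = ennreal ((norm (f x))\<^sup>2)"
      by (simp flip: ennreal_plus)
    then show "ennreal ((norm (f x))\<^sup>2 / 2) * A + ennreal ((norm (f x))\<^sup>2 / 2) * A = A * ennreal ((norm (f x))\<^sup>2)"
      by (metis distrib_right mult.commute)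
  qed
  also have "\<dots> = A * (\<integral>\<^sup>+x. ennreal ((norm (f x))\<^sup>2) \<partial>M)"
    by (rule nn_integral_cmult) measurable
  finally show ?thesis by (simp add: T_def)
qed


section \<open>Marcinkiewicz interpolation with a weight in weak \<open>L\<^sup>1\<close>\<close>

lemma nn_integral_powr_Icc:
  assumes "a > -1" "b \<ge> 0"
  shows "(\<integral>\<^sup>+s. ennreal (s powr a) * indicator {0..b} s \<partial>lborel) = ennreal (b powr (a + 1) / (a + 1))"
  by (rule nn_integral_has_integral_lebesgue'[OF _ has_integral_powr_from_0]) (use assms in auto)

lemma nn_integral_powr_Ici:
  fixes a e :: real
  assumes "e < -1" "a > 0"
  shows "(\<integral>\<^sup>+s. ennreal (s powr e) * indicator {a..} s \<partial>lborel) = ennreal (- (a powr (e + 1)) / (e + 1))"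
  by (rule nn_integral_has_integral_lebesgue'[OF _ has_integral_powr_to_inf]) (use assms in auto)

text \<open>Positivity makes the level sets above 1 / (n + 1) exhaust the space, and the weak bound
  makes each of them finite. Tonelli thus becomes available on the completed fan measure.\<close>

lemma weak_L1_sigma_finite:
  fixes \<phi> :: "'y \<Rightarrow> real"
  assumes m [measurable]: "\<phi> \<in> borel_measurable M" and pos: "\<And>y. y \<in> space M \<Longrightarrow> \<phi> y > 0"
    and weak: "\<And>s. s > 0 \<Longrightarrow> ennreal s * emeasure M {y \<in> space M. \<phi> y > s} \<le> ennreal W"
  shows "sigma_finite_measure M"
proof
  define A where "A = (\<lambda>n::nat. {y \<in> space M. \<phi> y > 1 / Suc n})"
  have "emeasure M (A n) \<noteq> \<infinity>" for n
    using weak[of "1 / Suc n"] by (auto simp: A_def ennreal_mult_top top_unique)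
  moreover have "(\<Union>n. A n) = space M"
  proof safe
    fix y assume y: "y \<in> space M"
    obtain n where "1 / Suc n < \<phi> y" using nat_approx_posE[OF pos[OF y]] by auto
    with y show "y \<in> (\<Union>n. A n)" by (auto simp: A_def)
  qed (simp add: A_def)
  ultimately show "\<exists>A. countable A \<and> A \<subseteq> sets M \<and> \<Union> A = space M \<and> (\<forall>a\<in>A. emeasure M a \<noteq> \<infinity>)"
    by (intro exI[of _ "range A"]) (auto simp: A_def)
qed

text \<open>Layer cake: phi^2 is the integral of 2 t over t < phi, and the weak bound replaces t
  times the measure of {phi > t} by W for t up to a. This is the weak (1,1) estimate: if |T u| is
  bounded by b, then |T u| / phi >= s forces phi <= b / s.\<close>

lemma weak_L1_integral_square:
  fixes \<phi> :: "'y \<Rightarrow> real"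
  assumes m [measurable]: "\<phi> \<in> borel_measurable M" and pos: "\<And>y. y \<in> space M \<Longrightarrow> \<phi> y > 0"
    and weak: "\<And>s. s > 0 \<Longrightarrow> ennreal s * emeasure M {y \<in> space M. \<phi> y > s} \<le> ennreal W"
    and a: "a \<ge> 0" and W: "W \<ge> 0"
  shows "(\<integral>\<^sup>+y. ennreal ((\<phi> y)\<^sup>2) * indicator {y. \<phi> y \<le> a} y \<partial>M) \<le> ennreal (2 * a * W)"
proof -
  interpret sigma_finite_measure M by (rule weak_L1_sigma_finite[OF m pos weak])
  interpret pair_sigma_finite M "lborel :: real measure" ..
  define G where "G = (\<lambda>y t. ennreal (2 * t) * indicator {0..a} t * indicator {t. t < \<phi> y} t)"
  have G [measurable]: "case_prod G \<in> borel_measurable (M \<Otimes>\<^sub>M lborel)"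
    unfolding G_def by measurable
  have "(\<integral>\<^sup>+y. ennreal ((\<phi> y)\<^sup>2) * indicator {y. \<phi> y \<le> a} y \<partial>M) \<le> (\<integral>\<^sup>+y. \<integral>\<^sup>+t. G y t \<partial>lborel \<partial>M)"
  proof (rule nn_integral_mono)
    fix y assume y: "y \<in> space M"
    show "ennreal ((\<phi> y)\<^sup>2) * indicator {y. \<phi> y \<le> a} y \<le> (\<integral>\<^sup>+t. G y t \<partial>lborel)"
    proof (cases "\<phi> y \<le> a")
      case True
      have "((\<lambda>t. 2 * t) has_integral ((\<phi> y)\<^sup>2 - 0\<^sup>2)) {0..\<phi> y}"
        using pos[OF y] by (intro fundamental_theorem_of_calculus)
          (auto intro!: derivative_eq_intros simp flip: has_real_derivative_iff_has_vector_derivative)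
      then have "ennreal ((\<phi> y)\<^sup>2) = (\<integral>\<^sup>+t. ennreal (2 * t) * indicator {0..\<phi> y} t \<partial>lborel)"
        by (subst nn_integral_has_integral_lebesgue') auto
      also have "\<dots> \<le> (\<integral>\<^sup>+t. G y t \<partial>lborel)"
      proof (rule nn_integral_mono_AE)
        show "AE t in lborel. ennreal (2 * t) * indicator {0..\<phi> y} t \<le> G y t"
          using AE_lborel_singleton[of "\<phi> y"]
          by eventually_elim (use True in \<open>auto simp: G_def indicator_def\<close>)
      qed
      finally show ?thesis using True by simp
    qed simp
  qed
  also have "\<dots> = (\<integral>\<^sup>+t. \<integral>\<^sup>+y. G y t \<partial>M \<partial>lborel)"
    by (rule Fubini'[symmetric]) measurable
  also have "\<dots> \<le> (\<integral>\<^sup>+t. ennreal (2 * W) * indicator {0..a} t \<partial>lborel)"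
  proof (rule nn_integral_mono)
    fix t :: real
    have "(\<integral>\<^sup>+y. G y t \<partial>M) = (\<integral>\<^sup>+y. (ennreal (2 * t) * indicator {0..a} t) * indicator {y \<in> space M. \<phi> y > t} y \<partial>M)"
      by (intro nn_integral_cong) (auto simp: G_def indicator_def)
    also have "\<dots> = (ennreal (2 * t) * indicator {0..a} t) * emeasure M {y \<in> space M. \<phi> y > t}"
      by (rule nn_integral_cmult_indicator) measurable
    also have "\<dots> \<le> ennreal (2 * W) * indicator {0..a} t"
    proof (cases "t > 0")
      case True
      then have "ennreal (2 * t) * emeasure M {y \<in> space M. \<phi> y > t} \<le> 2 * ennreal W"
        using mult_left_mono[OF weak[OF True], of 2] by (simp add: ennreal_mult mult.assoc)
      then show ?thesis
        using W by (auto simp: indicator_def ennreal_mult)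
    next
      case False
      then have "ennreal (2 * t) = 0" by (simp add: ennreal_eq_0_iff)
      then show ?thesis by simp
    qed
    finally show "(\<integral>\<^sup>+y. G y t \<partial>M) \<le> ennreal (2 * W) * indicator {0..a} t" .
  qed
  also have "\<dots> = ennreal (2 * a * W)"
    using a W by (subst nn_integral_cmult_indicator) (auto simp: mult_ac simp flip: ennreal_mult)
  finally show ?thesis .
qed

text \<open>The domain on which both endpoint bounds hold. It is stable under truncation at a
  height, as the splitting in the interpolation requires.\<close>

definition L1_L2 :: "'x measure \<Rightarrow> ('x \<Rightarrow> complex) set" where
  "L1_L2 N = {f. integrable N f \<and> integrable N (\<lambda>x. (norm (f x))\<^sup>2)}"

lemma L1_L2_if:
  assumes f: "f \<in> L1_L2 N" and P [measurable]: "Measurable.pred N P"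
  shows "(\<lambda>x. if P x then f x else 0) \<in> L1_L2 N"
proof -
  have i: "integrable N f" "integrable N (\<lambda>x. (norm (f x))\<^sup>2)" using f by (auto simp: L1_L2_def)
  have [measurable]: "f \<in> borel_measurable N" using i by auto
  show ?thesis
    unfolding L1_L2_def
    by (auto intro: Bochner_Integration.integrable_bound[OF i(1)] Bochner_Integration.integrable_bound[OF i(2)])
qed

context
  fixes M :: "'y measure" and N :: "'x measure" and \<phi> :: "'y \<Rightarrow> real"
    and T :: "('x \<Rightarrow> complex) \<Rightarrow> 'y \<Rightarrow> complex" and W A\<^sub>1 A\<^sub>2 :: real
  assumes sN: "sigma_finite_measure N"
    and phi [measurable]: "\<phi> \<in> borel_measurable M" and pos: "\<And>y. y \<in> space M \<Longrightarrow> \<phi> y > 0"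
    and weak: "\<And>s. s > 0 \<Longrightarrow> ennreal s * emeasure M {y \<in> space M. \<phi> y > s} \<le> ennreal W"
    and nn: "W \<ge> 0" "A\<^sub>1 \<ge> 0" "A\<^sub>2 \<ge> 0"
    and T: "\<And>f. f \<in> L1_L2 N \<Longrightarrow> T f \<in> borel_measurable M"
    and add: "\<And>f g. f \<in> L1_L2 N \<Longrightarrow> g \<in> L1_L2 N \<Longrightarrow> AE y in M. T (\<lambda>x. f x + g x) y = T f y + T g y"
    and T1: "\<And>f. f \<in> L1_L2 N \<Longrightarrow> AE y in M. norm (T f y) \<le> A\<^sub>1 * (\<integral>x. norm (f x) \<partial>N)"
    and T2: "\<And>f. f \<in> L1_L2 N \<Longrightarrow>
       (\<integral>\<^sup>+y. ennreal ((norm (T f y))\<^sup>2) \<partial>M) \<le> ennreal A\<^sub>2 * (\<integral>\<^sup>+x. ennreal ((norm (f x))\<^sup>2) \<partial>N)"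
begin

text \<open>The left side is the phi^2-measure of the set where |T f| / phi >= s. Split f at height
  s into a large part u and a small part v. On that set either phi <= 2 \<open>A\<^sub>1\<close>
  |u|_1 / s, which \<open>weak_L1_integral_square\<close> handles, or s phi <= 2 |T v|, which is
  Chebyshev with the L^2 bound.\<close>

lemma paley_level_bound:
  assumes f: "f \<in> L1_L2 N" and s: "s > 0"
  shows "(\<integral>\<^sup>+y. ennreal ((\<phi> y)\<^sup>2) * indicator {y. s * \<phi> y \<le> norm (T f y)} y \<partial>M) \<le>
    (\<integral>\<^sup>+x. ennreal (4 * A\<^sub>1 * W / s * norm (f x)) * indicator {x. s \<le> norm (f x)} x \<partial>N) +
    (\<integral>\<^sup>+x. ennreal (4 * A\<^sub>2 / s\<^sup>2 * (norm (f x))\<^sup>2) * indicator {x. norm (f x) < s} x \<partial>N)"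
proof -
  have [measurable]: "f \<in> borel_measurable N" using f by (auto simp: L1_L2_def)
  define u where "u = (\<lambda>x. if s \<le> norm (f x) then f x else 0)"
  define v where "v = (\<lambda>x. if \<not> s \<le> norm (f x) then f x else 0)"
  have uv: "u \<in> L1_L2 N" "v \<in> L1_L2 N"
    unfolding u_def v_def by (intro L1_L2_if f; measurable)+
  note [measurable] = T[OF f] T[OF uv(1)] T[OF uv(2)]
  have [measurable]: "u \<in> borel_measurable N" "v \<in> borel_measurable N"
    unfolding u_def v_def by measurable
  define U where "U = (\<integral>x. norm (u x) \<partial>N)"
  have U0: "U \<ge> 0" by (simp add: U_def)
  have iu: "integrable N (\<lambda>x. norm (u x))" using uv by (auto simp: L1_L2_def)
  have eu: "ennreal U = (\<integral>\<^sup>+x. ennreal (norm (u x)) \<partial>N)"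
    unfolding U_def using iu by (subst nn_integral_eq_integral) auto
  have "(\<lambda>x. u x + v x) = f" by (auto simp: u_def v_def)
  with add[OF uv] have AE: "AE y in M. T f y = T u y + T v y" by simp
  have "(\<integral>\<^sup>+y. ennreal ((\<phi> y)\<^sup>2) * indicator {y. s * \<phi> y \<le> norm (T f y)} y \<partial>M) \<le>
     (\<integral>\<^sup>+y. ennreal ((\<phi> y)\<^sup>2) * indicator {y. \<phi> y \<le> 2 * (A\<^sub>1 * U) / s} y
        + ennreal (4 / s\<^sup>2) * ennreal ((norm (T v y))\<^sup>2) \<partial>M)"
  proof (rule nn_integral_mono_AE)
    show "AE y in M. ennreal ((\<phi> y)\<^sup>2) * indicator {y. s * \<phi> y \<le> norm (T f y)} y
      \<le> ennreal ((\<phi> y)\<^sup>2) * indicator {y. \<phi> y \<le> 2 * (A\<^sub>1 * U) / s} y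
        + ennreal (4 / s\<^sup>2) * ennreal ((norm (T v y))\<^sup>2)"
      using AE T1[OF uv(1)] AE_space
    proof eventually_elim
      fix y assume y: "T f y = T u y + T v y" "norm (T u y) \<le> A\<^sub>1 * (\<integral>x. norm (u x) \<partial>N)" "y \<in> space M"
      show "ennreal ((\<phi> y)\<^sup>2) * indicator {y. s * \<phi> y \<le> norm (T f y)} y
      \<le> ennreal ((\<phi> y)\<^sup>2) * indicator {y. \<phi> y \<le> 2 * (A\<^sub>1 * U) / s} y
        + ennreal (4 / s\<^sup>2) * ennreal ((norm (T v y))\<^sup>2)"
      proof (cases "s * \<phi> y \<le> norm (T f y)")
        case True
        show ?thesis
        proof (cases "\<phi> y \<le> 2 * (A\<^sub>1 * U) / s")
          case False
          then have "s * \<phi> y > 2 * (A\<^sub>1 * U)" using s by (simp add: field_simps)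
          moreover have "norm (T f y) \<le> norm (T u y) + norm (T v y)"
            unfolding y(1) by (rule norm_triangle_ineq)
          ultimately have "s * \<phi> y \<le> 2 * norm (T v y)"
            using True y(2) by (simp add: U_def)
          then have "\<phi> y \<le> (2 / s) * norm (T v y)" using s by (simp add: field_simps)
          then have "(\<phi> y)\<^sup>2 \<le> ((2 / s) * norm (T v y))\<^sup>2"
            using pos[OF y(3)] by (intro power_mono) auto
          then have "ennreal ((\<phi> y)\<^sup>2) \<le> ennreal (4 / s\<^sup>2) * ennreal ((norm (T v y))\<^sup>2)"
            by (simp add: power_mult_distrib power_divide flip: ennreal_mult)
          then show ?thesis using True False by simp
        qed (use True in auto)
      qed simp
    qed
  qed
  also have "\<dots> = (\<integral>\<^sup>+y. ennreal ((\<phi> y)\<^sup>2) * indicator {y. \<phi> y \<le> 2 * (A\<^sub>1 * U) / s} y \<partial>M)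
     + ennreal (4 / s\<^sup>2) * (\<integral>\<^sup>+y. ennreal ((norm (T v y))\<^sup>2) \<partial>M)"
    by (subst nn_integral_add) (auto simp: nn_integral_cmult)
  also have "\<dots> \<le> ennreal (2 * (2 * (A\<^sub>1 * U) / s) * W)
      + ennreal (4 / s\<^sup>2) * (ennreal A\<^sub>2 * (\<integral>\<^sup>+x. ennreal ((norm (v x))\<^sup>2) \<partial>N))"
    by (intro add_mono mult_left_mono T2 uv weak_L1_integral_square pos weak phi) (use s nn U0 in auto)
  also have "ennreal (2 * (2 * (A\<^sub>1 * U) / s) * W) = ennreal (4 * A\<^sub>1 * W / s) * ennreal U"
    using nn U0 s by (subst ennreal_mult[symmetric]) (auto simp: mult_ac)
  also have "\<dots> = (\<integral>\<^sup>+x. ennreal (4 * A\<^sub>1 * W / s) * ennreal (norm (u x)) \<partial>N)"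
    unfolding eu by (rule nn_integral_cmult[symmetric]) measurable
  also have "\<dots> = (\<integral>\<^sup>+x. ennreal (4 * A\<^sub>1 * W / s * norm (f x)) * indicator {x. s \<le> norm (f x)} x \<partial>N)"
    using nn s by (intro nn_integral_cong) (auto simp: u_def indicator_def simp flip: ennreal_mult)
  also have "ennreal (4 / s\<^sup>2) * (ennreal A\<^sub>2 * (\<integral>\<^sup>+x. ennreal ((norm (v x))\<^sup>2) \<partial>N))
     = (\<integral>\<^sup>+x. ennreal (4 * A\<^sub>2 / s\<^sup>2) * ennreal ((norm (v x))\<^sup>2) \<partial>N)"
    using nn by (subst nn_integral_cmult) (auto simp: mult.assoc[symmetric] simp flip: ennreal_mult)
  also have "\<dots> = (\<integral>\<^sup>+x. ennreal (4 * A\<^sub>2 / s\<^sup>2 * (norm (f x))\<^sup>2) * indicator {x. norm (f x) < s} x \<partial>N)"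
    using nn s by (intro nn_integral_cong) (auto simp: v_def indicator_def simp flip: ennreal_mult)
  finally show ?thesis .
qed

text \<open>Integrate the level bound against p s^(p-1) ds and exchange the integrals. The large
  part leaves s^(p-2) on (0, |f|], integrable because p > 1; the small part leaves s^(p-3) beyond
  |f|, integrable because p < 2. Both give |f|^p, with denominators p - 1 and 2 - p.\<close>

lemma paley_marcinkiewicz:
  assumes f: "f \<in> L1_L2 N" and p: "1 < p" "p < 2"
  shows "(\<integral>\<^sup>+y. ennreal (norm (T f y) powr p * \<phi> y powr (2 - p)) \<partial>M) \<le>
    ennreal (4 * p * A\<^sub>1 * W / (p - 1) + 4 * p * A\<^sub>2 / (2 - p)) * (\<integral>\<^sup>+x. ennreal (norm (f x) powr p) \<partial>N)"
proof -
  interpret M: sigma_finite_measure M by (rule weak_L1_sigma_finite[OF phi pos weak])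
  interpret N: sigma_finite_measure N by fact
  interpret MS: pair_sigma_finite M "lborel :: real measure" ..
  interpret NS: pair_sigma_finite N "lborel :: real measure" ..
  have [measurable]: "f \<in> borel_measurable N" using f by (auto simp: L1_L2_def)
  note [measurable] = T[OF f]
  define c\<^sub>1 where "c\<^sub>1 = 4 * p * A\<^sub>1 * W"
  define c\<^sub>2 where "c\<^sub>2 = 4 * p * A\<^sub>2"
  have c: "c\<^sub>1 \<ge> 0" "c\<^sub>2 \<ge> 0" using nn p by (auto simp: c\<^sub>1_def c\<^sub>2_def)
  define G where "G = (\<lambda>y s. ennreal (p * s powr (p - 1)) * indicator {0<..} s *
     (ennreal ((\<phi> y)\<^sup>2) * indicator {y. s * \<phi> y \<le> norm (T f y)} y))"
  have G [measurable]: "case_prod G \<in> borel_measurable (M \<Otimes>\<^sub>M lborel)"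
    unfolding G_def by measurable
  define H\<^sub>1 where "H\<^sub>1 = (\<lambda>x s. ennreal (c\<^sub>1 * s powr (p - 2) * norm (f x)) * indicator {s. 0 < s \<and> s \<le> norm (f x)} s)"
  define H\<^sub>2 where "H\<^sub>2 = (\<lambda>x s. ennreal (c\<^sub>2 * s powr (p - 3) * (norm (f x))\<^sup>2) * indicator {s. 0 < s \<and> norm (f x) < s} s)"
  have H [measurable]: "case_prod H\<^sub>1 \<in> borel_measurable (N \<Otimes>\<^sub>M lborel)" "case_prod H\<^sub>2 \<in> borel_measurable (N \<Otimes>\<^sub>M lborel)"
    unfolding H\<^sub>1_def H\<^sub>2_def by measurable
  have "(\<integral>\<^sup>+y. ennreal (norm (T f y) powr p * \<phi> y powr (2 - p)) \<partial>M) = (\<integral>\<^sup>+y. \<integral>\<^sup>+s. G y s \<partial>lborel \<partial>M)"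
  proof (rule nn_integral_cong)
    fix y assume y: "y \<in> space M"
    define t where "t = norm (T f y) / \<phi> y"
    have ph: "\<phi> y > 0" using pos[OF y] .
    then have t: "t \<ge> 0" by (simp add: t_def)
    \<comment> \<open>The identity behind the exponent 2 - p: relative to the measure phi^2 the
      weighted integral is the plain p-th power integral of |T f| / phi.\<close>
    have "norm (T f y) powr p * \<phi> y powr (2 - p) = (\<phi> y)\<^sup>2 * t powr p"
      using ph by (simp add: t_def powr_divide powr_diff field_simps)
    also have "ennreal \<dots> = ennreal ((\<phi> y)\<^sup>2) * (ennreal p * ennreal (t powr (p - 1 + 1) / (p - 1 + 1)))"
      using p by (simp flip: ennreal_mult)
    also have "ennreal (t powr (p - 1 + 1) / (p - 1 + 1)) = (\<integral>\<^sup>+s. ennreal (s powr (p - 1)) * indicator {0..t} s \<partial>lborel)"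
      using p t by (subst nn_integral_powr_Icc) auto
    also have "ennreal ((\<phi> y)\<^sup>2) * (ennreal p * \<dots>)
       = (\<integral>\<^sup>+s. ennreal ((\<phi> y)\<^sup>2) * (ennreal p * (ennreal (s powr (p - 1)) * indicator {0..t} s)) \<partial>lborel)"
      by (simp add: nn_integral_cmult)
    also have "\<dots> = (\<integral>\<^sup>+s. G y s \<partial>lborel)"
    proof (rule nn_integral_cong)
      fix s :: real
      show "ennreal ((\<phi> y)\<^sup>2) * (ennreal p * (ennreal (s powr (p - 1)) * indicator {0..t} s)) = G y s"
        using ph p by (cases "s = 0") (auto simp: G_def t_def indicator_def field_simps ennreal_mult)
    qed
    finally show "ennreal (norm (T f y) powr p * \<phi> y powr (2 - p)) = (\<integral>\<^sup>+s. G y s \<partial>lborel)" .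
  qed
  also have "\<dots> = (\<integral>\<^sup>+s. \<integral>\<^sup>+y. G y s \<partial>M \<partial>lborel)"
    by (rule MS.Fubini'[symmetric]) measurable
  also have "\<dots> \<le> (\<integral>\<^sup>+s. (\<integral>\<^sup>+x. H\<^sub>1 x s \<partial>N) + (\<integral>\<^sup>+x. H\<^sub>2 x s \<partial>N) \<partial>lborel)"
  proof (rule nn_integral_mono)
    fix s :: real
    show "(\<integral>\<^sup>+y. G y s \<partial>M) \<le> (\<integral>\<^sup>+x. H\<^sub>1 x s \<partial>N) + (\<integral>\<^sup>+x. H\<^sub>2 x s \<partial>N)"
    proof (cases "s > 0")
      case True
      have "(\<integral>\<^sup>+y. G y s \<partial>M) = ennreal (p * s powr (p - 1)) *
          (\<integral>\<^sup>+y. ennreal ((\<phi> y)\<^sup>2) * indicator {y. s * \<phi> y \<le> norm (T f y)} y \<partial>M)"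
        unfolding G_def using True by (subst nn_integral_cmult) auto
      also have "\<dots> \<le> ennreal (p * s powr (p - 1)) *
        ((\<integral>\<^sup>+x. ennreal (4 * A\<^sub>1 * W / s * norm (f x)) * indicator {x. s \<le> norm (f x)} x \<partial>N) +
         (\<integral>\<^sup>+x. ennreal (4 * A\<^sub>2 / s\<^sup>2 * (norm (f x))\<^sup>2) * indicator {x. norm (f x) < s} x \<partial>N))"
        by (intro mult_left_mono paley_level_bound f True) auto
      also have "\<dots> = (\<integral>\<^sup>+x. ennreal (p * s powr (p - 1)) * (ennreal (4 * A\<^sub>1 * W / s * norm (f x)) * indicator {x. s \<le> norm (f x)} x) \<partial>N) +
         (\<integral>\<^sup>+x. ennreal (p * s powr (p - 1)) * (ennreal (4 * A\<^sub>2 / s\<^sup>2 * (norm (f x))\<^sup>2) * indicator {x. norm (f x) < s} x) \<partial>N)"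
        by (simp add: distrib_left nn_integral_cmult)
      also have "\<dots> = (\<integral>\<^sup>+x. H\<^sub>1 x s \<partial>N) + (\<integral>\<^sup>+x. H\<^sub>2 x s \<partial>N)"
      proof (intro arg_cong2[where f = "(+)"] nn_integral_cong)
        have e1: "s powr (p - 1) / s = s powr (p - 2)" "s powr (p - 1) / s\<^sup>2 = s powr (p - 3)"
          using True by (simp_all add: powr_diff power2_eq_square power3_eq_cube)
        fix x
        have "p * s powr (p - 1) * (4 * A\<^sub>1 * W / s * norm (f x)) = c\<^sub>1 * (s powr (p - 1) / s) * norm (f x)"
          by (simp add: c\<^sub>1_def)
        then show "ennreal (p * s powr (p - 1)) * (ennreal (4 * A\<^sub>1 * W / s * norm (f x)) * indicator {x. s \<le> norm (f x)} x) = H\<^sub>1 x s"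
          using True nn p unfolding e1 by (auto simp: H\<^sub>1_def indicator_def simp flip: ennreal_mult)
        have "p * s powr (p - 1) * (4 * A\<^sub>2 / s\<^sup>2 * (norm (f x))\<^sup>2) = c\<^sub>2 * (s powr (p - 1) / s\<^sup>2) * (norm (f x))\<^sup>2"
          by (simp add: c\<^sub>2_def)
        then show "ennreal (p * s powr (p - 1)) * (ennreal (4 * A\<^sub>2 / s\<^sup>2 * (norm (f x))\<^sup>2) * indicator {x. norm (f x) < s} x) = H\<^sub>2 x s"
          using True nn p unfolding e1 by (auto simp: H\<^sub>2_def indicator_def simp flip: ennreal_mult)
      qed
      finally show ?thesis .
    qed (simp add: G_def)
  qed
  also have "\<dots> = (\<integral>\<^sup>+s. (\<integral>\<^sup>+x. H\<^sub>1 x s \<partial>N) \<partial>lborel) + (\<integral>\<^sup>+s. (\<integral>\<^sup>+x. H\<^sub>2 x s \<partial>N) \<partial>lborel)"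
    by (rule nn_integral_add) measurable
  also have "\<dots> = (\<integral>\<^sup>+x. (\<integral>\<^sup>+s. H\<^sub>1 x s \<partial>lborel) \<partial>N) + (\<integral>\<^sup>+x. (\<integral>\<^sup>+s. H\<^sub>2 x s \<partial>lborel) \<partial>N)"
    by (intro arg_cong2[where f = "(+)"] NS.Fubini' H)
  also have "\<dots> \<le> (\<integral>\<^sup>+x. ennreal (c\<^sub>1 / (p - 1)) * ennreal (norm (f x) powr p) \<partial>N)
     + (\<integral>\<^sup>+x. ennreal (c\<^sub>2 / (2 - p)) * ennreal (norm (f x) powr p) \<partial>N)"
  proof (intro add_mono nn_integral_mono)
    fix x
    define b where "b = norm (f x)"
    have b: "b \<ge> 0" by (simp add: b_def)
    have "(\<integral>\<^sup>+s. H\<^sub>1 x s \<partial>lborel) \<le> (\<integral>\<^sup>+s. ennreal (c\<^sub>1 * b) * (ennreal (s powr (p - 2)) * indicator {0..b} s) \<partial>lborel)"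
      using c b by (intro nn_integral_mono) (auto simp: H\<^sub>1_def indicator_def b_def mult_ac simp flip: ennreal_mult)
    also have "\<dots> = ennreal (c\<^sub>1 * b) * ennreal (b powr (p - 2 + 1) / (p - 2 + 1))"
      using p b by (subst nn_integral_cmult) (auto simp: nn_integral_powr_Icc)
    also have "\<dots> = ennreal (c\<^sub>1 / (p - 1)) * ennreal (b powr p)"
      using c b p by (cases "b = 0") (auto simp: powr_diff simp flip: ennreal_mult)
    finally show "(\<integral>\<^sup>+s. H\<^sub>1 x s \<partial>lborel) \<le> ennreal (c\<^sub>1 / (p - 1)) * ennreal (norm (f x) powr p)"
      by (simp add: b_def)
    show "(\<integral>\<^sup>+s. H\<^sub>2 x s \<partial>lborel) \<le> ennreal (c\<^sub>2 / (2 - p)) * ennreal (norm (f x) powr p)"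
    \<comment> \<open>At b = 0 the integral of s^(p-3) down to 0 would diverge, but the factor b^2
      makes the integrand vanish.\<close>
    proof (cases "b = 0")
      case True
      then show ?thesis by (simp add: H\<^sub>2_def b_def)
    next
      case False
      have "(\<integral>\<^sup>+s. H\<^sub>2 x s \<partial>lborel) \<le> (\<integral>\<^sup>+s. ennreal (c\<^sub>2 * b\<^sup>2) * (ennreal (s powr (p - 3)) * indicator {b..} s) \<partial>lborel)"
        using c b by (intro nn_integral_mono) (auto simp: H\<^sub>2_def indicator_def b_def mult_ac simp flip: ennreal_mult)
      also have "\<dots> = ennreal (c\<^sub>2 * b\<^sup>2) * ennreal (- (b powr (p - 3 + 1)) / (p - 3 + 1))"
        using p b False by (subst nn_integral_cmult) (auto simp: nn_integral_powr_Ici)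
      also have "- (b powr (p - 3 + 1)) / (p - 3 + 1) = b powr (p - 2) / (2 - p)"
        using p by (simp add: field_simps)
      also have "ennreal (c\<^sub>2 * b\<^sup>2) * ennreal (b powr (p - 2) / (2 - p)) = ennreal (c\<^sub>2 / (2 - p)) * ennreal (b powr p)"
        using c b p False by (auto simp: powr_diff simp flip: ennreal_mult)
      finally show ?thesis by (simp add: b_def)
    qed
  qed
  also have "\<dots> = ennreal (c\<^sub>1 / (p - 1) + c\<^sub>2 / (2 - p)) * (\<integral>\<^sup>+x. ennreal (norm (f x) powr p) \<partial>N)"
    using c p by (simp add: nn_integral_cmult distrib_right)
  finally show ?thesis by (simp add: c\<^sub>1_def c\<^sub>2_def)
qed

end


section \<open>Twisted convolution\<close>

lemma has_bochner_integral_lborel_translate: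
  fixes f :: "'a::euclidean_space \<Rightarrow> 'b::{banach, second_countable_topology}"
  assumes "has_bochner_integral lborel f v"
  shows "has_bochner_integral lborel (\<lambda>x. f (x + c)) v"
proof -
  have [measurable]: "f \<in> borel_measurable borel"
    using assms by (auto simp: has_bochner_integral_iff)
  have m: "(+) c \<in> borel_measurable (lborel :: 'a measure)" by measurable
  have "integrable lborel (\<lambda>x. f (c + x)) \<longleftrightarrow> integrable (distr lborel borel ((+) c)) f"
    by (rule integrable_distr_eq[symmetric]) measurable
  moreover have "(\<integral>x. f (c + x) \<partial>lborel) = integral\<^sup>L (distr lborel borel ((+) c)) f"
    by (rule integral_distr[symmetric]) measurable
  ultimately show ?thesis
    using assms by (simp add: lborel_distr_plus has_bochner_integral_iff add.commute)
qed

lemma integral_lborel_translate: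
  fixes f :: "'a::euclidean_space \<Rightarrow> 'b::{banach, second_countable_topology}"
  shows "(\<integral>x. f (x + c) \<partial>lborel) = (\<integral>x. f x \<partial>lborel)"
proof (cases "integrable lborel f")
  case True
  then have "has_bochner_integral lborel f (\<integral>x. f x \<partial>lborel)"
    by (simp add: has_bochner_integral_integrable)
  from has_bochner_integral_lborel_translate[OF this] show ?thesis
    by (simp add: has_bochner_integral_iff)
next
  case False
  have "\<not> integrable lborel (\<lambda>x. f (x + c))"
  proof
    assume "integrable lborel (\<lambda>x. f (x + c))"
    from has_bochner_integral_lborel_translate[OF has_bochner_integral_integrable[OF this], of "- c"] False
    show False by (simp add: has_bochner_integral_iff)
  qed
  with False show ?thesis by (simp add: not_integrable_integral_eq)
qed

lemma nn_integral_lborel_translate: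
  fixes f :: "'a::euclidean_space \<Rightarrow> ennreal"
  assumes [measurable]: "f \<in> borel_measurable borel"
  shows "(\<integral>\<^sup>+x. f (x + c) \<partial>lborel) = (\<integral>\<^sup>+x. f x \<partial>lborel)"
  by (subst (2) lborel_distr_plus[of c, symmetric], subst nn_integral_distr) (auto simp: add.commute)

text \<open>Completing the square centres the product of the two Gaussians at a multiple of z. Since
  b is orthogonal to z, moving the centre leaves the phase unchanged, so the result is real.\<close>

lemma gauss_product_fourier:
  fixes b z :: "'a::euclidean_space"
  assumes ab: "\<alpha> > 0" "\<beta> > 0" and orth: "b \<bullet> z = 0"
  shows "has_bochner_integral lborel
     (\<lambda>u. of_real (exp (- \<alpha> * (norm (u - z))\<^sup>2) * exp (- \<beta> * (norm u)\<^sup>2)) * cis (b \<bullet> u))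
     (complex_of_real (exp (- (\<alpha> * \<beta> / (\<alpha> + \<beta>)) * (norm z)\<^sup>2) * sqrt (pi / (\<alpha> + \<beta>)) ^ DIM('a)
        * exp (- ((norm b)\<^sup>2 / (4 * (\<alpha> + \<beta>))))))"
proof -
  define g where "g = \<alpha> + \<beta>"
  define c where "c = \<alpha> / g"
  have g: "g > 0" using ab by (simp add: g_def)
  have "has_bochner_integral lborel (\<lambda>x. of_real (exp (- g * (norm (x + - c *\<^sub>R z))\<^sup>2)) * cis (b \<bullet> (x + - c *\<^sub>R z)))
           (complex_of_real (sqrt (pi / g) ^ DIM('a) * exp (- ((norm b)\<^sup>2 / (4 * g)))))"
    using has_bochner_integral_lborel_translate[OF gauss_fourier[OF g]] .
  from has_bochner_integral_mult_right[OF this, of "complex_of_real (exp (- (\<alpha> * \<beta> / g) * (norm z)\<^sup>2))"]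
  have "has_bochner_integral lborel (\<lambda>x. complex_of_real (exp (- (\<alpha> * \<beta> / g) * (norm z)\<^sup>2)) *
      (of_real (exp (- g * (norm (x + - c *\<^sub>R z))\<^sup>2)) * cis (b \<bullet> (x + - c *\<^sub>R z))))
      (complex_of_real (exp (- (\<alpha> * \<beta> / g) * (norm z)\<^sup>2)) *
        (complex_of_real (sqrt (pi / g) ^ DIM('a) * exp (- ((norm b)\<^sup>2 / (4 * g))))))"
    by simp
  also have "(\<lambda>x. complex_of_real (exp (- (\<alpha> * \<beta> / g) * (norm z)\<^sup>2)) *
      (of_real (exp (- g * (norm (x + - c *\<^sub>R z))\<^sup>2)) * cis (b \<bullet> (x + - c *\<^sub>R z))))
     = (\<lambda>u. of_real (exp (- \<alpha> * (norm (u - z))\<^sup>2) * exp (- \<beta> * (norm u)\<^sup>2)) * cis (b \<bullet> u))"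
  proof
    fix u
    have n1: "(norm (u + - c *\<^sub>R z))\<^sup>2 = (norm u)\<^sup>2 - 2 * c * (u \<bullet> z) + c\<^sup>2 * (norm z)\<^sup>2"
      unfolding power2_norm_eq_inner
      by (simp add: inner_diff inner_add_left inner_add_right inner_commute algebra_simps power2_eq_square)
    have n2: "(norm (u - z))\<^sup>2 = (norm u)\<^sup>2 - 2 * (u \<bullet> z) + (norm z)\<^sup>2"
      unfolding power2_norm_eq_inner by (simp add: inner_diff inner_commute algebra_simps)
    have gc: "g * c = \<alpha>" using g by (simp add: c_def)
    have e2: "g * c\<^sup>2 + \<alpha> * \<beta> / g = \<alpha>"
      using g by (simp add: c_def power2_eq_square field_simps) (simp add: g_def algebra_simps)
    have "- (\<alpha> * \<beta> / g) * (norm z)\<^sup>2 + - g * (norm (u + - c *\<^sub>R z))\<^sup>2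
      = - g * (norm u)\<^sup>2 + 2 * (g * c) * (u \<bullet> z) - (g * c\<^sup>2 + \<alpha> * \<beta> / g) * (norm z)\<^sup>2"
      unfolding n1 by (simp add: algebra_simps)
    also have "\<dots> = - \<alpha> * (norm (u - z))\<^sup>2 + - \<beta> * (norm u)\<^sup>2"
      unfolding n2 gc e2 by (simp add: g_def algebra_simps)
    finally have "exp (- (\<alpha> * \<beta> / g) * (norm z)\<^sup>2) * exp (- g * (norm (u + - c *\<^sub>R z))\<^sup>2)
      = exp (- \<alpha> * (norm (u - z))\<^sup>2) * exp (- \<beta> * (norm u)\<^sup>2)"
      by (simp only: exp_add[symmetric])
    moreover have "b \<bullet> (u + - c *\<^sub>R z) = b \<bullet> u"
      by (simp add: inner_add_right inner_diff_right orth)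
    ultimately show "complex_of_real (exp (- (\<alpha> * \<beta> / g) * (norm z)\<^sup>2)) *
      (of_real (exp (- g * (norm (u + - c *\<^sub>R z))\<^sup>2)) * cis (b \<bullet> (u + - c *\<^sub>R z)))
      = of_real (exp (- \<alpha> * (norm (u - z))\<^sup>2) * exp (- \<beta> * (norm u)\<^sup>2)) * cis (b \<bullet> u)"
      by (metis (no_types, lifting) mult.assoc of_real_mult)
  qed
  finally show ?thesis by (simp add: g_def mult.assoc)
qed

text \<open>Multiplication by -i. It turns the symplectic form of the group law into a real inner
  product, so that the twist becomes an ordinary Fourier phase with frequency orthogonal to
  z.\<close>

definition vec_rot :: "complex ^ 'n \<Rightarrow> complex ^ 'n" where
  "vec_rot z = (\<chi> i. - \<i> * z $ i)"

lemma Im_herm: "Im (herm z w) = vec_rot z \<bullet> w"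
  by (simp add: herm_def vec_rot_def inner_vec_def inner_complex_def algebra_simps)

lemma norm_vec_rot [simp]: "norm (vec_rot z) = norm z"
  by (simp add: vec_rot_def norm_vec_def norm_mult)

lemma vec_rot_orth [simp]: "vec_rot z \<bullet> z = 0"
  by (simp add: vec_rot_def inner_vec_def inner_complex_def)

lemma vec_rot_diff: "vec_rot (z - w) = vec_rot z - vec_rot w"
  by (simp add: vec_rot_def vec_eq_iff algebra_simps)

section \<open>The functions \<open>heis_phi\<close> and their generating Gaussians\<close>

lemma heis_phi_eq:
  "heis_phi k l (z :: complex ^ 'n) = laguerre_sum (CARD('n) - 1) k (\<bar>l\<bar> * (norm z)\<^sup>2 / 2) * exp (- (\<bar>l\<bar> * (norm z)\<^sup>2 / 4))"
proof -
  have "real CARD('n) - 1 = real (CARD('n) - 1)" by simp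
  then show ?thesis
    unfolding heis_phi_def by (simp only: poly_laguerre_nat)
qed

text \<open>A crude bound: the factor 5^k is far from the truth, but the Gaussian decay makes all
  integrals converge and lets sums over k be exchanged with them for |r| < 1/5.\<close>

lemma heis_phi_bound:
  "\<bar>heis_phi k l (z :: complex ^ 'n)\<bar> \<le> (5 / 4) ^ CARD('n) * 5 ^ k * exp (- (\<bar>l\<bar> / 8) * (norm z)\<^sup>2)"
  using laguerre_sum_exp_bound[of "\<bar>l\<bar> * (norm z)\<^sup>2 / 2" "CARD('n) - 1" k]
  by (simp add: heis_phi_eq abs_mult)

lemma heis_phi_0: "heis_phi k l (0 :: complex ^ 'n) = fan_coeff CARD('n) k"
proof -
  obtain d where d: "CARD('n) = Suc d" using zero_less_card_finite[where 'a = 'n] gr0_conv_Suc by blast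
  show ?thesis
    unfolding heis_phi_eq fan_coeff_def by (simp add: laguerre_sum_0 binomial_fact d)
qed

lemma heis_phi_minus: "heis_phi k l (z - w) = heis_phi k l (w - z)"
  by (simp add: heis_phi_def norm_minus_commute)

lemma borel_measurable_heis_phi [measurable (raw)]:
  assumes [measurable]: "g \<in> borel_measurable M" "h \<in> borel_measurable M"
  shows "(\<lambda>x. heis_phi k (g x) (h x :: complex ^ 'n)) \<in> borel_measurable M"
  unfolding heis_phi_eq laguerre_sum_def by measurable

text \<open>With r = exp (- 2 t |l|) the quotient (1 + r) / (1 - r) is coth (t |l|): up to a factor
  independent of z this is the heat kernel of the special Hermite operator.\<close>

definition heis_gauss :: "real \<Rightarrow> real \<Rightarrow> complex ^ 'n \<Rightarrow> real" where
  "heis_gauss l r z = exp (- (\<bar>l\<bar> / 4 * ((1 + r) / (1 - r))) * (norm z)\<^sup>2) / (1 - r) ^ CARD('n)"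

lemma borel_measurable_heis_gauss [measurable (raw)]:
  assumes [measurable]: "h \<in> borel_measurable M"
  shows "(\<lambda>x. heis_gauss l r (h x :: complex ^ 'n)) \<in> borel_measurable M"
  unfolding heis_gauss_def by measurable

lemma heis_gauss_sums:
  assumes r: "\<bar>r\<bar> < 1"
  shows "(\<lambda>k. r ^ k * heis_phi k l (z :: complex ^ 'n)) sums heis_gauss l r z"
proof -
  define x where "x = \<bar>l\<bar> * (norm z)\<^sup>2 / 2"
  have "(\<lambda>k. r ^ k * laguerre_sum (CARD('n) - 1) k x * exp (- (x / 2))) sums
      (exp (- x * r / (1 - r)) / (1 - r) ^ Suc (CARD('n) - 1) * exp (- (x / 2)))"
    by (intro sums_mult2 laguerre_generating r)
  also have "(\<lambda>k. r ^ k * laguerre_sum (CARD('n) - 1) k x * exp (- (x / 2))) = (\<lambda>k. r ^ k * heis_phi k l z)"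
    by (simp add: heis_phi_eq x_def mult.assoc)
  also have "- x * r / (1 - r) + - (x / 2) = - (\<bar>l\<bar> / 4 * ((1 + r) / (1 - r))) * (norm z)\<^sup>2"
    using r by (simp add: x_def field_simps)
  then have "exp (- x * r / (1 - r)) / (1 - r) ^ Suc (CARD('n) - 1) * exp (- (x / 2)) = heis_gauss l r z"
    by (simp add: heis_gauss_def flip: exp_add)
  finally show ?thesis .
qed

lemma heis_gauss_nonneg: "\<bar>r\<bar> < 1 \<Longrightarrow> heis_gauss l r z \<ge> 0"
  by (simp add: heis_gauss_def)

lemma heis_gauss_le: 
  assumes "\<bar>r\<bar> < 1"
  shows "\<bar>heis_gauss l r (z :: complex ^ 'n)\<bar> \<le> 1 / (1 - r) ^ CARD('n)"
proof -
  have "(1 + r) / (1 - r) \<ge> 0" using assms by simp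
  then have "0 \<le> \<bar>l\<bar> / 4 * ((1 + r) / (1 - r)) * (norm z)\<^sup>2"
    by (intro mult_nonneg_nonneg) auto
  then have "- (\<bar>l\<bar> / 4 * ((1 + r) / (1 - r))) * (norm z)\<^sup>2 \<le> 0"
    by simp
  then show ?thesis
    using assms by (simp add: heis_gauss_def divide_right_mono)
qed

lemma sqrt_power_DIM_vec_complex: "x \<ge> 0 \<Longrightarrow> sqrt x ^ DIM(complex ^ 'n) = x ^ CARD('n)"
  by (simp add: power_mult mult.commute[of _ 2])

text \<open>In heat kernel terms this is the semigroup law. \<open>gauss_product_fourier\<close>
  applies with frequency - (l / 2) \<open>vec_rot\<close> z; the common denominator (1 - r) (1 - s)
  cancels both in the exponent and in the prefactor, and only r s remains.\<close>

lemma heis_gauss_twisted_conv: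
  fixes z :: "complex ^ 'n"
  assumes l: "l \<noteq> 0" and r: "\<bar>r\<bar> < 1" and s: "\<bar>s\<bar> < 1"
  shows "(\<integral>u. of_real (heis_gauss l r (u - z)) * (cis (- (l / 2) * Im (herm z u)) * of_real (heis_gauss l s u)) \<partial>lborel)
    = complex_of_real ((2 * pi / \<bar>l\<bar>) ^ CARD('n) * heis_gauss l (r * s) z)"
proof -
  define n where "n = CARD('n)"
  define a where "a = \<bar>l\<bar>"
  define \<alpha> where "\<alpha> = a / 4 * ((1 + r) / (1 - r))"
  define \<beta> where "\<beta> = a / 4 * ((1 + s) / (1 - s))"
  have a: "a > 0" using l by (simp add: a_def)
  have rs: "1 - r > 0" "1 - s > 0" "1 + r > 0" "1 + s > 0" using r s by auto
  have "\<bar>r * s\<bar> < 1"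
    using mult_strict_mono'[OF r s] by (simp add: abs_mult)
  then have rs1: "1 - r * s > 0" "1 + r * s > 0" by auto
  have ab: "\<alpha> > 0" "\<beta> > 0" using a rs by (auto simp: \<alpha>_def \<beta>_def)
  have sum: "\<alpha> + \<beta> = a / 2 * ((1 - r * s) / ((1 - r) * (1 - s)))"
  proof -
    have "(1 + r) / (1 - r) + (1 + s) / (1 - s) = 2 * ((1 - r * s) / ((1 - r) * (1 - s)))"
      using rs by (simp add: add_frac_eq) (simp add: algebra_simps)
    then have "a / 4 * ((1 + r) / (1 - r)) + a / 4 * ((1 + s) / (1 - s)) = a / 4 * (2 * ((1 - r * s) / ((1 - r) * (1 - s))))"
      by (simp only: distrib_left[symmetric])
    moreover have "a / 4 * (2 * X) = a / 2 * X" for X by simp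
    ultimately show ?thesis unfolding \<alpha>_def \<beta>_def by (simp only:)
  qed
  \<comment> \<open>The summand a^2 / 16 is the contribution of the phase: its frequency has norm a
    |z| / 2, and the Fourier transform divides the square of that norm by 4 (\<open>\<alpha>\<close>
    + \<open>\<beta>\<close>).\<close>
  have prod: "\<alpha> * \<beta> + a\<^sup>2 / 16 = a\<^sup>2 / 8 * ((1 + r * s) / ((1 - r) * (1 - s)))"
  proof -
    have "(1 + r) / (1 - r) * ((1 + s) / (1 - s)) + 1 = 2 * ((1 + r * s) / ((1 - r) * (1 - s)))"
      using rs by (simp add: add_divide_eq_iff add_frac_eq divide_add_eq_iff) (simp add: algebra_simps)
    then have "a\<^sup>2 / 16 * ((1 + r) / (1 - r) * ((1 + s) / (1 - s)) + 1) = a\<^sup>2 / 16 * (2 * ((1 + r * s) / ((1 - r) * (1 - s))))"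
      by simp
    moreover have "a / 4 * X * (a / 4 * Y) + a\<^sup>2 / 16 = a\<^sup>2 / 16 * (X * Y + 1)"
      "a\<^sup>2 / 16 * (2 * X) = a\<^sup>2 / 8 * X" for X Y
      by (simp_all add: power2_eq_square algebra_simps)
    ultimately show ?thesis unfolding \<alpha>_def \<beta>_def by (simp only:)
  qed
  have e: "\<alpha> * \<beta> / (\<alpha> + \<beta>) + a\<^sup>2 / (16 * (\<alpha> + \<beta>)) = a / 4 * ((1 + r * s) / (1 - r * s))"
  proof -
    have "\<alpha> * \<beta> / (\<alpha> + \<beta>) + a\<^sup>2 / (16 * (\<alpha> + \<beta>)) = (\<alpha> * \<beta> + a\<^sup>2 / 16) / (\<alpha> + \<beta>)"
      by (simp add: add_divide_distrib)
    also have "\<dots> = a / 4 * ((1 + r * s) / (1 - r * s))"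
    proof -
      have "a\<^sup>2 / 8 * (P / Q) / (a / 2 * (R / Q)) = a / 4 * (P / R)" if "Q \<noteq> 0" "R \<noteq> 0" for P Q R :: real
        using a that by (simp add: field_simps power2_eq_square)
      then show ?thesis unfolding prod sum using rs rs1 by (metis less_irrefl mult_eq_0_iff)
    qed
    finally show ?thesis .
  qed
  define C where "C = 1 / (1 - r) ^ n * (1 / (1 - s) ^ n)"
  have "has_bochner_integral lborel
     (\<lambda>u. of_real (exp (- \<alpha> * (norm (u - z))\<^sup>2) * exp (- \<beta> * (norm u)\<^sup>2)) * cis ((- (l / 2)) *\<^sub>R vec_rot z \<bullet> u))
     (complex_of_real (exp (- (\<alpha> * \<beta> / (\<alpha> + \<beta>)) * (norm z)\<^sup>2) * sqrt (pi / (\<alpha> + \<beta>)) ^ DIM(complex ^ 'n)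
        * exp (- ((norm ((- (l / 2)) *\<^sub>R vec_rot z))\<^sup>2 / (4 * (\<alpha> + \<beta>))))))"
    by (rule gauss_product_fourier[OF ab]) simp
  then have "(\<integral>u. of_real C * (of_real (exp (- \<alpha> * (norm (u - z))\<^sup>2) * exp (- \<beta> * (norm u)\<^sup>2)) * cis ((- (l / 2)) *\<^sub>R vec_rot z \<bullet> u)) \<partial>lborel)
    = complex_of_real (C * (exp (- (\<alpha> * \<beta> / (\<alpha> + \<beta>)) * (norm z)\<^sup>2) * sqrt (pi / (\<alpha> + \<beta>)) ^ DIM(complex ^ 'n)
        * exp (- ((norm ((- (l / 2)) *\<^sub>R vec_rot z))\<^sup>2 / (4 * (\<alpha> + \<beta>))))))"
    by (simp add: has_bochner_integral_iff)
  also have "(\<lambda>u. of_real C * (of_real (exp (- \<alpha> * (norm (u - z))\<^sup>2) * exp (- \<beta> * (norm u)\<^sup>2)) * cis ((- (l / 2)) *\<^sub>R vec_rot z \<bullet> u)))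
    = (\<lambda>u. of_real (heis_gauss l r (u - z)) * (cis (- (l / 2) * Im (herm z u)) * of_real (heis_gauss l s u)))"
    by (simp add: heis_gauss_def C_def n_def \<alpha>_def \<beta>_def a_def Im_herm fun_eq_iff)
  also have "C * (exp (- (\<alpha> * \<beta> / (\<alpha> + \<beta>)) * (norm z)\<^sup>2) * sqrt (pi / (\<alpha> + \<beta>)) ^ DIM(complex ^ 'n)
        * exp (- ((norm ((- (l / 2)) *\<^sub>R vec_rot z))\<^sup>2 / (4 * (\<alpha> + \<beta>)))))
     = (C * (pi / (\<alpha> + \<beta>)) ^ n) * (exp (- (\<alpha> * \<beta> / (\<alpha> + \<beta>)) * (norm z)\<^sup>2) * exp (- (a\<^sup>2 / (16 * (\<alpha> + \<beta>))) * (norm z)\<^sup>2))"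
    using ab by (subst sqrt_power_DIM_vec_complex) (auto simp: n_def a_def power_mult_distrib power_divide)
  also have "exp (- (\<alpha> * \<beta> / (\<alpha> + \<beta>)) * (norm z)\<^sup>2) * exp (- (a\<^sup>2 / (16 * (\<alpha> + \<beta>))) * (norm z)\<^sup>2)
     = exp (- (\<alpha> * \<beta> / (\<alpha> + \<beta>) + a\<^sup>2 / (16 * (\<alpha> + \<beta>))) * (norm z)\<^sup>2)"
    by (simp add: algebra_simps flip: exp_add)
  also have "\<dots> = exp (- (a / 4 * ((1 + r * s) / (1 - r * s))) * (norm z)\<^sup>2)"
    unfolding e ..
  also have "C * (pi / (\<alpha> + \<beta>)) ^ n = (2 * pi / a) ^ n * (1 / (1 - r * s) ^ n)"
  proof -
    have "C * (pi / (\<alpha> + \<beta>)) ^ n = (1 / (1 - r) * (1 / (1 - s)) * (pi / (\<alpha> + \<beta>))) ^ n"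
      by (simp add: C_def power_mult_distrib power_divide)
    also have "1 / (1 - r) * (1 / (1 - s)) * (pi / (\<alpha> + \<beta>)) = 2 * pi / a * (1 / (1 - r * s))"
      unfolding sum using a rs rs1 by (simp add: divide_simps)
    finally show ?thesis by (simp add: power_mult_distrib power_divide)
  qed
  finally show ?thesis
    by (simp add: heis_gauss_def n_def a_def)
qed

lemma integrable_gauss:
  assumes "c > 0"
  shows "integrable lborel (\<lambda>x::'a::euclidean_space. exp (- c * (norm (x - y))\<^sup>2))"
  unfolding integrable_iff_bounded
  using nn_integral_gauss[OF assms, of y] by simp

text \<open>The k-th term is dominated by (5 |r|)^k times a fixed integrable Gaussian. The factor
  \<open>H\<close> is left arbitrary because the expansion is applied in turn to each factor of a
  twisted convolution.\<close>

lemma heis_phi_conv_sums: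
  fixes z :: "complex ^ 'n" and H :: "complex ^ 'n \<Rightarrow> complex"
  assumes l: "l \<noteq> 0" and H [measurable]: "H \<in> borel_measurable borel" and B: "\<And>u. norm (H u) \<le> B"
    and r: "\<bar>r\<bar> < 1 / 5"
  shows "(\<lambda>k. (\<integral>u. of_real (heis_phi k l (u - z)) * H u \<partial>lborel) * of_real r ^ k) sums
     (\<integral>u. of_real (heis_gauss l r (u - z)) * H u \<partial>lborel)"
    and "integrable lborel (\<lambda>u. of_real (heis_phi k l (u - z)) * H u)"
proof -
  define D where "D = (\<lambda>u::complex ^ 'n. (5 / 4) ^ CARD('n) * B * exp (- (\<bar>l\<bar> / 8) * (norm (u - z))\<^sup>2))"
  have D: "integrable lborel D"
    unfolding D_def using l by (intro integrable_mult_right integrable_gauss) auto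
  have B0: "B \<ge> 0" using B[of 0] norm_ge_zero order_trans by blast
  have bd: "norm (of_real (heis_phi k l (u - z)) * H u) \<le> 5 ^ k * D u" for k u
  proof -
    have "norm (of_real (heis_phi k l (u - z)) * H u) = \<bar>heis_phi k l (u - z)\<bar> * norm (H u)"
      by (simp add: norm_mult)
    also have "\<dots> \<le> ((5 / 4) ^ CARD('n) * 5 ^ k * exp (- (\<bar>l\<bar> / 8) * (norm (u - z))\<^sup>2)) * B"
      by (intro mult_mono heis_phi_bound B) auto
    finally show ?thesis by (simp add: D_def mult_ac)
  qed
  show int: "integrable lborel (\<lambda>u. of_real (heis_phi k l (u - z)) * H u)" for k
  proof (rule Bochner_Integration.integrable_bound[of _ "\<lambda>u. 5 ^ k * D u"])
    show "AE u in lborel. norm (of_real (heis_phi k l (u - z)) * H u) \<le> norm (5 ^ k * D u)"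
      using bd order_trans[OF _ abs_ge_self] by (intro AE_I2) (simp add: norm_mult, fastforce)
  qed (use D in \<open>auto intro!: integrable_mult_right\<close>)
  define f where "f = (\<lambda>k u. of_real (heis_phi k l (u - z)) * H u * of_real r ^ k)"
  have r5: "\<bar>5 * r\<bar> < 1" using r by auto
  have fb: "norm (f k u) \<le> \<bar>5 * r\<bar> ^ k * D u" for k u
  proof -
    have "norm (f k u) = norm (of_real (heis_phi k l (u - z)) * H u) * \<bar>r\<bar> ^ k"
      unfolding f_def norm_mult[of _ "of_real r ^ k"] by (simp add: norm_power)
    also have "\<dots> \<le> 5 ^ k * D u * \<bar>r\<bar> ^ k"
      by (intro mult_right_mono bd) auto
    finally show ?thesis by (simp add: abs_mult power_mult_distrib mult_ac)
  qed
  have fi: "integrable lborel (f k)" for k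
    unfolding f_def by (intro integrable_mult_left int)
  have s1: "summable (\<lambda>k. norm (f k u))" for u
    by (rule summable_comparison_test'[of "\<lambda>k. \<bar>5 * r\<bar> ^ k * D u" 0])
       (use fb r5 in \<open>auto intro!: summable_mult2 summable_geometric\<close>)
  have s2: "summable (\<lambda>k. \<integral>u. norm (f k u) \<partial>lborel)"
  proof (rule summable_comparison_test'[of "\<lambda>k. \<bar>5 * r\<bar> ^ k * (\<integral>u. D u \<partial>lborel)" 0])
    show "summable (\<lambda>k. \<bar>5 * r\<bar> ^ k * (\<integral>u. D u \<partial>lborel))"
      using r5 by (intro summable_mult2 summable_geometric) auto
    fix k
    have "(\<integral>u. norm (f k u) \<partial>lborel) \<le> (\<integral>u. \<bar>5 * r\<bar> ^ k * D u \<partial>lborel)"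
      using fi D by (intro integral_mono fb) auto
    then show "norm (\<integral>u. norm (f k u) \<partial>lborel) \<le> \<bar>5 * r\<bar> ^ k * (\<integral>u. D u \<partial>lborel)"
      by simp
  qed
  have "(\<lambda>k. \<integral>u. f k u \<partial>lborel) sums (\<integral>u. (\<Sum>k. f k u) \<partial>lborel)"
    by (rule sums_integral[OF fi _ s2]) (use s1 in auto)
  also have "(\<lambda>u. \<Sum>k. f k u) = (\<lambda>u. of_real (heis_gauss l r (u - z)) * H u)"
  proof
    fix u
    have "(\<lambda>k. r ^ k * heis_phi k l (u - z)) sums heis_gauss l r (u - z)"
      by (rule heis_gauss_sums) (use r in auto)
    then have "(\<lambda>k. of_real (r ^ k * heis_phi k l (u - z)) * H u) sums (of_real (heis_gauss l r (u - z)) * H u)"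
      by (intro sums_mult2 sums_of_real)
    then show "(\<Sum>k. f k u) = of_real (heis_gauss l r (u - z)) * H u"
      by (simp add: f_def sums_iff mult_ac)
  qed
  finally show "(\<lambda>k. (\<integral>u. of_real (heis_phi k l (u - z)) * H u \<partial>lborel) * of_real r ^ k) sums
     (\<integral>u. of_real (heis_gauss l r (u - z)) * H u \<partial>lborel)"
    by (simp add: f_def)
qed

lemma borel_measurable_cis [measurable (raw)]:
  "f \<in> borel_measurable M \<Longrightarrow> (\<lambda>x. cis (f x)) \<in> borel_measurable M"
  by (rule measurable_compose[OF _ borel_measurable_continuous_onI]) (auto intro: continuous_intros simp: cis_conv_exp)

lemma borel_measurable_Im_herm [measurable (raw)]:
  assumes [measurable]: "f \<in> borel_measurable M" "g \<in> borel_measurable M"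
  shows "(\<lambda>x. Im (herm (f x) (g x :: complex ^ 'n))) \<in> borel_measurable M"
proof -
  have "linear (vec_rot :: complex ^ 'n \<Rightarrow> _)"
    by (rule linearI) (simp_all add: vec_rot_def vec_eq_iff algebra_simps)
  then have "continuous_on UNIV (vec_rot :: complex ^ 'n \<Rightarrow> _)"
    by (simp add: linear_continuous_on linear_linear)
  then have [measurable]: "(\<lambda>x. vec_rot (f x)) \<in> borel_measurable M"
    by (rule measurable_compose[OF assms(1) borel_measurable_continuous_onI])
  show ?thesis unfolding Im_herm by measurable
qed

text \<open>Twisted convolution with \<open>heis_phi k l\<close> is a multiple of a projection; both sides are the
  coefficients of \<open>r\<^sup>k s\<^sup>k\<close> in the twisted convolution of two Gaussians.\<close>

lemma heis_phi_twisted_conv: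
  fixes z :: "complex ^ 'n"
  assumes l: "l \<noteq> 0"
  shows "(\<integral>u. of_real (heis_phi k l (u - z)) * (cis (- (l / 2) * Im (herm z u)) * of_real (heis_phi k l u)) \<partial>lborel)
    = complex_of_real ((2 * pi / \<bar>l\<bar>) ^ CARD('n) * heis_phi k l z)"
proof -
  define c where "c = (2 * pi / \<bar>l\<bar>) ^ CARD('n)"
  define E where "E = (\<lambda>u. cis (- (l / 2) * Im (herm z u)))"
  have [measurable]: "E \<in> borel_measurable borel" unfolding E_def by measurable
  have nE: "norm (E u) = 1" for u by (simp add: E_def)
  \<comment> \<open>Coefficients are extracted one variable at a time. \<open>J s\<close> is the
    coefficient of r^k for fixed s; its own coefficient of s^k is then the integral in
    question.\<close>
  define J where "J = (\<lambda>s. \<integral>u. of_real (heis_phi k l (u - z)) * (E u * of_real (heis_gauss l s u)) \<partial>lborel)"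
  have J: "J s = complex_of_real (c * heis_phi k l z * s ^ k)" if s: "\<bar>s\<bar> < 1 / 5" for s
  proof -
    have "(\<integral>u. of_real (heis_phi k l (u - z)) * (E u * of_real (heis_gauss l s u)) \<partial>lborel)
       = complex_of_real (c * heis_phi k l z * s ^ k)"
    proof (rule powser_of_real_unique[of "1/5" "\<lambda>k. (\<integral>u. of_real (heis_phi k l (u - z)) * (E u * of_real (heis_gauss l s u)) \<partial>lborel)"
           "\<lambda>r. complex_of_real (c * heis_gauss l (r * s) z)" "\<lambda>k. complex_of_real (c * heis_phi k l z * s ^ k)"])
      fix r :: real assume "norm r < 1 / 5"
      then have r: "\<bar>r\<bar> < 1 / 5" by simp
      have "(\<lambda>k. (\<integral>u. of_real (heis_phi k l (u - z)) * (E u * of_real (heis_gauss l s u)) \<partial>lborel) * of_real r ^ k) sums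
         (\<integral>u. of_real (heis_gauss l r (u - z)) * (E u * of_real (heis_gauss l s u)) \<partial>lborel)"
      proof (rule heis_phi_conv_sums(1)[OF l _ _ r])
        show "norm (E u * complex_of_real (heis_gauss l s u)) \<le> 1 / (1 - s) ^ CARD('n)" for u
          using heis_gauss_le[of s l u] s by (simp add: norm_mult nE)
      qed measurable
      also have "(\<integral>u. of_real (heis_gauss l r (u - z)) * (E u * of_real (heis_gauss l s u)) \<partial>lborel)
         = complex_of_real (c * heis_gauss l (r * s) z)"
        unfolding E_def c_def by (rule heis_gauss_twisted_conv[OF l]) (use r s in auto)
      finally show "(\<lambda>k. (\<integral>u. of_real (heis_phi k l (u - z)) * (E u * of_real (heis_gauss l s u)) \<partial>lborel) * of_real r ^ k) sums
         complex_of_real (c * heis_gauss l (r * s) z)" .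
      have "\<bar>r * s\<bar> < 1"
        using r s mult_strict_mono'[of "\<bar>r\<bar>" 1 "\<bar>s\<bar>" 1] by (auto simp: abs_mult)
      then have "(\<lambda>k. c * ((r * s) ^ k * heis_phi k l z)) sums (c * heis_gauss l (r * s) z)"
        by (intro sums_mult heis_gauss_sums)
      then have "(\<lambda>k. complex_of_real (c * ((r * s) ^ k * heis_phi k l z))) sums complex_of_real (c * heis_gauss l (r * s) z)"
        by (rule sums_of_real)
      then show "(\<lambda>k. complex_of_real (c * heis_phi k l z * s ^ k) * of_real r ^ k) sums complex_of_real (c * heis_gauss l (r * s) z)"
        by (simp add: power_mult_distrib mult_ac)
    qed simp
    then show ?thesis by (simp add: J_def)
  qed
  \<comment> \<open>The test \<open>k = k\<close> writes the right side as entry k of a sequence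
    supported at k alone. As a power series in s that sequence is the single term found for
    \<open>J s\<close>; its zero entries express that different indices annihilate each other under
    twisted convolution.\<close>
  have "(\<integral>u. of_real (heis_phi k l (u - z)) * (E u * of_real (heis_phi k l u)) \<partial>lborel)
    = (if k = k then complex_of_real (c * heis_phi k l z) else 0)"
  proof (rule powser_of_real_unique[of "1/5" "\<lambda>m. (\<integral>u. of_real (heis_phi k l (u - z)) * (E u * of_real (heis_phi m l u)) \<partial>lborel)"
       J "\<lambda>m. (if m = k then complex_of_real (c * heis_phi k l z) else 0)"])
    fix s :: real assume "norm s < 1 / 5"
    then have s: "\<bar>s\<bar> < 1 / 5" by simp
    have "(\<lambda>m. (\<integral>u. of_real (heis_phi m l (u - 0)) * (of_real (heis_phi k l (u - z)) * E u) \<partial>lborel) * of_real s ^ m) sums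
       (\<integral>u. of_real (heis_gauss l s (u - 0)) * (of_real (heis_phi k l (u - z)) * E u) \<partial>lborel)"
    proof (rule heis_phi_conv_sums(1)[OF l _ _ s])
      fix u
      have "\<bar>heis_phi k l (u - z)\<bar> \<le> (5 / 4) ^ CARD('n) * 5 ^ k * exp (- (\<bar>l\<bar> / 8) * (norm (u - z))\<^sup>2)"
        by (rule heis_phi_bound)
      also have "\<dots> \<le> (5 / 4) ^ CARD('n) * 5 ^ k * 1"
        by (intro mult_left_mono) auto
      finally show "norm (complex_of_real (heis_phi k l (u - z)) * E u) \<le> (5 / 4) ^ CARD('n) * 5 ^ k"
        by (simp add: norm_mult nE)
    qed measurable
    then show "(\<lambda>m. (\<integral>u. of_real (heis_phi k l (u - z)) * (E u * of_real (heis_phi m l u)) \<partial>lborel) * of_real s ^ m) sums J s"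
      by (simp add: J_def mult_ac)
    have "(\<lambda>m. if m = k then complex_of_real (c * heis_phi k l z) * of_real s ^ m else 0) sums
      (complex_of_real (c * heis_phi k l z) * of_real s ^ k)"
      by (rule sums_single)
    then show "(\<lambda>m. (if m = k then complex_of_real (c * heis_phi k l z) else 0) * of_real s ^ m) sums J s"
      unfolding J[OF s] by (simp add: if_distrib[of "\<lambda>x. x * _"] cong: if_cong)
  qed simp
  then show ?thesis by (simp add: E_def c_def)
qed

lemma heis_phi_0_pos: "heis_phi k l (0 :: complex ^ 'n) > 0"
  by (simp add: heis_phi_0 fan_coeff_def)

text \<open>At z = 0 the twist is trivial, so the reproducing identity reads off the L^2 norm;
  translation moves the centre.\<close>

lemma heis_phi_square_integral:
  assumes l: "l \<noteq> 0"
  shows "(\<integral>\<^sup>+u. ennreal ((heis_phi k l (u - z :: complex ^ 'n))\<^sup>2) \<partial>lborel)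
    = ennreal ((2 * pi / \<bar>l\<bar>) ^ CARD('n) * heis_phi k l (0 :: complex ^ 'n))"
proof -
  have "integrable lborel (\<lambda>u. complex_of_real (heis_phi k l (u - 0)) * of_real (heis_phi k l (u :: complex ^ 'n)))"
  proof (rule heis_phi_conv_sums(2)[OF l, of _ _ 0])
    fix u :: "complex ^ 'n"
    have "\<bar>heis_phi k l u\<bar> \<le> (5 / 4) ^ CARD('n) * 5 ^ k * exp (- (\<bar>l\<bar> / 8) * (norm u)\<^sup>2)"
      by (rule heis_phi_bound)
    also have "\<dots> \<le> (5 / 4) ^ CARD('n) * 5 ^ k * 1"
      by (intro mult_left_mono) auto
    finally show "norm (complex_of_real (heis_phi k l u)) \<le> (5 / 4) ^ CARD('n) * 5 ^ k" by simp
  qed auto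
  then have int: "integrable lborel (\<lambda>u::complex ^ 'n. (heis_phi k l u)\<^sup>2)"
    by (simp add: power2_eq_square complex_of_real_integrable_eq flip: of_real_mult)
  have z0: "herm 0 u = 0" for u :: "complex ^ 'n" by (simp add: herm_def)
  have "(\<integral>u. complex_of_real ((heis_phi k l (u :: complex ^ 'n))\<^sup>2) \<partial>lborel) = complex_of_real ((2 * pi / \<bar>l\<bar>) ^ CARD('n) * heis_phi k l (0 :: complex ^ 'n))"
    using heis_phi_twisted_conv[OF l, of k "0 :: complex ^ 'n"] by (simp add: z0 power2_eq_square)
  then have "(\<integral>u. (heis_phi k l (u :: complex ^ 'n))\<^sup>2 \<partial>lborel) = (2 * pi / \<bar>l\<bar>) ^ CARD('n) * heis_phi k l (0 :: complex ^ 'n)"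
    unfolding integral_complex_of_real by (simp only: of_real_eq_iff)
  then have "(\<integral>\<^sup>+u. ennreal ((heis_phi k l (u :: complex ^ 'n))\<^sup>2) \<partial>lborel)
    = ennreal ((2 * pi / \<bar>l\<bar>) ^ CARD('n) * heis_phi k l (0 :: complex ^ 'n))"
    using nn_integral_eq_integral[OF int] by simp
  then show ?thesis
    using nn_integral_lborel_translate[of "\<lambda>u. ennreal ((heis_phi k l (u :: complex ^ 'n))\<^sup>2)" "- z"] by simp
qed

text \<open>Both factors have the same L^2 norm, so a b <= (a^2 + b^2) / 2 already gives what
  Cauchy-Schwarz would. The bound serves twice: for the sup norm of phi_k and for Fubini in the
  TT-star argument.\<close>

lemma heis_phi_product_integral_le:
  assumes l: "l \<noteq> 0"
  shows "(\<integral>\<^sup>+u. ennreal (\<bar>heis_phi k l (u - z)\<bar> * \<bar>heis_phi k l (u - z' :: complex ^ 'n)\<bar>) \<partial>lborel)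
    \<le> ennreal ((2 * pi / \<bar>l\<bar>) ^ CARD('n) * heis_phi k l (0 :: complex ^ 'n))"
proof -
  let ?X = "(2 * pi / \<bar>l\<bar>) ^ CARD('n) * heis_phi k l (0 :: complex ^ 'n)"
  have X: "?X \<ge> 0" using heis_phi_0_pos[of k l, where 'n = 'n] by (intro mult_nonneg_nonneg) auto
  have half: "ennreal (1 / 2) * ennreal x + ennreal (1 / 2) * ennreal y = ennreal (1 / 2 * x + 1 / 2 * y)"
    if "x \<ge> 0" "y \<ge> 0" for x y
    using that by (subst ennreal_plus) (simp_all only: ennreal_mult'' mult_nonneg_nonneg zero_le_divide_1_iff zero_le_numeral)
  have "(\<integral>\<^sup>+u. ennreal (\<bar>heis_phi k l (u - z)\<bar> * \<bar>heis_phi k l (u - z' :: complex ^ 'n)\<bar>) \<partial>lborel)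
    \<le> (\<integral>\<^sup>+u. ennreal (1 / 2) * ennreal ((heis_phi k l (u - z))\<^sup>2) + ennreal (1 / 2) * ennreal ((heis_phi k l (u - z'))\<^sup>2) \<partial>lborel)"
  proof (rule nn_integral_mono)
    fix u
    have "\<bar>heis_phi k l (u - z)\<bar> * \<bar>heis_phi k l (u - z')\<bar> \<le> 1 / 2 * (heis_phi k l (u - z))\<^sup>2 + 1 / 2 * (heis_phi k l (u - z'))\<^sup>2"
      using sum_squares_bound[of "\<bar>heis_phi k l (u - z)\<bar>" "\<bar>heis_phi k l (u - z')\<bar>"] by simp
    then show "ennreal (\<bar>heis_phi k l (u - z)\<bar> * \<bar>heis_phi k l (u - z')\<bar>)
      \<le> ennreal (1 / 2) * ennreal ((heis_phi k l (u - z))\<^sup>2) + ennreal (1 / 2) * ennreal ((heis_phi k l (u - z'))\<^sup>2)"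
      by (subst half, simp, simp) (rule ennreal_leI)
  qed
  also have "\<dots> = ennreal (1 / 2) * ennreal ?X + ennreal (1 / 2) * ennreal ?X"
    by (subst nn_integral_add, measurable) (simp add: nn_integral_cmult heis_phi_square_integral[OF l])
  also have "\<dots> = ennreal ?X"
    unfolding half[OF X X] by (simp add: mult.commute)
  finally show ?thesis .
qed

text \<open>The sup bound is Cauchy--Schwarz for the reproducing kernel.\<close>

lemma abs_heis_phi_le:
  assumes l: "l \<noteq> 0"
  shows "\<bar>heis_phi k l (z :: complex ^ 'n)\<bar> \<le> fan_coeff CARD('n) k"
proof -
  let ?c = "(2 * pi / \<bar>l\<bar>) ^ CARD('n)"
  have c: "?c > 0" using l by simp
  let ?g = "\<lambda>u. complex_of_real (heis_phi k l (u - z)) * (cis (- (l / 2) * Im (herm z u)) * of_real (heis_phi k l u))"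
  have "ennreal (?c * \<bar>heis_phi k l z\<bar>) = ennreal (norm (integral\<^sup>L lborel ?g))"
    using c unfolding heis_phi_twisted_conv[OF l] norm_of_real abs_mult by simp
  also have "\<dots> \<le> (\<integral>\<^sup>+u. ennreal (norm (?g u)) \<partial>lborel)"
  proof (cases "integrable lborel ?g")
    case True
    then show ?thesis by (rule integral_norm_bound_ennreal)
  qed (simp add: not_integrable_integral_eq)
  also have "\<dots> = (\<integral>\<^sup>+u. ennreal (\<bar>heis_phi k l (u - z)\<bar> * \<bar>heis_phi k l (u - 0)\<bar>) \<partial>lborel)"
    by (simp add: norm_mult)
  also have "\<dots> \<le> ennreal (?c * heis_phi k l (0 :: complex ^ 'n))"
    by (rule heis_phi_product_integral_le[OF l])
  finally have "?c * \<bar>heis_phi k l z\<bar> \<le> ?c * heis_phi k l (0 :: complex ^ 'n)"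
    using c heis_phi_0_pos[of k l, where 'n = 'n] by (subst (asm) ennreal_le_iff) (auto intro!: mult_nonneg_nonneg simp: less_imp_le)
  then show ?thesis
    using c by (simp add: heis_phi_0)
qed

text \<open>What remains of \<open>heis_e\<close> at (z, t)^(-1) (w, 0) once the central phase exp
  (- i l t) is split off; see \<open>heis_e_kernel\<close>.\<close>

definition heis_kernel :: "nat \<Rightarrow> real \<Rightarrow> complex ^ 'n \<Rightarrow> complex ^ 'n \<Rightarrow> complex" where
  "heis_kernel k l z w = cis (- (l / 2) * Im (herm z w)) * of_real (heis_phi k l (w - z))"

lemma norm_heis_kernel: "norm (heis_kernel k l z w) = \<bar>heis_phi k l (w - z)\<bar>"
  by (simp add: heis_kernel_def norm_mult)

lemma borel_measurable_heis_kernel [measurable (raw)]: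
  assumes [measurable]: "k \<in> M \<rightarrow>\<^sub>M count_space UNIV" "f \<in> borel_measurable M" "g \<in> borel_measurable M" "h \<in> borel_measurable M"
  shows "(\<lambda>x. heis_kernel (k x) (f x) (g x) (h x :: complex ^ 'n)) \<in> borel_measurable M"
  by (rule measurable_compose_countable[OF _ assms(1)]) (unfold heis_kernel_def, measurable)

text \<open>Twisted translation invariance: with w = u + z' the two phases combine into a factor
  that depends only on z and z' and the twist at z - z', which reduces the claim to
  \<open>heis_phi_twisted_conv\<close>.\<close>

lemma heis_kernel_reproducing:
  fixes z z' :: "complex ^ 'n"
  assumes l: "l \<noteq> 0"
  shows "(\<integral>w. heis_kernel k l z w * cnj (heis_kernel k l z' w) \<partial>lborel)
     = of_real ((2 * pi / \<bar>l\<bar>) ^ CARD('n)) * heis_kernel k l z z'"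
proof -
  define \<zeta> where "\<zeta> = z - z'"
  define E where "E = cis (- (l / 2) * Im (herm z z'))"
  have "(\<integral>w. heis_kernel k l z w * cnj (heis_kernel k l z' w) \<partial>lborel)
     = (\<integral>u. heis_kernel k l z (u + z') * cnj (heis_kernel k l z' (u + z')) \<partial>lborel)"
    by (rule integral_lborel_translate[symmetric])
  also have "\<dots> = (\<integral>u. E * (of_real (heis_phi k l (u - \<zeta>)) * (cis (- (l / 2) * Im (herm \<zeta> u)) * of_real (heis_phi k l u))) \<partial>lborel)"
  proof (rule Bochner_Integration.integral_cong[OF refl])
    fix u :: "complex ^ 'n"
    have "- (l / 2) * Im (herm z (u + z')) - - (l / 2) * Im (herm z' (u + z'))
      = - (l / 2) * Im (herm z z') + - (l / 2) * Im (herm \<zeta> u)"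
      by (simp add: Im_herm \<zeta>_def vec_rot_diff inner_diff_left inner_add_right algebra_simps)
    then have "cis (- (l / 2) * Im (herm z (u + z'))) * cnj (cis (- (l / 2) * Im (herm z' (u + z'))))
       = E * cis (- (l / 2) * Im (herm \<zeta> u))"
      unfolding E_def cis_cnj cis_mult by (simp only: diff_conv_add_uminus)
    moreover have "u + z' - z = u - \<zeta>" "u + z' - z' = u" by (simp_all add: \<zeta>_def)
    ultimately show "heis_kernel k l z (u + z') * cnj (heis_kernel k l z' (u + z'))
      = E * (of_real (heis_phi k l (u - \<zeta>)) * (cis (- (l / 2) * Im (herm \<zeta> u)) * of_real (heis_phi k l u)))"
      unfolding heis_kernel_def complex_cnj_mult complex_cnj_complex_of_real
      by (simp only: mult.assoc mult.left_commute mult.commute)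
  qed
  also have "\<dots> = E * of_real ((2 * pi / \<bar>l\<bar>) ^ CARD('n) * heis_phi k l \<zeta>)"
    by (simp only: integral_mult_right_zero heis_phi_twisted_conv[OF l])
  also have "\<dots> = of_real ((2 * pi / \<bar>l\<bar>) ^ CARD('n)) * heis_kernel k l z z'"
    by (simp add: heis_kernel_def E_def \<zeta>_def heis_phi_minus[of k l z z'])
  finally show ?thesis .
qed


section \<open>The \<open>L\<^sup>2\<close> bound\<close>

text \<open>Fatou's lemma in the shape of its three uses: removing the Gaussian weight in l,
  removing the weight r^k, and passing to L^p.\<close>

lemma nn_integral_le_of_AE_limit:
  fixes u :: "nat \<Rightarrow> 'a \<Rightarrow> ennreal"
  assumes [measurable]: "\<And>i. u i \<in> borel_measurable M"
    and lim: "AE x in M. (\<lambda>i. u i x) \<longlonglongrightarrow> v x"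
    and le: "\<And>i. (\<integral>\<^sup>+x. u i x \<partial>M) \<le> X i" and X: "X \<longlonglongrightarrow> Y"
  shows "(\<integral>\<^sup>+x. v x \<partial>M) \<le> Y"
proof -
  have "(\<integral>\<^sup>+x. v x \<partial>M) = (\<integral>\<^sup>+x. liminf (\<lambda>i. u i x) \<partial>M)"
    using lim by (intro nn_integral_cong_AE) (auto elim!: eventually_mono simp: lim_imp_Liminf)
  also have "\<dots> \<le> liminf (\<lambda>i. \<integral>\<^sup>+x. u i x \<partial>M)"
    by (rule nn_integral_liminf) measurable
  also have "\<dots> \<le> liminf X"
    by (rule Liminf_mono) (use le in auto)
  also have "\<dots> = Y"
    using X by (simp add: lim_imp_Liminf)
  finally show ?thesis .
qed

text \<open>The kernel of the composition with the adjoint is a Gaussian in t - t' whose mass is 2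
  pi for every e, so the bound survives e tending to 0. The right side may be infinite.\<close>

lemma plancherel_real_le:
  fixes g :: "real \<Rightarrow> complex"
  assumes g: "integrable lborel g"
  shows "(\<integral>\<^sup>+l. ennreal ((norm (\<integral>t. g t * cis (- (l * t)) \<partial>lborel))\<^sup>2) \<partial>lborel)
    \<le> ennreal (2 * pi) * (\<integral>\<^sup>+t. ennreal ((norm (g t))\<^sup>2) \<partial>lborel)"
proof -
  have [measurable]: "g \<in> borel_measurable borel" using g by auto
  define G where "G = (\<lambda>l. \<integral>t. g t * cis (- (l * t)) \<partial>lborel)"
  have [measurable]: "G \<in> borel_measurable borel" unfolding G_def by measurable
  have reg: "(\<integral>\<^sup>+l. ennreal (exp (- e * l\<^sup>2) * (norm (G l))\<^sup>2) \<partial>lborel)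
    \<le> ennreal (2 * pi) * (\<integral>\<^sup>+t. ennreal ((norm (g t))\<^sup>2) \<partial>lborel)" if e: "e > 0" for e
  proof -
    \<comment> \<open>Half of the exponent, because the weight enters squared.\<close>
    define K where "K = (\<lambda>t l. complex_of_real (exp (- (e / 2) * l\<^sup>2)) * cis (- (l * t)))"
    define R where "R = (\<lambda>t t'. ennreal (sqrt (pi / e)) * ennreal (exp (- (1 / (4 * e)) * (norm (t - t' :: real))\<^sup>2)))"
    have ee: "exp (- (e / 2 * l\<^sup>2)) * exp (- (e / 2 * l\<^sup>2)) = exp (- e * l\<^sup>2)" for l :: real
      by (simp flip: exp_add)
    have RA: "(\<integral>\<^sup>+t. R t t' \<partial>lborel) = ennreal (2 * pi)" for t'
    proof -
      have "(\<integral>\<^sup>+t. R t t' \<partial>lborel) = ennreal (sqrt (pi / e)) * ennreal (sqrt (pi / (1 / (4 * e))) ^ DIM(real))"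
        unfolding R_def using e by (subst nn_integral_cmult, measurable, subst nn_integral_gauss) auto
      also have "\<dots> = ennreal (sqrt (pi / e * (pi * (4 * e))))"
      proof -
        have "sqrt (pi / e) * sqrt (pi / (1 / (4 * e))) = sqrt (pi / e * (pi * (4 * e)))"
          by (subst real_sqrt_mult[symmetric]) simp
        then show ?thesis using e by (subst ennreal_mult[symmetric]) auto
      qed
      also have "pi / e * (pi * (4 * e)) = (2 * pi)\<^sup>2"
        using e by (simp add: power2_eq_square)
      also have "sqrt ((2 * pi)\<^sup>2) = 2 * pi"
        by (rule real_sqrt_unique[OF refl]) simp
      finally show ?thesis .
    qed
    have "(\<integral>\<^sup>+l. ennreal ((norm (\<integral>t. g t * K t l \<partial>lborel))\<^sup>2) \<partial>lborel)
      \<le> ennreal (2 * pi) * (\<integral>\<^sup>+t. ennreal ((norm (g t))\<^sup>2) \<partial>lborel)"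
    proof (rule TT_star_bound[where R = R and B = "sqrt (pi / e)"])
      show "(\<integral>\<^sup>+l. ennreal (norm (K t l) * norm (K t' l)) \<partial>lborel) \<le> ennreal (sqrt (pi / e))" for t t'
      proof -
        have "norm (K t l) * norm (K t' l) = exp (- e * (norm (l - 0))\<^sup>2)" for l
          using ee[of l] by (simp add: K_def norm_mult)
        then show ?thesis
          using nn_integral_gauss[OF e, of "0::real"] by (simp only: DIM_real power_one_right)
      qed
      show "ennreal (norm (\<integral>l. K t l * cnj (K t' l) \<partial>lborel)) \<le> R t t'" for t t'
      proof -
        have "K t l * cnj (K t' l) = of_real (exp (- e * l\<^sup>2)) * cis ((t' - t) * l)" for l
        proof -
          have "cis (- (l * t)) * cnj (cis (- (l * t'))) = cis ((t' - t) * l)"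
            by (simp add: cis_cnj cis_mult algebra_simps)
          moreover have "complex_of_real (exp (- (e / 2) * l\<^sup>2)) * complex_of_real (exp (- (e / 2) * l\<^sup>2)) = complex_of_real (exp (- e * l\<^sup>2))"
            using ee[of l] by (simp flip: of_real_mult)
          ultimately show ?thesis
            unfolding K_def complex_cnj_mult complex_cnj_complex_of_real
            by (metis mult.assoc mult.left_commute)
        qed
        then have "(\<integral>l. K t l * cnj (K t' l) \<partial>lborel) = complex_of_real (sqrt (pi / e) * exp (- ((t' - t)\<^sup>2 / (4 * e))))"
          using gauss_fourier_real[OF e, of "t' - t"] by (simp add: has_bochner_integral_iff)
        then have "norm (\<integral>l. K t l * cnj (K t' l) \<partial>lborel) = sqrt (pi / e) * exp (- (1 / (4 * e)) * (norm (t - t'))\<^sup>2)"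
          using e by (simp add: abs_mult power2_commute[of t t'] del: of_real_mult)
        then show ?thesis using e by (simp add: R_def ennreal_mult)
      qed
      show "(\<integral>\<^sup>+t. R t t' \<partial>lborel) \<le> ennreal (2 * pi)" for t' by (simp add: RA)
      show "(\<integral>\<^sup>+t'. R t t' \<partial>lborel) \<le> ennreal (2 * pi)" for t
        using RA[of t] by (simp add: R_def norm_minus_commute[of t] del: real_norm_def)
    qed (use g in \<open>auto simp: K_def R_def intro: lborel.sigma_finite_measure_axioms\<close>)
    moreover have "(norm (\<integral>t. g t * K t l \<partial>lborel))\<^sup>2 = exp (- e * l\<^sup>2) * (norm (G l))\<^sup>2" for l
    proof -
      have "(\<integral>t. g t * K t l \<partial>lborel) = of_real (exp (- (e / 2) * l\<^sup>2)) * G l"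
        unfolding K_def G_def by (subst integral_mult_right_zero[symmetric]) (simp add: mult_ac)
      then show ?thesis using ee[of l] by (simp add: norm_mult power_mult_distrib power2_eq_square)
    qed
    ultimately show ?thesis by simp
  qed
  have "(\<integral>\<^sup>+l. ennreal ((norm (G l))\<^sup>2) \<partial>lborel) \<le> ennreal (2 * pi) * (\<integral>\<^sup>+t. ennreal ((norm (g t))\<^sup>2) \<partial>lborel)"
  proof (rule nn_integral_le_of_AE_limit[OF _ _ reg tendsto_const])
    show "0 < 1 / real (Suc i)" for i by simp
    show "AE l in lborel. (\<lambda>i. ennreal (exp (- (1 / real (Suc i)) * l\<^sup>2) * (norm (G l))\<^sup>2)) \<longlonglongrightarrow> ennreal ((norm (G l))\<^sup>2)"
    proof (rule AE_I2)
      fix l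
      have "(\<lambda>i. exp (- (1 / real (Suc i)) * l\<^sup>2) * (norm (G l))\<^sup>2) \<longlonglongrightarrow> exp (- 0 * l\<^sup>2) * (norm (G l))\<^sup>2"
        by (intro tendsto_intros LIMSEQ_Suc lim_1_over_n)
      then show "(\<lambda>i. ennreal (exp (- (1 / real (Suc i)) * l\<^sup>2) * (norm (G l))\<^sup>2)) \<longlonglongrightarrow> ennreal ((norm (G l))\<^sup>2)"
        by (intro tendsto_ennrealI) simp
    qed
  qed measurable
  then show ?thesis by (simp add: G_def)
qed

text \<open>The mass equals (4 pi / (|l| (1 + r)))^n. What matters is a bound uniform in r, since r
  tends to 1.\<close>

lemma nn_integral_heis_gauss_le:
  fixes z :: "complex ^ 'n"
  assumes l: "l \<noteq> 0" and r: "0 < r" "r < 1"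
  shows "(\<integral>\<^sup>+z'. ennreal (heis_gauss l r (z' - z)) \<partial>lborel) \<le> ennreal ((4 * pi / \<bar>l\<bar>) ^ CARD('n))"
proof -
  define \<alpha> where "\<alpha> = \<bar>l\<bar> / 4 * ((1 + r) / (1 - r))"
  have \<alpha>: "\<alpha> > 0" using l r by (simp add: \<alpha>_def)
  have "(\<integral>\<^sup>+z'. ennreal (heis_gauss l r (z' - z)) \<partial>lborel)
    = (\<integral>\<^sup>+z'. ennreal (1 / (1 - r) ^ CARD('n)) * ennreal (exp (- \<alpha> * (norm (z' - z))\<^sup>2)) \<partial>lborel)"
    using r by (simp add: heis_gauss_def \<alpha>_def flip: ennreal_mult)
  also have "\<dots> = ennreal (1 / (1 - r) ^ CARD('n)) * ennreal ((pi / \<alpha>) ^ CARD('n))"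
    using \<alpha> by (subst nn_integral_cmult, measurable) (simp only: nn_integral_gauss sqrt_power_DIM_vec_complex, subst sqrt_power_DIM_vec_complex, auto)
  also have "\<dots> = ennreal ((1 / (1 - r) * (pi / \<alpha>)) ^ CARD('n))"
    using r \<alpha> by (simp add: power_mult_distrib power_divide flip: ennreal_mult)
  also have "1 / (1 - r) * (pi / \<alpha>) = 4 * pi / \<bar>l\<bar> * (1 / (1 + r))"
  proof -
    have *: "1 / P * (pi / (\<bar>l\<bar> / 4 * (Q / P))) = 4 * pi / \<bar>l\<bar> * (1 / Q)" if "P \<noteq> 0" "Q \<noteq> 0" for P Q
      using that l by (simp add: field_simps)
    show ?thesis unfolding \<alpha>_def by (rule *) (use r in auto)
  qed
  also have "ennreal ((4 * pi / \<bar>l\<bar> * (1 / (1 + r))) ^ CARD('n)) \<le> ennreal ((4 * pi / \<bar>l\<bar>) ^ CARD('n))"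
  proof (intro ennreal_leI power_mono)
    have "4 * pi / \<bar>l\<bar> * (1 / (1 + r)) \<le> 4 * pi / \<bar>l\<bar> * 1"
      by (rule mult_left_mono) (use r in auto)
    then show "4 * pi / \<bar>l\<bar> * (1 / (1 + r)) \<le> 4 * pi / \<bar>l\<bar>" by simp
  qed (use r in auto)
  finally show ?thesis .
qed

text \<open>The constant is the product of (2 pi / |l|)^n from the reproducing identity and (4 pi /
  |l|)^n from the mass of the Gaussian. The sum over k is part of the target measure
  \<open>?N\<close>, so the generating function sums the reproducing kernels inside the TT-star
  argument.\<close>

lemma heis_fixed_frequency_bound:
  fixes g :: "complex ^ 'n \<Rightarrow> complex"
  assumes l: "l \<noteq> 0" and g: "integrable lborel g"
  shows "(\<Sum>k. \<integral>\<^sup>+w. ennreal ((norm (\<integral>z. g z * heis_kernel k l z w \<partial>lborel))\<^sup>2) \<partial>lborel)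
    \<le> ennreal ((8 * pi\<^sup>2 / l\<^sup>2) ^ CARD('n)) * (\<integral>\<^sup>+z. ennreal ((norm (g z))\<^sup>2) \<partial>lborel)"
proof -
  let ?N = "count_space (UNIV :: nat set) \<Otimes>\<^sub>M (lborel :: (complex ^ 'n) measure)"
  interpret C: sigma_finite_measure "count_space (UNIV :: nat set)"
    by (rule sigma_finite_measure_count_space)
  interpret CL: pair_sigma_finite "count_space (UNIV :: nat set)" "lborel :: (complex ^ 'n) measure" ..
  have [measurable]: "g \<in> borel_measurable borel" using g by auto
  define G where "G = (\<lambda>kw. \<integral>z. g z * heis_kernel (fst kw) l z (snd kw) \<partial>lborel)"
  have [measurable]: "G \<in> borel_measurable ?N" unfolding G_def by measurable
  define c where "c = (2 * pi / \<bar>l\<bar>) ^ CARD('n)"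
  have c: "c > 0" using l by (simp add: c_def)
  define A where "A = ennreal ((8 * pi\<^sup>2 / l\<^sup>2) ^ CARD('n))"
  have cA: "ennreal c * ennreal ((4 * pi / \<bar>l\<bar>) ^ CARD('n)) = A"
    unfolding A_def c_def using l
    by (simp add: power2_eq_square flip: ennreal_mult power_mult_distrib)
  have reg: "(\<integral>\<^sup>+kw. ennreal (r ^ fst kw * (norm (G kw))\<^sup>2) \<partial>?N) \<le> A * (\<integral>\<^sup>+z. ennreal ((norm (g z))\<^sup>2) \<partial>lborel)"
    if r: "0 < r" "r < 1" for r
  proof -
    have ar: "\<bar>r\<bar> < 1" using r by simp
    \<comment> \<open>The square root of r, because the weight enters squared.\<close>
    define K where "K = (\<lambda>z kw. complex_of_real (sqrt r ^ fst kw) * heis_kernel (fst kw) l (z :: complex ^ 'n) (snd kw))"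
    define R where "R = (\<lambda>z z'. ennreal c * ennreal (heis_gauss l r (z' - z :: complex ^ 'n)))"
    have sr: "sqrt r ^ k * sqrt r ^ k = r ^ k" for k
      using r by (simp flip: power_mult_distrib)
    have Km [measurable]: "case_prod K \<in> borel_measurable (lborel \<Otimes>\<^sub>M ?N)"
      unfolding K_def by measurable
    have Km' [measurable]: "K z \<in> borel_measurable ?N" for z
      unfolding K_def by measurable
    \<comment> \<open>This bound is c / (1 - r)^n and degenerates as r tends to 1; it is used for
      integrability at fixed r only.\<close>
    have B: "(\<integral>\<^sup>+kw. ennreal (norm (K z kw) * norm (K z' kw)) \<partial>?N) \<le> ennreal (c * heis_gauss l r (0 :: complex ^ 'n))" for z z'
    proof -
      have "(\<integral>\<^sup>+kw. ennreal (norm (K z kw) * norm (K z' kw)) \<partial>?N)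
        = (\<integral>\<^sup>+k. \<integral>\<^sup>+w. ennreal (norm (K z (k, w)) * norm (K z' (k, w))) \<partial>lborel \<partial>count_space UNIV)"
        by (rule lborel.nn_integral_fst[symmetric]) measurable
      also have "\<dots> = (\<integral>\<^sup>+k. \<integral>\<^sup>+w. ennreal (r ^ k) * ennreal (\<bar>heis_phi k l (w - z)\<bar> * \<bar>heis_phi k l (w - z')\<bar>) \<partial>lborel \<partial>count_space UNIV)"
        using r by (intro nn_integral_cong) (simp add: K_def norm_mult norm_heis_kernel norm_power sr[symmetric] mult_ac flip: ennreal_mult)
      also have "\<dots> \<le> (\<integral>\<^sup>+k. ennreal (r ^ k) * ennreal (c * heis_phi k l (0 :: complex ^ 'n)) \<partial>count_space UNIV)"
        unfolding c_def
        by (intro nn_integral_mono, subst nn_integral_cmult, measurable) (intro mult_left_mono heis_phi_product_integral_le l, simp)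
      also have "\<dots> = (\<Sum>k. ennreal (c * (r ^ k * heis_phi k l (0 :: complex ^ 'n))))"
        using r c heis_phi_0_pos[of _ l, where 'n = 'n]
        by (simp add: nn_integral_count_space_nat less_imp_le mult_ac flip: ennreal_mult)
      also have "\<dots> = ennreal (c * heis_gauss l r (0 :: complex ^ 'n))"
        by (rule suminf_ennreal_eq)
           (use r c heis_phi_0_pos[of _ l, where 'n = 'n] in \<open>auto intro!: sums_mult heis_gauss_sums mult_nonneg_nonneg simp: less_imp_le\<close>)
      finally show ?thesis .
    qed
    have "(\<integral>\<^sup>+kw. ennreal ((norm (\<integral>z. g z * K z kw \<partial>lborel))\<^sup>2) \<partial>?N) \<le> A * (\<integral>\<^sup>+z. ennreal ((norm (g z))\<^sup>2) \<partial>lborel)"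
    proof (rule TT_star_bound[OF _ _ _ g B, where R = R])
      show "sigma_finite_measure ?N" ..
      show "ennreal (norm (\<integral>kw. K z kw * cnj (K z' kw) \<partial>?N)) \<le> R z z'" for z z'
      proof -
        have int: "integrable ?N (\<lambda>kw. K z kw * cnj (K z' kw))"
          unfolding integrable_iff_bounded using B[of z z'] by (auto simp: norm_mult intro: le_less_trans)
        have "(\<lambda>k. \<integral>w. K z (k, w) * cnj (K z' (k, w)) \<partial>lborel) sums
           (\<integral>k. \<integral>w. K z (k, w) * cnj (K z' (k, w)) \<partial>lborel \<partial>count_space UNIV)"
          by (rule sums_integral_count_space_nat) (rule CL.integrable_fst'[OF int])
        also have "(\<integral>k. \<integral>w. K z (k, w) * cnj (K z' (k, w)) \<partial>lborel \<partial>count_space UNIV) = (\<integral>kw. K z kw * cnj (K z' kw) \<partial>?N)"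
          by (rule CL.integral_fst'[OF int])
        finally have s1: "(\<lambda>k. \<integral>w. K z (k, w) * cnj (K z' (k, w)) \<partial>lborel) sums (\<integral>kw. K z kw * cnj (K z' kw) \<partial>?N)" .
        have "(\<integral>w. K z (k, w) * cnj (K z' (k, w)) \<partial>lborel)
          = of_real c * cis (- (l / 2) * Im (herm z z')) * of_real (r ^ k * heis_phi k l (z' - z))" for k
        proof -
          have "(\<integral>w. K z (k, w) * cnj (K z' (k, w)) \<partial>lborel)
            = (\<integral>w. of_real (r ^ k) * (heis_kernel k l z w * cnj (heis_kernel k l z' w)) \<partial>lborel)"
            unfolding sr[symmetric] by (simp add: K_def mult_ac)
          also have "\<dots> = of_real (r ^ k) * (of_real c * heis_kernel k l z z')"
            unfolding c_def by (simp only: integral_mult_right_zero heis_kernel_reproducing[OF l])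
          finally show ?thesis by (simp add: heis_kernel_def mult_ac)
        qed
        moreover have "(\<lambda>k. of_real c * cis (- (l / 2) * Im (herm z z')) * of_real (r ^ k * heis_phi k l (z' - z))) sums
           (of_real c * cis (- (l / 2) * Im (herm z z')) * of_real (heis_gauss l r (z' - z)))"
          by (intro sums_mult sums_of_real heis_gauss_sums ar)
        ultimately have "(\<integral>kw. K z kw * cnj (K z' kw) \<partial>?N) = of_real c * cis (- (l / 2) * Im (herm z z')) * of_real (heis_gauss l r (z' - z))"
          using s1 sums_unique2 by simp
        then show ?thesis
          using c heis_gauss_nonneg[OF ar, of l "z' - z"] by (simp add: R_def norm_mult flip: ennreal_mult)
      qed
      show "(\<integral>\<^sup>+z'. R z z' \<partial>lborel) \<le> A" for z
      proof -
        have "(\<integral>\<^sup>+z'. R z z' \<partial>lborel) = ennreal c * (\<integral>\<^sup>+z'. ennreal (heis_gauss l r (z' - z)) \<partial>lborel)"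
          unfolding R_def by (rule nn_integral_cmult) measurable
        also have "\<dots> \<le> A"
          unfolding cA[symmetric] by (intro mult_left_mono nn_integral_heis_gauss_le l r) auto
        finally show ?thesis .
      qed
      then show "(\<integral>\<^sup>+z. R z z' \<partial>lborel) \<le> A" for z'
        by (simp add: R_def heis_gauss_def norm_minus_commute[of z'])
    qed (auto simp: R_def intro: lborel.sigma_finite_measure_axioms)
    moreover have "(norm (\<integral>z. g z * K z kw \<partial>lborel))\<^sup>2 = r ^ fst kw * (norm (G kw))\<^sup>2" for kw
    proof -
      have "(\<integral>z. g z * K z kw \<partial>lborel) = of_real (sqrt r ^ fst kw) * G kw"
        unfolding K_def G_def by (subst integral_mult_right_zero[symmetric]) (simp add: mult_ac)
      then show ?thesis
        using r sr[of "fst kw"] by (simp add: norm_mult power_mult_distrib power2_eq_square norm_power)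
    qed
    ultimately show ?thesis by simp
  qed
  have "(\<integral>\<^sup>+kw. ennreal ((norm (G kw))\<^sup>2) \<partial>?N) \<le> A * (\<integral>\<^sup>+z. ennreal ((norm (g z))\<^sup>2) \<partial>lborel)"
  proof (rule nn_integral_le_of_AE_limit[OF _ _ reg tendsto_const])
    show "0 < real (Suc i) / real (Suc (Suc i))" "real (Suc i) / real (Suc (Suc i)) < 1" for i by auto
    show "AE kw in ?N. (\<lambda>i. ennreal ((real (Suc i) / real (Suc (Suc i))) ^ fst kw * (norm (G kw))\<^sup>2)) \<longlonglongrightarrow> ennreal ((norm (G kw))\<^sup>2)"
    proof (rule AE_I2)
      fix kw :: "nat \<times> (complex ^ 'n)"
      have "(\<lambda>i. (real (Suc i) / real (Suc (Suc i))) ^ fst kw * (norm (G kw))\<^sup>2) \<longlonglongrightarrow> 1 ^ fst kw * (norm (G kw))\<^sup>2"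
        by (intro tendsto_intros LIMSEQ_n_over_Suc_n[THEN LIMSEQ_Suc])
      then show "(\<lambda>i. ennreal ((real (Suc i) / real (Suc (Suc i))) ^ fst kw * (norm (G kw))\<^sup>2)) \<longlonglongrightarrow> ennreal ((norm (G kw))\<^sup>2)"
        by (intro tendsto_ennrealI) simp
    qed
  qed measurable
  then have "(\<integral>\<^sup>+k. \<integral>\<^sup>+w. ennreal ((norm (G (k, w)))\<^sup>2) \<partial>lborel \<partial>count_space UNIV) \<le> A * (\<integral>\<^sup>+z. ennreal ((norm (g z))\<^sup>2) \<partial>lborel)"
    by (subst lborel.nn_integral_fst) measurable
  then show ?thesis by (simp add: G_def A_def nn_integral_count_space_nat)
qed

text \<open>The unnormalized transform in the coordinates (l, k), taken over \<open>lborel\<close>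
  rather than its completion so that product measures and Tonelli apply directly.\<close>

definition heis_transform :: "(('n::finite) heis \<Rightarrow> complex) \<Rightarrow> real \<Rightarrow> nat \<Rightarrow> complex ^ 'n \<Rightarrow> complex" where
  "heis_transform f l k w = (\<integral>x. f x * heis_e k l (heis_mult (heis_inv x) (w, 0)) \<partial>lborel)"

lemma heis_e_kernel:
  "heis_e k l (heis_mult (heis_inv (z, t)) (w, 0)) = cis (- (l * t)) * heis_kernel k l z w"
proof -
  have h: "herm (- z) w = - herm z w" by (simp add: herm_def sum_negf)
  have "cis (l * (- t + - Im (herm z w) / 2)) = cis (- (l * t)) * cis (- (l / 2) * Im (herm z w))"
    by (simp add: cis_mult algebra_simps)
  then show ?thesis
    by (simp add: heis_e_def heis_mult_def heis_inv_def heis_kernel_def h)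
qed

lemma norm_heis_e_le:
  assumes "l \<noteq> 0"
  shows "norm (heis_e k l (x :: 'n heis)) \<le> fan_coeff CARD('n::finite) k"
  using abs_heis_phi_le[OF assms, of k "fst x"] by (simp add: heis_e_def norm_mult)

lemma borel_measurable_heis_e [measurable (raw)]:
  assumes [measurable]: "k \<in> M \<rightarrow>\<^sub>M count_space UNIV" "l \<in> borel_measurable M"
    "z \<in> borel_measurable M" "t \<in> borel_measurable M" "w \<in> borel_measurable M"
  shows "(\<lambda>x. heis_e (k x) (l x) (heis_mult (heis_inv (z x :: complex ^ 'n, t x)) (w x, 0))) \<in> borel_measurable M"
  unfolding heis_e_kernel by measurable

context
  fixes f :: "('n::finite) heis \<Rightarrow> complex"
  assumes f: "integrable lborel f"
begin

lemma heis_borel_measurable [measurable]: "f \<in> borel_measurable borel"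
  using f by auto

lemma heis_integrable_pair: "integrable (lborel \<Otimes>\<^sub>M lborel) f"
  using f by (simp add: lborel_prod)

lemma partial_fourier_integrable: "integrable lborel (\<lambda>z. \<integral>t. f (z, t) * cis (- (l * t)) \<partial>lborel)"
proof -
  have "(\<lambda>x. f x * cis (- (l * snd x))) \<in> borel_measurable (lborel \<Otimes>\<^sub>M lborel)"
    by (rule borel_measurable_times[OF borel_measurable_integrable[OF heis_integrable_pair]]) measurable
  then have "integrable (lborel \<Otimes>\<^sub>M lborel) (\<lambda>x. f x * cis (- (l * snd x)))"
    by (rule Bochner_Integration.integrable_bound[OF heis_integrable_pair]) (auto simp: norm_mult)
  from lborel_pair.integrable_fst'[OF this] show ?thesis by simp
qed

lemma heis_transform_integrable:
  assumes l: "l \<noteq> 0"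
  shows "integrable lborel (\<lambda>x. f x * heis_e k l (heis_mult (heis_inv x) (w, 0)))"
proof -
  let ?g = "\<lambda>x. f x * heis_e k l (heis_mult (heis_inv x) (w, 0))"
  have m: "?g \<in> borel_measurable lborel"
  proof -
    have "(\<lambda>x. f (fst x, snd x) * heis_e k l (heis_mult (heis_inv (fst x, snd x)) (w, 0))) \<in> borel_measurable (lborel \<Otimes>\<^sub>M lborel)"
      by measurable
    then show ?thesis by (simp add: lborel_prod)
  qed
  show ?thesis
  proof (rule Bochner_Integration.integrable_bound[OF integrable_mult_right[OF f, of "of_real (fan_coeff CARD('n) k)"] m])
    have "norm (f x) * norm (heis_e k l (heis_mult (heis_inv x) (w, 0))) \<le> norm (f x) * \<bar>fan_coeff CARD('n) k\<bar>" for x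
      by (intro mult_left_mono order_trans[OF norm_heis_e_le[OF l]]) auto
    then show "AE x in lborel. norm (?g x) \<le> norm (of_real (fan_coeff CARD('n) k) * f x)"
      by (simp add: norm_mult mult.commute)
  qed
qed

lemma heis_transform_eq:
  assumes l: "l \<noteq> 0"
  shows "heis_transform f l k w = (\<integral>z. (\<integral>t. f (z, t) * cis (- (l * t)) \<partial>lborel) * heis_kernel k l z w \<partial>lborel)"
proof -
  let ?g = "\<lambda>x. f x * heis_e k l (heis_mult (heis_inv x) (w, 0))"
  have "integrable (lborel \<Otimes>\<^sub>M lborel) ?g"
    using heis_transform_integrable[OF l] by (simp add: lborel_prod)
  from lborel_pair.integral_fst'[OF this]
  have "heis_transform f l k w = (\<integral>z. \<integral>t. f (z, t) * (cis (- (l * t)) * heis_kernel k l z w) \<partial>lborel \<partial>lborel)"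
    by (simp add: heis_transform_def lborel_prod heis_e_kernel)
  also have "\<dots> = (\<integral>z. (\<integral>t. f (z, t) * cis (- (l * t)) \<partial>lborel) * heis_kernel k l z w \<partial>lborel)"
    by (simp only: mult.assoc[symmetric] integral_mult_left_zero)
  finally show ?thesis .
qed

lemma heis_transform_measurable:
  assumes [measurable]: "k \<in> M \<rightarrow>\<^sub>M count_space UNIV" "l \<in> borel_measurable M" "w \<in> borel_measurable M"
  shows "(\<lambda>x. heis_transform f (l x) (k x) (w x)) \<in> borel_measurable M"
proof -
  have "(\<lambda>x. \<integral>y. f (fst y, snd y) * heis_e (k x) (l x) (heis_mult (heis_inv (fst y, snd y)) (w x, 0)) \<partial>(lborel \<Otimes>\<^sub>M lborel))
     \<in> borel_measurable M"
    by (intro lborel_pair.P.borel_measurable_lebesgue_integral) measurable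
  then show ?thesis by (simp add: heis_transform_def lborel_prod)
qed

lemma norm_heis_transform_le:
  assumes l: "l \<noteq> 0"
  shows "norm (heis_transform f l k w) \<le> fan_coeff CARD('n) k * (\<integral>x. norm (f x) \<partial>lborel)"
proof -
  have "norm (heis_transform f l k w) \<le> (\<integral>x. norm (f x * heis_e k l (heis_mult (heis_inv x) (w, 0))) \<partial>lborel)"
    unfolding heis_transform_def by (rule integral_norm_bound)
  also have "\<dots> \<le> (\<integral>x. fan_coeff CARD('n) k * norm (f x) \<partial>lborel)"
  proof (rule integral_mono')
    have "norm (f x) * norm (heis_e k l (heis_mult (heis_inv x) (w, 0))) \<le> norm (f x) * fan_coeff CARD('n) k" for x
      by (intro mult_left_mono norm_heis_e_le l) auto
    then show "norm (f x * heis_e k l (heis_mult (heis_inv x) (w, 0))) \<le> fan_coeff CARD('n) k * norm (f x)" for x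
      by (simp add: norm_mult mult.commute)
  qed (use f in \<open>auto simp: fan_coeff_def\<close>)
  finally show ?thesis by simp
qed

text \<open>The weight |l|^(2n) cancels the l^(-2n) of the fixed-frequency bound and vanishes at l =
  0. What is left is Plancherel in the central variable for each z.\<close>

lemma heis_transform_L2_le:
  "(\<integral>\<^sup>+l. ennreal (\<bar>l\<bar> ^ (2 * CARD('n))) * (\<Sum>k. \<integral>\<^sup>+w. ennreal ((norm (heis_transform f l k w))\<^sup>2) \<partial>lborel) \<partial>lborel)
    \<le> ennreal ((8 * pi\<^sup>2) ^ CARD('n) * (2 * pi)) * (\<integral>\<^sup>+x. ennreal ((norm (f x))\<^sup>2) \<partial>lborel)"
proof -
  define C where "C = (8 * pi\<^sup>2) ^ CARD('n)"
  define g where "g = (\<lambda>l z. \<integral>t. f (z, t) * cis (- (l * t)) \<partial>lborel)"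
  have [measurable]: "case_prod g \<in> borel_measurable (lborel \<Otimes>\<^sub>M lborel)"
    unfolding g_def by measurable
  have "(\<integral>\<^sup>+l. ennreal (\<bar>l\<bar> ^ (2 * CARD('n))) * (\<Sum>k. \<integral>\<^sup>+w. ennreal ((norm (heis_transform f l k w))\<^sup>2) \<partial>lborel) \<partial>lborel)
    \<le> (\<integral>\<^sup>+l. ennreal C * (\<integral>\<^sup>+z. ennreal ((norm (g l z))\<^sup>2) \<partial>lborel) \<partial>lborel)"
  proof (rule nn_integral_mono)
    fix l :: real
    show "ennreal (\<bar>l\<bar> ^ (2 * CARD('n))) * (\<Sum>k. \<integral>\<^sup>+w. ennreal ((norm (heis_transform f l k w))\<^sup>2) \<partial>lborel)
      \<le> ennreal C * (\<integral>\<^sup>+z. ennreal ((norm (g l z))\<^sup>2) \<partial>lborel)"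
    proof (cases "l = 0")
      case False
      have [measurable]: "g l \<in> borel_measurable borel" unfolding g_def by measurable
      have gi: "integrable lborel (g l)" unfolding g_def by (rule partial_fourier_integrable)
      have "(\<Sum>k. \<integral>\<^sup>+w. ennreal ((norm (heis_transform f l k w))\<^sup>2) \<partial>lborel)
        \<le> ennreal ((8 * pi\<^sup>2 / l\<^sup>2) ^ CARD('n)) * (\<integral>\<^sup>+z. ennreal ((norm (g l z))\<^sup>2) \<partial>lborel)"
        using heis_fixed_frequency_bound[OF False gi] by (simp add: heis_transform_eq[OF False] g_def)
      then have "ennreal (\<bar>l\<bar> ^ (2 * CARD('n))) * (\<Sum>k. \<integral>\<^sup>+w. ennreal ((norm (heis_transform f l k w))\<^sup>2) \<partial>lborel)
        \<le> ennreal (\<bar>l\<bar> ^ (2 * CARD('n))) * (ennreal ((8 * pi\<^sup>2 / l\<^sup>2) ^ CARD('n)) * (\<integral>\<^sup>+z. ennreal ((norm (g l z))\<^sup>2) \<partial>lborel))"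
        by (rule mult_left_mono) simp
      also have "\<dots> = ennreal (\<bar>l\<bar> ^ (2 * CARD('n)) * (8 * pi\<^sup>2 / l\<^sup>2) ^ CARD('n)) * (\<integral>\<^sup>+z. ennreal ((norm (g l z))\<^sup>2) \<partial>lborel)"
        by (simp add: ennreal_mult mult.assoc)
      also have "\<bar>l\<bar> ^ (2 * CARD('n)) * (8 * pi\<^sup>2 / l\<^sup>2) ^ CARD('n) = C"
        using False by (simp add: C_def power_mult power_divide)
      finally show ?thesis .
    qed (simp add: power_0_left)
  qed
  also have "\<dots> = ennreal C * (\<integral>\<^sup>+l. \<integral>\<^sup>+z. ennreal ((norm (g l z))\<^sup>2) \<partial>lborel \<partial>lborel)"
    by (rule nn_integral_cmult) measurable
  also have "(\<integral>\<^sup>+l. \<integral>\<^sup>+z. ennreal ((norm (g l z))\<^sup>2) \<partial>lborel \<partial>lborel) = (\<integral>\<^sup>+z. \<integral>\<^sup>+l. ennreal ((norm (g l z))\<^sup>2) \<partial>lborel \<partial>lborel)"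
    by (rule lborel_pair.Fubini'[symmetric]) measurable
  also have "\<dots> \<le> (\<integral>\<^sup>+z. ennreal (2 * pi) * (\<integral>\<^sup>+t. ennreal ((norm (f (z, t)))\<^sup>2) \<partial>lborel) \<partial>lborel)"
  \<comment> \<open>Almost every z only, since Fubini gives integrability of the section f(z, .) no
    more often.\<close>
  proof (rule nn_integral_mono_AE)
    show "AE z in lborel. (\<integral>\<^sup>+l. ennreal ((norm (g l z))\<^sup>2) \<partial>lborel) \<le> ennreal (2 * pi) * (\<integral>\<^sup>+t. ennreal ((norm (f (z, t)))\<^sup>2) \<partial>lborel)"
      using lborel_pair.AE_integrable_fst'[OF heis_integrable_pair]
      by eventually_elim (simp add: g_def plancherel_real_le)
  qed
  also have "\<dots> = ennreal (2 * pi) * (\<integral>\<^sup>+x. ennreal ((norm (f x))\<^sup>2) \<partial>lborel)"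
  proof -
    have [measurable]: "(\<lambda>x. ennreal ((norm (f x))\<^sup>2)) \<in> borel_measurable (lborel \<Otimes>\<^sub>M lborel)"
      using borel_measurable_integrable[OF heis_integrable_pair] by measurable
    show ?thesis
      by (subst nn_integral_cmult, measurable) (subst lborel.nn_integral_fst, measurable, simp add: lborel_prod)
  qed
  finally show ?thesis
    by (simp add: C_def ennreal_mult mult.assoc mult_left_mono)
qed

end


section \<open>The transform on the fan\<close>

text \<open>Preimages under the two functions differ by null sets, which the completion measures. It
  makes \<open>strichartz_tilde\<close> measurable although it is compared with a Borel function
  only off the ray at infinity.\<close>

lemma borel_measurable_completion_AE:
  fixes f :: "'a \<Rightarrow> 'b::topological_space"
  assumes f: "f \<in> borel_measurable M" and eq: "AE x in M. f x = g x"
  shows "g \<in> borel_measurable (completion M)"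
proof (rule measurableI)
  fix A :: "'b set" assume A: "A \<in> sets borel"
  show "g -` A \<inter> space (completion M) \<in> sets (completion M)"
  proof (rule completion.in_sets_AE[where A = "f -` A \<inter> space M"])
    show "AE x in completion M. (x \<in> f -` A \<inter> space M) = (x \<in> g -` A \<inter> space (completion M))"
      using AE_completion[OF eq] by eventually_elim auto
    show "f -` A \<inter> space M \<in> sets (completion M)"
      using measurable_sets[OF f A] by auto
  qed auto
qed auto

lemma lebesgue_borel_representative:
  fixes f :: "'a::euclidean_space \<Rightarrow> complex"
  assumes f: "f \<in> borel_measurable lebesgue"
  obtains f' where "f' \<in> borel_measurable borel" "AE x in lebesgue. f x = f' x"
proof -
  have "(\<lambda>x. Re (f x)) \<in> borel_measurable lebesgue" "(\<lambda>x. Im (f x)) \<in> borel_measurable lebesgue"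
    using f by measurable
  from this[THEN completion_ex_borel_measurable_real]
  obtain a b where [measurable]: "a \<in> borel_measurable borel" "b \<in> borel_measurable borel"
    and ab: "AE x in lborel. Re (f x) = a x" "AE x in lborel. Im (f x) = b x"
    by (auto simp: measurable_lborel1)
  have "(\<lambda>x. Complex (a x) (b x)) \<in> borel_measurable borel"
    unfolding Complex_eq by measurable
  moreover have "AE x in lebesgue. f x = Complex (a x) (b x)"
    unfolding AE_completion_iff using ab by eventually_elim (simp add: complex_eq_iff)
  ultimately show ?thesis by (rule that)
qed

text \<open>On the ray \<open>\<tau> = (2 k + n) |l|\<close> the floor expression equals \<open>k\<close>; unlike \<open>fan_index\<close>
  it is visibly Borel.\<close>

definition fan_transform :: "(('n::finite) heis \<Rightarrow> complex) \<Rightarrow> (real \<times> real) \<times> (complex ^ 'n) \<Rightarrow> complex" where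
  "fan_transform f = (\<lambda>((l, \<tau>), w). if l = 0 then 0 else
     let k = nat \<lfloor>(\<tau> / \<bar>l\<bar> - CARD('n)) / 2\<rfloor> in heis_transform f l k w / of_real (fan_coeff CARD('n) k))"

lemma fan_transform_ray:
  assumes "l \<noteq> 0"
  shows "fan_transform f ((l, (2 * real k + real CARD('n)) * \<bar>l\<bar>), w :: complex ^ 'n) =
    heis_transform f l k w / of_real (fan_coeff CARD('n) k)"
  using assms by (simp add: fan_transform_def Let_def)

lemma fan_coeff_pos: "fan_coeff n k > 0"
  by (simp add: fan_coeff_def)

text \<open>Changing f on a null set changes none of the defining integrals, so equality holds at
  every point of the Laguerre rays and every w, not merely almost everywhere.\<close>

lemma strichartz_tilde_eq_fan_transform:
  fixes f :: "('n::finite) heis \<Rightarrow> complex"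
  assumes a: "a \<in> heis_fan CARD('n)" "fst a \<noteq> 0"
    and f: "f \<in> borel_measurable lebesgue" and f': "f' \<in> borel_measurable borel" and eq: "AE x in lebesgue. f x = f' x"
  shows "strichartz_tilde f (a, w) = fan_transform f' (a, w)"
proof -
  obtain k where k: "a \<in> fan_ray CARD('n) k"
    using a by (auto simp: heis_fan_def fan_ray_inf_def)
  then obtain l where l: "l \<noteq> 0" "a = (l, (2 * real k + real CARD('n)) * \<bar>l\<bar>)"
    by (auto simp: fan_ray_def)
  have idx: "fan_index CARD('n) a = k" by (rule fan_index_eq[OF k])
  have e: "(\<lambda>x. heis_e k l (heis_mult (heis_inv x) (w, 0))) \<in> borel_measurable borel"
  proof -
    have "(\<lambda>x. heis_e k l (heis_mult (heis_inv (fst x, snd x)) (w, 0))) \<in> borel_measurable (borel \<Otimes>\<^sub>M borel)"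
      by measurable
    then show ?thesis by (simp add: borel_prod)
  qed
  have "(\<integral>x. f x * heis_e k l (heis_mult (heis_inv x) (w, 0)) \<partial>lebesgue)
    = (\<integral>x. f' x * heis_e k l (heis_mult (heis_inv x) (w, 0)) \<partial>lebesgue)"
  proof (rule integral_cong_AE)
    show "(\<lambda>x. f x * heis_e k l (heis_mult (heis_inv x) (w, 0))) \<in> borel_measurable lebesgue"
      using f measurable_completion[of _ lborel borel] e by (intro borel_measurable_times) auto
    show "(\<lambda>x. f' x * heis_e k l (heis_mult (heis_inv x) (w, 0))) \<in> borel_measurable lebesgue"
      using f' e by (intro measurable_completion) auto
    show "AE x in lebesgue. f x * heis_e k l (heis_mult (heis_inv x) (w, 0)) = f' x * heis_e k l (heis_mult (heis_inv x) (w, 0))"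
      using eq by eventually_elim simp
  qed
  also have "\<dots> = heis_transform f' l k w"
    unfolding heis_transform_def using f' e by (intro integral_completion) auto
  finally show ?thesis
    using l idx by (simp add: strichartz_tilde_def strichartz_hat_def fan_transform_ray)
qed

lemma fst_snd_measurable_nu2 [measurable]:
  "fst \<in> borel_measurable (nu2 n)" "snd \<in> borel_measurable (nu2 n)"
  unfolding measurable_cong_sets[OF sets_nu2 refl]
  by (intro measurable_restrict_space1 borel_measurable_continuous_onI continuous_intros)+

text \<open>The ray at infinity is a null set: only l = 0 is mapped into it, and the density
  |l|^(2n) vanishes there because n >= 1.\<close>

lemma AE_fan_fst_nonzero: "AE x in (nu2 CARD('n::finite) \<Otimes>\<^sub>M lborel :: ((real \<times> real) \<times> (complex ^ 'n)) measure). fst (fst x) \<noteq> 0"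
proof -
  let ?A = "{a \<in> space (nu2 CARD('n)). fst a = 0}"
  have A: "?A \<in> sets (nu2 CARD('n))" by measurable
  have ind: "(indicator ?A :: _ \<Rightarrow> ennreal) \<in> borel_measurable (nu2 CARD('n))"
    using A by measurable
  then have h: "(indicator ?A :: _ \<Rightarrow> ennreal) \<in> borel_measurable (restrict_space borel (heis_fan CARD('n)))"
    by (simp only: measurable_cong_sets[OF sets_nu2 refl])
  have 0: "(\<Sum>k. ennreal ((fan_coeff CARD('n) k)\<^sup>2) * indicator ?A (l, (2 * real k + real CARD('n)) * \<bar>l\<bar>))
      * ennreal (\<bar>l\<bar> ^ (2 * CARD('n))) = 0" for l :: real
    by (cases "l = 0") (simp_all add: indicator_def power_0_left)
  have "emeasure (nu2 CARD('n)) ?A = (\<integral>\<^sup>+a. indicator ?A a \<partial>nu2 CARD('n))"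
    using A by simp
  also have "\<dots> = 0"
    unfolding nn_integral_nu2[OF h] 0 by simp
  finally have "emeasure (nu2 CARD('n) \<Otimes>\<^sub>M lborel) (?A \<times> (UNIV :: (complex ^ 'n) set)) = 0"
    using A by (subst lborel.emeasure_pair_measure_Times) auto
  then have "?A \<times> (UNIV :: (complex ^ 'n) set) \<in> null_sets (nu2 CARD('n) \<Otimes>\<^sub>M lborel)"
    using A by (auto intro!: null_setsI pair_measureI)
  then show ?thesis
    by (rule AE_I') (auto simp: space_pair_measure)
qed

lemma fan_transform_measurable:
  fixes f :: "('n::finite) heis \<Rightarrow> complex"
  assumes f: "integrable lborel f"
  shows "fan_transform f \<in> borel_measurable (nu2 CARD('n) \<Otimes>\<^sub>M lborel)"
proof -
  let ?M = "nu2 CARD('n) \<Otimes>\<^sub>M (lborel :: (complex ^ 'n) measure)"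
  define k where "k = (\<lambda>x::(real \<times> real) \<times> (complex ^ 'n). nat \<lfloor>(snd (fst x) / \<bar>fst (fst x)\<bar> - CARD('n)) / 2\<rfloor>)"
  have k [measurable]: "k \<in> ?M \<rightarrow>\<^sub>M count_space UNIV"
    unfolding k_def by measurable
  note [measurable] = heis_transform_measurable[OF f]
  have "(\<lambda>x. if fst (fst x) = 0 then 0 else heis_transform f (fst (fst x)) (k x) (snd x) / of_real (fan_coeff CARD('n) (k x)))
    \<in> borel_measurable ?M"
    by measurable
  also have "(\<lambda>x. if fst (fst x) = 0 then 0 else heis_transform f (fst (fst x)) (k x) (snd x) / of_real (fan_coeff CARD('n) (k x)))
    = fan_transform f"
    by (auto simp: fan_transform_def k_def Let_def fun_eq_iff)
  finally show ?thesis .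
qed

text \<open>The normalizing divisor is exactly the sup bound of phi_k, whence constant 1 for all k
  at once.\<close>

lemma norm_fan_transform_le:
  fixes f :: "('n::finite) heis \<Rightarrow> complex"
  assumes f: "integrable lborel f"
  shows "norm (fan_transform f x) \<le> (\<integral>x. norm (f x) \<partial>lborel)"
proof -
  obtain l \<tau> w where x: "x = ((l, \<tau>), w)" by (metis prod.collapse)
  show ?thesis
  proof (cases "l = 0")
    case False
    have "norm (heis_transform f l k w) / fan_coeff CARD('n) k \<le> (\<integral>x. norm (f x) \<partial>lborel)" for k
      using norm_heis_transform_le[OF f False, of k w]
      by (subst pos_divide_le_eq[OF fan_coeff_pos]) (simp only: mult.commute)
    then show ?thesis
      using False fan_coeff_pos by (simp add: x fan_transform_def Let_def norm_divide abs_of_pos)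
  qed (simp add: x fan_transform_def)
qed

lemma fan_transform_add:
  fixes f g :: "('n::finite) heis \<Rightarrow> complex"
  assumes f: "integrable lborel f" and g: "integrable lborel g"
  shows "fan_transform (\<lambda>x. f x + g x) x = fan_transform f x + fan_transform g x"
proof -
  have "heis_transform (\<lambda>x. f x + g x) l k w = heis_transform f l k w + heis_transform g l k w" if "l \<noteq> 0" for l k w
    using heis_transform_integrable[OF f that] heis_transform_integrable[OF g that]
    by (simp add: heis_transform_def distrib_right)
  then show ?thesis
    by (auto simp: fan_transform_def Let_def add_divide_distrib split: prod.split)
qed

text \<open>This equals \<open>2\<^sup>n\<close>, whereas the sharp constant is 1: the loss comes from dropping \<open>1 + r\<close> in
  \<open>nn_integral_heis_gauss_le\<close>.\<close>

definition plancherel_const :: "nat \<Rightarrow> real" where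
  "plancherel_const n = (2 * pi) powi (- 2 * int n - 1) * ((8 * pi\<^sup>2) ^ n * (2 * pi))"

text \<open>The squared \<open>fan_coeff\<close> in nu_2 cancels the square of the normalizing
  divisor, which leaves the integral of \<open>heis_transform_L2_le\<close>.\<close>

lemma fan_transform_L2_le:
  fixes f :: "('n::finite) heis \<Rightarrow> complex"
  assumes f: "integrable lborel f"
  shows "(\<integral>\<^sup>+x. ennreal ((norm (fan_transform f x))\<^sup>2) \<partial>(nu2 CARD('n) \<Otimes>\<^sub>M lborel))
    \<le> ennreal (plancherel_const CARD('n)) * (\<integral>\<^sup>+x. ennreal ((norm (f x))\<^sup>2) \<partial>lborel)"
proof -
  note [measurable] = fan_transform_measurable[OF f]
  let ?c = "(2 * pi) powi (- 2 * int CARD('n) - 1)"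
  define h where "h = (\<lambda>a. \<integral>\<^sup>+w. ennreal ((norm (fan_transform f (a, w)))\<^sup>2) \<partial>lborel)"
  have "h \<in> borel_measurable (nu2 CARD('n))" unfolding h_def by measurable
  then have h: "h \<in> borel_measurable (restrict_space borel (heis_fan CARD('n)))"
    by (simp cong: measurable_cong_sets add: sets_nu2)
  have "(\<integral>\<^sup>+x. ennreal ((norm (fan_transform f x))\<^sup>2) \<partial>(nu2 CARD('n) \<Otimes>\<^sub>M lborel)) = (\<integral>\<^sup>+a. h a \<partial>nu2 CARD('n))"
    unfolding h_def by (rule lborel.nn_integral_fst[symmetric]) measurable
  also have "\<dots> = ennreal ?c * (\<integral>\<^sup>+ l. (\<Sum>k. ennreal ((fan_coeff CARD('n) k)\<^sup>2) * h (l, (2 * real k + real CARD('n)) * \<bar>l\<bar>))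
               * ennreal (\<bar>l\<bar> ^ (2 * CARD('n))) \<partial>lborel)"
    by (rule nn_integral_nu2[OF h])
  also have "(\<integral>\<^sup>+ l. (\<Sum>k. ennreal ((fan_coeff CARD('n) k)\<^sup>2) * h (l, (2 * real k + real CARD('n)) * \<bar>l\<bar>))
               * ennreal (\<bar>l\<bar> ^ (2 * CARD('n))) \<partial>lborel)
    = (\<integral>\<^sup>+l. ennreal (\<bar>l\<bar> ^ (2 * CARD('n))) * (\<Sum>k. \<integral>\<^sup>+w. ennreal ((norm (heis_transform f l k w))\<^sup>2) \<partial>lborel) \<partial>lborel)"
  proof (rule nn_integral_cong)
    fix l :: real
    show "(\<Sum>k. ennreal ((fan_coeff CARD('n) k)\<^sup>2) * h (l, (2 * real k + real CARD('n)) * \<bar>l\<bar>)) * ennreal (\<bar>l\<bar> ^ (2 * CARD('n)))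
      = ennreal (\<bar>l\<bar> ^ (2 * CARD('n))) * (\<Sum>k. \<integral>\<^sup>+w. ennreal ((norm (heis_transform f l k w))\<^sup>2) \<partial>lborel)"
    proof (cases "l = 0")
      case False
      have "ennreal ((fan_coeff CARD('n) k)\<^sup>2) * h (l, (2 * real k + real CARD('n)) * \<bar>l\<bar>)
        = (\<integral>\<^sup>+w. ennreal ((norm (heis_transform f l k w))\<^sup>2) \<partial>lborel)" for k
      proof -
        have [measurable]: "(\<lambda>w. heis_transform f l k w) \<in> borel_measurable borel"
          by (rule heis_transform_measurable[OF f]) auto
        have "ennreal ((fan_coeff CARD('n) k)\<^sup>2) * h (l, (2 * real k + real CARD('n)) * \<bar>l\<bar>)
          = (\<integral>\<^sup>+w. ennreal ((fan_coeff CARD('n) k)\<^sup>2) * ennreal ((norm (heis_transform f l k w / of_real (fan_coeff CARD('n) k)))\<^sup>2) \<partial>lborel)"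
          unfolding h_def fan_transform_ray[OF False] by (rule nn_integral_cmult[symmetric]) measurable
        also have "\<dots> = (\<integral>\<^sup>+w. ennreal ((norm (heis_transform f l k w))\<^sup>2) \<partial>lborel)"
          using fan_coeff_pos[of "CARD('n)" k]
          by (intro nn_integral_cong) (simp add: norm_divide power_divide flip: ennreal_mult)
        finally show ?thesis .
      qed
      then show ?thesis by (simp add: mult.commute)
    qed (simp add: power_0_left)
  qed
  also have "ennreal ?c * \<dots> \<le> ennreal ?c * (ennreal ((8 * pi\<^sup>2) ^ CARD('n) * (2 * pi)) * (\<integral>\<^sup>+x. ennreal ((norm (f x))\<^sup>2) \<partial>lborel))"
    by (intro mult_left_mono heis_transform_L2_le f) simp
  also have "\<dots> = ennreal (plancherel_const CARD('n)) * (\<integral>\<^sup>+x. ennreal ((norm (f x))\<^sup>2) \<partial>lborel)"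
    unfolding plancherel_const_def by (subst ennreal_mult) (auto simp: mult.assoc)
  finally show ?thesis .
qed

section \<open>Application of the interpolation and passage to L^p\<close>

lemma powr_add_le:
  assumes "a \<ge> 0" "b \<ge> 0" "p \<ge> (0::real)"
  shows "(a + b) powr p \<le> 2 powr p * (a powr p + b powr p)"
proof -
  have "(a + b) powr p \<le> (2 * max a b) powr p"
    using assms by (intro powr_mono2) auto
  also have "\<dots> = 2 powr p * max a b powr p"
    using assms by (simp add: powr_mult)
  also have "\<dots> \<le> 2 powr p * (a powr p + b powr p)"
    by (intro mult_left_mono) (auto simp: max_def)
  finally show ?thesis .
qed

text \<open>Taking q-th powers of the differences reduces the claim to the known subsequence theorem
  for L^1 convergence.\<close>

lemma lp_tendsto_AE_subseq:
  assumes F: "\<And>j. F j \<in> borel_measurable M" and g: "g \<in> borel_measurable M"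
    and lim: "lp_tendsto q M F g" and q: "q > 0"
  obtains r where "filterlim r at_top sequentially" "AE x in M. (\<lambda>j. F (r j) x) \<longlonglongrightarrow> g x"
proof -
  note [measurable] = F g
  define u where "u = (\<lambda>j x. norm (F j x - g x) powr q)"
  have [measurable]: "u j \<in> borel_measurable M" for j unfolding u_def by measurable
  have lim': "(\<lambda>j. \<integral>\<^sup>+x. ennreal (u j x) \<partial>M) \<longlonglongrightarrow> 0"
    using lim by (simp add: lp_tendsto_def u_def)
  then have "eventually (\<lambda>j. (\<integral>\<^sup>+x. ennreal (u j x) \<partial>M) < 1) sequentially"
    by (rule order_tendstoD) simp
  \<comment> \<open>Finitely many differences may have infinite integral, so the sequence is shifted
    past them before L^1 theory applies.\<close>
  then obtain N where N: "\<And>j. j \<ge> N \<Longrightarrow> (\<integral>\<^sup>+x. ennreal (u j x) \<partial>M) < 1"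
    by (auto simp: eventually_sequentially)
  define v where "v = (\<lambda>j. u (j + N))"
  have v: "integrable M (v j)" for j
    unfolding integrable_iff_bounded v_def
    using N[of "j + N"] by (auto simp: u_def intro: less_trans)
  have eq: "(\<integral>\<^sup>+x. ennreal (u (j + N) x) \<partial>M) = ennreal (\<integral>x. norm (v j x) \<partial>M)" for j
    using nn_integral_eq_integral[OF v[of j]] by (simp add: v_def u_def)
  have "(\<lambda>j. ennreal (\<integral>x. norm (v j x) \<partial>M)) \<longlonglongrightarrow> ennreal 0"
    using LIMSEQ_ignore_initial_segment[OF lim', of N] unfolding eq by simp
  then have "(\<lambda>j. \<integral>x. norm (v j x) \<partial>M) \<longlonglongrightarrow> 0"
    by (subst (asm) tendsto_ennreal_iff) auto
  from tendsto_L1_AE_subseq[OF v this] obtain s where s: "strict_mono s" "AE x in M. (\<lambda>n. v (s n) x) \<longlonglongrightarrow> 0"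
    by blast
  show ?thesis
  proof (rule that[of "\<lambda>j. s j + N"])
    show "filterlim (\<lambda>j. s j + N) at_top sequentially"
      using s(1) by (intro filterlim_at_top_mono[OF filterlim_subseq[OF s(1)]]) auto
    show "AE x in M. (\<lambda>j. F (s j + N) x) \<longlonglongrightarrow> g x"
      using s(2)
    proof eventually_elim
      fix x assume x: "(\<lambda>n. v (s n) x) \<longlonglongrightarrow> 0"
      have "(\<lambda>n. v (s n) x powr (1 / q)) \<longlonglongrightarrow> 0"
        by (rule tendsto_zero_powrI[OF x tendsto_const]) (use q in \<open>auto simp: v_def u_def\<close>)
      then have "(\<lambda>n. norm (F (s n + N) x - g x)) \<longlonglongrightarrow> 0"
        using q by (simp add: v_def u_def powr_powr)
      then show "(\<lambda>n. F (s n + N) x) \<longlonglongrightarrow> g x"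
        by (simp add: tendsto_norm_zero_iff LIM_zero_iff)
    qed
  qed
qed

lemma weak_L1_bound:
  assumes "weak_L1 M \<phi>"
  obtains W where "W \<ge> 0" "\<And>s. s > 0 \<Longrightarrow> ennreal s * emeasure M {y \<in> space M. \<phi> y > s} \<le> ennreal W"
proof -
  let ?S = "SUP s\<in>{0<..}. ennreal s * emeasure M {x \<in> space M. \<phi> x > s}"
  have "?S < \<infinity>" using assms by (simp add: weak_L1_def)
  then have "?S = ennreal (enn2real ?S)" by simp
  then have "ennreal s * emeasure M {y \<in> space M. \<phi> y > s} \<le> ennreal (enn2real ?S)" if "s > 0" for s
    using that by (metis (no_types, lifting) SUP_upper greaterThan_iff)
  then show ?thesis by (rule that[OF enn2real_nonneg])
qed

lemma space_fan_measure: "space (fan_measure :: ((real \<times> real) \<times> (complex ^ 'n)) measure) = heis_fan CARD('n) \<times> UNIV"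
  by (simp add: fan_measure_def space_pair_measure space_nu2)

text \<open>The interpolation constant blows up as p tends to 2, so p = 2 is taken directly from the
  L^2 bound.\<close>

lemma fan_transform_paley:
  fixes \<phi> :: "(real \<times> real) \<times> (complex ^ 'n) \<Rightarrow> real"
  assumes pos: "\<And>x. x \<in> heis_fan CARD('n) \<times> UNIV \<Longrightarrow> 0 < \<phi> x"
    and weak: "weak_L1 fan_measure \<phi>" and p: "1 < p" "p \<le> 2"
  obtains C where "C \<ge> 0" "\<And>f. f \<in> L1_L2 lborel \<Longrightarrow>
    (\<integral>\<^sup>+x. ennreal (norm (fan_transform f x) powr p * \<phi> x powr (2 - p)) \<partial>fan_measure)
      \<le> ennreal C * (\<integral>\<^sup>+x. ennreal (norm (f x) powr p) \<partial>lborel)"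
proof -
  let ?M = "fan_measure :: ((real \<times> real) \<times> (complex ^ 'n)) measure"
  have pos': "\<And>x. x \<in> space ?M \<Longrightarrow> 0 < \<phi> x"
    using pos by (simp add: space_fan_measure)
  have m: "\<phi> \<in> borel_measurable ?M" using weak by (simp add: weak_L1_def)
  obtain W where W: "W \<ge> 0" "\<And>s. s > 0 \<Longrightarrow> ennreal s * emeasure ?M {y \<in> space ?M. \<phi> y > s} \<le> ennreal W"
    using weak_L1_bound[OF weak] by blast
  have L2: "(\<integral>\<^sup>+x. ennreal ((norm (fan_transform f x))\<^sup>2) \<partial>?M)
     \<le> ennreal (plancherel_const CARD('n)) * (\<integral>\<^sup>+x. ennreal ((norm (f x))\<^sup>2) \<partial>lborel)"
    if "f \<in> L1_L2 lborel" for f :: "'n heis \<Rightarrow> complex"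
    using fan_transform_L2_le[of f] that by (simp add: L1_L2_def fan_measure_def nn_integral_completion)
  have pc: "plancherel_const CARD('n) \<ge> 0" by (simp add: plancherel_const_def)
  show ?thesis
  proof (cases "p = 2")
    case True
    have "(\<integral>\<^sup>+x. ennreal (norm (fan_transform f x) powr p * \<phi> x powr (2 - p)) \<partial>?M)
      \<le> ennreal (plancherel_const CARD('n)) * (\<integral>\<^sup>+x. ennreal (norm (f x) powr p) \<partial>lborel)"
      if "f \<in> L1_L2 lborel" for f :: "'n heis \<Rightarrow> complex"
    proof -
      have sq: "norm z powr 2 = (norm z)\<^sup>2" for z :: complex
        by (cases "z = 0") (simp_all add: powr_numeral)
      \<comment> \<open>Positivity of phi makes the weight \<open>\<phi> x powr 0\<close> equal to
        1; in HOL \<open>0 powr 0\<close> is 0.\<close>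
      have "(\<integral>\<^sup>+x. ennreal (norm (fan_transform f x) powr p * \<phi> x powr (2 - p)) \<partial>?M)
        = (\<integral>\<^sup>+x. ennreal ((norm (fan_transform f x))\<^sup>2) \<partial>?M)"
        using pos' by (intro nn_integral_cong) (simp add: True sq order_less_imp_not_eq2)
      with L2[OF that] show ?thesis by (simp add: True sq)
    qed
    with pc show ?thesis by (rule that)
  next
    case False
    then have p2: "p < 2" using p by simp
    let ?C = "4 * p * 1 * W / (p - 1) + 4 * p * plancherel_const CARD('n) / (2 - p)"
    have "?C \<ge> 0" using W pc p p2 by simp
    moreover have "(\<integral>\<^sup>+x. ennreal (norm (fan_transform f x) powr p * \<phi> x powr (2 - p)) \<partial>?M)
      \<le> ennreal ?C * (\<integral>\<^sup>+x. ennreal (norm (f x) powr p) \<partial>lborel)"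
      if "f \<in> L1_L2 lborel" for f :: "'n heis \<Rightarrow> complex"
    proof (rule paley_marcinkiewicz[OF lborel.sigma_finite_measure_axioms m pos' W(2) W(1) _ pc _ _ _ L2 that p(1) p2])
      fix f g :: "'n heis \<Rightarrow> complex" assume fg: "f \<in> L1_L2 lborel" "g \<in> L1_L2 lborel"
      then have i: "integrable lborel f" "integrable lborel g" by (auto simp: L1_L2_def)
      show "fan_transform f \<in> borel_measurable ?M"
        unfolding fan_measure_def using fan_transform_measurable[OF i(1)] by (rule measurable_completion)
      show "AE y in ?M. fan_transform (\<lambda>x. f x + g x) y = fan_transform f y + fan_transform g y"
        using fan_transform_add[OF i] by simp
      show "AE y in ?M. norm (fan_transform f y) \<le> 1 * (\<integral>x. norm (f x) \<partial>lborel)"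
        using norm_fan_transform_le[OF i(1)] by simp
    qed simp_all
    ultimately show ?thesis by (rule that)
  qed
qed

text \<open>The bridge between the definitions, which live on completed measures and identify
  functions almost everywhere, and the Borel setting of the estimates.\<close>

lemma strichartz_tilde_borel_representative:
  fixes f :: "('n::finite) heis \<Rightarrow> complex"
  assumes f: "f \<in> lp_space 1 lebesgue \<inter> lp_space 2 lebesgue"
  obtains f' where "f' \<in> L1_L2 lborel" "AE x in lborel. f x = f' x"
    "strichartz_tilde f \<in> borel_measurable fan_measure"
    "AE x in fan_measure. strichartz_tilde f x = fan_transform f' x"
proof -
  have m: "f \<in> borel_measurable lebesgue" using f by (simp add: lp_space_def)
  obtain f' where m': "f' \<in> borel_measurable borel" and eq: "AE x in lebesgue. f x = f' x"
    by (rule lebesgue_borel_representative[OF m])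
  have sq: "norm z powr 2 = (norm z)\<^sup>2" for z :: complex
    by (cases "z = 0") (simp_all add: powr_numeral)
  have ae: "AE x in lborel. f x = f' x" using eq by (simp add: AE_completion_iff)
  have i1: "integrable lebesgue f"
  proof -
    have "integrable lebesgue (\<lambda>x. norm (f x))" using f by (simp add: lp_space_def)
    then show ?thesis using m integrable_norm_iff by blast
  qed
  have mm: "f' \<in> borel_measurable lebesgue" using m' by (intro measurable_completion) simp
  have "integrable lebesgue f'"
    using integrable_cong_AE[OF m mm eq] i1 by simp
  then have i1': "integrable lborel f'"
    using m' by (simp add: integrable_completion)
  have "integrable lebesgue (\<lambda>x. (norm (f x))\<^sup>2)"
    using f by (simp add: lp_space_def sq)
  then have "integrable lebesgue (\<lambda>x. (norm (f' x))\<^sup>2)"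
    by (rule integrable_cong_AE_imp) (use mm eq in \<open>auto elim: eventually_mono\<close>)
  then have "integrable lborel (\<lambda>x. (norm (f' x))\<^sup>2)"
    using m' by (subst (asm) integrable_completion) auto
  with i1' have L: "f' \<in> L1_L2 lborel" by (simp add: L1_L2_def)
  have AE: "AE x in (nu2 CARD('n) \<Otimes>\<^sub>M lborel). fan_transform f' x = strichartz_tilde f x"
    using AE_fan_fst_nonzero[where 'n = 'n] AE_space
  proof eventually_elim
    fix x :: "(real \<times> real) \<times> (complex ^ 'n)"
    assume "fst (fst x) \<noteq> 0" "x \<in> space (nu2 CARD('n) \<Otimes>\<^sub>M lborel)"
    then have "strichartz_tilde f (fst x, snd x) = fan_transform f' (fst x, snd x)"
      by (intro strichartz_tilde_eq_fan_transform[OF _ _ m m' eq]) (auto simp: space_pair_measure space_nu2)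
    then show "fan_transform f' x = strichartz_tilde f x" by simp
  qed
  show ?thesis
  proof (rule that[OF L ae])
    show "strichartz_tilde f \<in> borel_measurable fan_measure"
      unfolding fan_measure_def by (rule borel_measurable_completion_AE[OF fan_transform_measurable[OF i1'] AE])
    show "AE x in fan_measure. strichartz_tilde f x = fan_transform f' x"
      unfolding fan_measure_def using AE_completion[OF AE] by eventually_elim simp
  qed
qed

text \<open>Integrability is part of the conclusion because the Bochner integral of a non-integrable
  function is 0, which would make the inequality empty.\<close>

theorem theorem6p3:
  fixes \<phi> :: "(real \<times> real) \<times> (complex ^ 'n) \<Rightarrow> real" and p :: real
  assumes "\<And>x. x \<in> heis_fan CARD('n) \<times> UNIV \<Longrightarrow> 0 < \<phi> x"
    and "weak_L1 fan_measure \<phi>"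
    and "1 < p" and "p \<le> 2"
  shows "\<exists>C::real. \<forall>f \<in> lp_space p lebesgue. \<forall>g. has_strichartz_tilde p f g \<longrightarrow>
    integrable fan_measure (\<lambda>x. norm (g x) powr p * \<phi> x powr (2 - p)) \<and>
    (\<integral>x. norm (g x) powr p * \<phi> x powr (2 - p) \<partial>fan_measure) powr (1 / p)
      \<le> C * lp_norm p lebesgue f"
proof -
  let ?M = "fan_measure :: ((real \<times> real) \<times> (complex ^ 'n)) measure"
  obtain C\<^sub>0 where C\<^sub>0: "C\<^sub>0 \<ge> 0" and paley: "\<And>f. f \<in> L1_L2 lborel \<Longrightarrow>
    (\<integral>\<^sup>+x. ennreal (norm (fan_transform f x) powr p * \<phi> x powr (2 - p)) \<partial>?M)
      \<le> ennreal C\<^sub>0 * (\<integral>\<^sup>+x. ennreal (norm (f x) powr p) \<partial>lborel)"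
    using fan_transform_paley[OF assms] by blast
  have phi [measurable]: "\<phi> \<in> borel_measurable ?M" using assms(2) by (simp add: weak_L1_def)
  \<comment> \<open>The factor \<open>2 powr p\<close> pays for comparing |F j|^p with |f|^p + |F j
    - f|^p; it spares Minkowski's inequality.\<close>
  define C where "C = C\<^sub>0 * 2 powr p"
  have C: "C \<ge> 0" using C\<^sub>0 by (simp add: C_def)
  have main: "integrable ?M (\<lambda>x. norm (g x) powr p * \<phi> x powr (2 - p)) \<and>
    (\<integral>x. norm (g x) powr p * \<phi> x powr (2 - p) \<partial>?M) powr (1 / p) \<le> C powr (1 / p) * lp_norm p lebesgue f"
    if f: "f \<in> lp_space p lebesgue" and fg: "has_strichartz_tilde p f g" for f g
  proof -
    from fg obtain F where g: "g \<in> lp_space (p / (p - 1)) ?M"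
      and F: "\<And>j. F j \<in> lp_space 1 lebesgue \<inter> lp_space 2 lebesgue"
      and Ff: "lp_tendsto p lebesgue F f"
      and Fg: "lp_tendsto (p / (p - 1)) ?M (\<lambda>j. strichartz_tilde (F j)) g"
      by (auto simp: has_strichartz_tilde_def)
    have gm [measurable]: "g \<in> borel_measurable ?M" using g by (simp add: lp_space_def)
    have fm [measurable]: "f \<in> borel_measurable lebesgue" and fi: "integrable lebesgue (\<lambda>x. norm (f x) powr p)"
      using f by (auto simp: lp_space_def)
    have Fm [measurable]: "F j \<in> borel_measurable lebesgue" for j using F[of j] by (simp add: lp_space_def)
    have Tm [measurable]: "strichartz_tilde (F j) \<in> borel_measurable ?M" for j
      using strichartz_tilde_borel_representative[OF F[of j]] by blast
    \<comment> \<open>Convergence in L^(p') says nothing directly about the weighted L^p norm. An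
      almost everywhere convergent subsequence is enough, since Fatou needs no more.\<close>
    obtain r where r: "filterlim r at_top sequentially"
      and lim: "AE x in ?M. (\<lambda>j. strichartz_tilde (F (r j)) x) \<longlonglongrightarrow> g x"
      using lp_tendsto_AE_subseq[OF Tm gm Fg] assms(3) by auto
    define d where "d = (\<lambda>j. \<integral>\<^sup>+x. ennreal (norm (F j x - f x) powr p) \<partial>lebesgue)"
    define I where "I = (\<integral>\<^sup>+x. ennreal (norm (f x) powr p) \<partial>lebesgue)"
    have "d \<longlonglongrightarrow> 0" using Ff by (simp add: lp_tendsto_def d_def)
    then have dr: "(\<lambda>j. d (r j)) \<longlonglongrightarrow> 0" using r by (rule filterlim_compose)
    have bound: "(\<integral>\<^sup>+x. ennreal (norm (strichartz_tilde (F j) x) powr p * \<phi> x powr (2 - p)) \<partial>?M)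
       \<le> ennreal C * (I + d j)" for j
    proof -
      obtain f' where f': "f' \<in> L1_L2 lborel" "AE x in lborel. F j x = f' x"
        "AE x in ?M. strichartz_tilde (F j) x = fan_transform f' x"
        using strichartz_tilde_borel_representative[OF F[of j]] by blast
      have "(\<integral>\<^sup>+x. ennreal (norm (strichartz_tilde (F j) x) powr p * \<phi> x powr (2 - p)) \<partial>?M)
        = (\<integral>\<^sup>+x. ennreal (norm (fan_transform f' x) powr p * \<phi> x powr (2 - p)) \<partial>?M)"
        using f'(3) by (intro nn_integral_cong_AE) (auto elim: eventually_mono)
      also have "\<dots> \<le> ennreal C\<^sub>0 * (\<integral>\<^sup>+x. ennreal (norm (f' x) powr p) \<partial>lborel)"
        by (rule paley[OF f'(1)])
      also have "(\<integral>\<^sup>+x. ennreal (norm (f' x) powr p) \<partial>lborel) = (\<integral>\<^sup>+x. ennreal (norm (F j x) powr p) \<partial>lebesgue)"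
        unfolding nn_integral_completion using f'(2) by (intro nn_integral_cong_AE) (auto elim: eventually_mono)
      also have "\<dots> \<le> (\<integral>\<^sup>+x. ennreal (2 powr p) * (ennreal (norm (f x) powr p) + ennreal (norm (F j x - f x) powr p)) \<partial>lebesgue)"
      proof (rule nn_integral_mono)
        fix x
        have "norm (F j x) \<le> norm (f x) + norm (F j x - f x)"
          using norm_triangle_ineq[of "f x" "F j x - f x"] by simp
        then have "norm (F j x) powr p \<le> (norm (f x) + norm (F j x - f x)) powr p"
          using assms(3) by (intro powr_mono2) auto
        also have "\<dots> \<le> 2 powr p * (norm (f x) powr p + norm (F j x - f x) powr p)"
          using assms(3) by (intro powr_add_le) auto
        finally show "ennreal (norm (F j x) powr p) \<le> ennreal (2 powr p) * (ennreal (norm (f x) powr p) + ennreal (norm (F j x - f x) powr p))"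
          by (simp add: ennreal_leI flip: ennreal_mult ennreal_plus)
      qed
      also have "\<dots> = ennreal (2 powr p) * (I + d j)"
        unfolding I_def d_def by (simp add: nn_integral_cmult nn_integral_add)
      also have "ennreal C\<^sub>0 * (ennreal (2 powr p) * (I + d j)) = ennreal C * (I + d j)"
        using C\<^sub>0 by (simp add: C_def ennreal_mult mult.assoc)
      finally show ?thesis by (simp add: mult_left_mono)
    qed
    have I: "I = ennreal (\<integral>x. norm (f x) powr p \<partial>lebesgue)"
      unfolding I_def using fi by (rule nn_integral_eq_integral) auto
    have nn: "(\<integral>\<^sup>+x. ennreal (norm (g x) powr p * \<phi> x powr (2 - p)) \<partial>?M) \<le> ennreal C * I"
    proof (rule nn_integral_le_of_AE_limit[OF _ _ bound])
      show "(\<lambda>j. ennreal C * (I + d (r j))) \<longlonglongrightarrow> ennreal C * I"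
        using ennreal_tendsto_cmult[OF _ tendsto_add[OF tendsto_const dr], of "ennreal C" I] by simp
      show "AE x in ?M. (\<lambda>j. ennreal (norm (strichartz_tilde (F (r j)) x) powr p * \<phi> x powr (2 - p)))
          \<longlonglongrightarrow> ennreal (norm (g x) powr p * \<phi> x powr (2 - p))"
        using lim
      proof eventually_elim
        fix x assume "(\<lambda>j. strichartz_tilde (F (r j)) x) \<longlonglongrightarrow> g x"
        then have "(\<lambda>j. norm (strichartz_tilde (F (r j)) x) powr p) \<longlonglongrightarrow> norm (g x) powr p"
          by (intro tendsto_powr' tendsto_norm tendsto_const) (use assms(3) in auto)
        then show "(\<lambda>j. ennreal (norm (strichartz_tilde (F (r j)) x) powr p * \<phi> x powr (2 - p)))
          \<longlonglongrightarrow> ennreal (norm (g x) powr p * \<phi> x powr (2 - p))"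
          by (intro tendsto_ennrealI tendsto_mult tendsto_const)
      qed
    qed measurable
    also have "ennreal C * I = ennreal (C * (\<integral>x. norm (f x) powr p \<partial>lebesgue))"
      unfolding I using C by (simp add: ennreal_mult)
    finally have fin: "(\<integral>\<^sup>+x. ennreal (norm (g x) powr p * \<phi> x powr (2 - p)) \<partial>?M)
       \<le> ennreal (C * (\<integral>x. norm (f x) powr p \<partial>lebesgue))" .
    have int: "integrable ?M (\<lambda>x. norm (g x) powr p * \<phi> x powr (2 - p))"
    proof (rule integrableI_bounded)
      show "(\<integral>\<^sup>+x. ennreal (norm (norm (g x) powr p * \<phi> x powr (2 - p))) \<partial>?M) < \<infinity>"
        using fin by (auto simp: intro: le_less_trans)
    qed measurable
    have "(\<integral>x. norm (g x) powr p * \<phi> x powr (2 - p) \<partial>?M) \<le> C * (\<integral>x. norm (f x) powr p \<partial>lebesgue)"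
      using fin C by (subst (asm) nn_integral_eq_integral[OF int]) (auto simp: ennreal_le_iff)
    then have "(\<integral>x. norm (g x) powr p * \<phi> x powr (2 - p) \<partial>?M) powr (1 / p)
       \<le> (C * (\<integral>x. norm (f x) powr p \<partial>lebesgue)) powr (1 / p)"
      using assms(3) by (intro powr_mono2) (auto intro!: integral_nonneg_AE)
    also have "\<dots> = C powr (1 / p) * lp_norm p lebesgue f"
      using C by (simp add: lp_norm_def powr_mult)
    finally show ?thesis using int by blast
  qed
  then show ?thesis by blast
qed

end
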